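(* Let $m_1,m_2$ be positive integers and let $f_1,\ldots,f_{m_1}$ and $g_1,\ldots,g_{m_2}$ be radial functions in $L^\infty(\mathbb{D})$, none of which is the zero function. Suppose $f\in L^2(\mathbb{D},\mathrm{d}A)$ is such that the (densely defined) operator $T_{g_1}\cdots T_{g_{m_2}}T_fT_{f_1}\cdots T_{f_{m_1}}$ on $A^2$ has finite rank. Then $f$ is the zero function, i.e. $f=0$ almost everywhere on $\mathbb{D}$.
   Context: $\mathbb{D}$ is the open unit disk in $\mathbb{C}$ and $\mathrm{d}A=\frac1\pi\mathrm{d}x\,\mathrm{d}y$ is normalized Lebesgue measure on $\mathbb{D}$. $A^2$ is the Bergman space, the closed subspace of holomorphic functions in $L^2=L^2(\mathbb{D},\mathrm{d}A)$, and $P:L^2\to A^2$ is the orthogonal projection. $H^\infty$ is the space of bounded holomorphic functions on $\mathbb{D}$. For $f\in L^2$, the Toeplitz operator $T_f$ is densely defined on $A^2$ by $T_f\varphi=P(f\varphi)$ for $\varphi\in H^\infty$; if $f\in L^\infty(\mathbb{D})$, then $T_f$ extends to a bounded operator on all of $A^2$, $T_f\varphi=P(f\varphi)$ for $\varphi\in A^2$. A function $h$ on $\mathbb{D}$ is radial if $h(z)=h(|z|)$ for almost all $z\in\mathbb{D}$. Functions are identified when equal almost everywhere, so "not the zero function" means not almost everywhere zero. For bounded radial $h$, $T_h$ is diagonal with respect to the orthonormal basis $e_m(z)=\sqrt{m+1}\,z^m$, $m=0,1,2,\ldots$, of $A^2$, hence maps the space $\mathcal{P}$ of polynomials in $z$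 into itself; therefore the product operator in the claim is defined on $\mathcal{P}$, which is dense in $A^2$. "Finite rank" means that the image of $\mathcal{P}$ under the product operator is finite-dimensional. *)

theory Defs
  imports "HOL-Complex_Analysis.Complex_Analysis"
begin

text \<open>Elements of \<open>L\<^sup>2\<close> and \<open>L\<^sup>\<infinity>\<close> are represented by functions on all of
  \<^typ>\<open>complex\<close>; values outside the open unit disk are irrelevant.\<close>

abbreviation unit_disk :: "complex set" where
  "unit_disk \<equiv> ball 0 1"

definition dA :: "complex measure" where
  "dA = density (lebesgue_on unit_disk) (\<lambda>_. ennreal (1 / pi))"

definition L2 :: "(complex \<Rightarrow> complex) set" where
  "L2 = {f. f \<in> borel_measurable dA \<and> integrable dA (\<lambda>z. (cmod (f z))\<^sup>2)}"

definition Linf :: "(complex \<Rightarrow> complex) set" where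
  "Linf = {f. f \<in> borel_measurable dA \<and> (\<exists>C. AE z in dA. cmod (f z) \<le> C)}"

definition L2_inner :: "(complex \<Rightarrow> complex) \<Rightarrow> (complex \<Rightarrow> complex) \<Rightarrow> complex" where
  "L2_inner f g = (LINT z|dA. f z * cnj (g z))"

text \<open>Elements of the Bergman space are normalized to vanish outside the disk, so that an
  a.e.-class containing a holomorphic function has exactly one representative here.\<close>

definition bergman_space :: "(complex \<Rightarrow> complex) set" where
  "bergman_space =
     {f \<in> L2. f holomorphic_on unit_disk \<and> (\<forall>z. z \<notin> unit_disk \<longrightarrow> f z = 0)}"

definition bergman_proj :: "(complex \<Rightarrow> complex) \<Rightarrow> complex \<Rightarrow> complex" where
  "bergman_proj f =
     (THE g. g \<in> bergman_space \<and> (\<forall>h \<in> bergman_space. L2_inner (\<lambda>z. f z - g z) h = 0))"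

text \<open>A total function, meaningful at \<open>\<phi>\<close> whenever the pointwise product lies in \<open>L\<^sup>2\<close>: for
  \<open>f \<in> L\<^sup>2\<close> and \<open>\<phi>\<close> bounded holomorphic, and for \<open>f \<in> L\<^sup>\<infinity>\<close> and every \<open>\<phi>\<close> in the Bergman space.\<close>

definition toeplitz :: "(complex \<Rightarrow> complex) \<Rightarrow> (complex \<Rightarrow> complex) \<Rightarrow> complex \<Rightarrow> complex" where
  "toeplitz f \<phi> = bergman_proj (\<lambda>z. f z * \<phi> z)"

text \<open>The condition \<open>h z = h \<bar>z\<bar>\<close> evaluates \<open>h\<close> on the null set \<open>[0,1)\<close>, hence depends on
  the representative; an a.e.-class is radial if some representative of it satisfies the equation
  almost everywhere.\<close>

definition radial :: "(complex \<Rightarrow> complex) \<Rightarrow> bool" where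
  "radial h \<longleftrightarrow> (\<exists>h'. (AE z in dA. h z = h' z) \<and> (AE z in dA. h' z = h' (of_real (cmod z))))"

definition disk_polynomials :: "(complex \<Rightarrow> complex) set" where
  "disk_polynomials = {\<lambda>z. if z \<in> unit_disk then poly p z else 0 | p. True}"

text \<open>Finite dimension of the image \<open>T ` V\<close>: it lies in the complex span of finitely many
  functions.\<close>

definition finite_rank_on ::
  "(complex \<Rightarrow> complex) set \<Rightarrow> ((complex \<Rightarrow> complex) \<Rightarrow> complex \<Rightarrow> complex) \<Rightarrow> bool" where
  "finite_rank_on V T \<longleftrightarrow>
     (\<exists>B. finite B \<and> (\<forall>\<phi> \<in> V. \<exists>c. \<forall>z \<in> unit_disk. T \<phi> z = (\<Sum>b\<in>B. c b * b z)))"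

end

(*
  Write a j k for the integral of f z^j cnj(z)^k over the disk. A Toeplitz operator with bounded
  radial symbol multiplies the k-th Taylor coefficient by a number depending on k only, so the
  (j, k) matrix entry of the product operator is alpha j * beta k * a j k. Finite rank makes all
  minors of a certain size N of the matrix (a j k) vanish as long as the indices avoid the zeros of
  alpha and beta. These zeros are sparse (the reciprocals are summable), because they are zeros of
  Mellin transforms, which are bounded and holomorphic in a half plane, where a Blaschke estimate
  applies. The same uniqueness argument for the bounded holomorphic function
  t |-> det (integral of f z^(J i) cnj(z)^(K l) |z|^(2t)) shows that all N-minors for the function
  f |z|^2 vanish, with no restriction on the indices. This is the situation of Luecking's theorem,
  which says that f |z|^2 = 0. It is proved here as follows. If m > 0 is the rank of the moment
  matrix, an m-minor of the moments of u exp(mu z) exp(nu cnj z) factors as U(mu) V(nu) with U, V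
  entire. On nu = - cnj mu the exponential has modulus 1, so mu |-> U(mu) cnj(V(- cnj mu)) is
  bounded and entire, hence constant. By the Riemann-Lebesgue lemma the constant is 0, whereas at
  mu = 0 it is the squared modulus of a nonzero minor of the moment matrix.
*)
theory Submission
  imports Defs "Jordan_Normal_Form.Determinant"
begin

section \<open>Lebesgue measure on the disk\<close>

text \<open>Rank conditions are carried as vanishing minors because a determinant is polynomial in
  its entries: when the entries depend holomorphically and boundedly on t, so does the minor, and a
  statement about many integers t becomes one about the zeros of a single function. At a positive
  integer t the determinant in t is the minor with all indices raised by t, and raising indices
  keeps the forbidden index set sparse. The point t = 0, which would give f itself, lies on the
  boundary of the half plane; t = 1 is the first usable integer, and this is where the factor |z|^2
  comes from. It is harmless, since it vanishes only at the origin. A nonzero minor of maximal size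
  m fixes m rows and m columns through which every moment factors. The factorization holds moment by
  moment, so it survives multiplication of u by exponentials, and the multiplicativity of
  determinants splits U from V. On the operator side everything is tested against monomials: the
  inner products with z^k determine an element of the Bergman space, which reduces projections and
  Toeplitz operators to integrals.\<close>

lemma lborel_complex_eq_distr_pair:
  "(lborel :: complex measure) = distr (lborel \<Otimes>\<^sub>M lborel) borel (\<lambda>(x, y). Complex x y)"
proof (rule lborel_eqI)
  have m: "(\<lambda>(x, y). Complex x y) \<in> borel_measurable (lborel \<Otimes>\<^sub>M lborel)"
    by (simp add: Complex_eq split_beta')
  fix l u :: complex
  assume le: "\<And>b. b \<in> Basis \<Longrightarrow> l \<bullet> b \<le> u \<bullet> b"
  have "Re l \<le> Re u" "Im l \<le> Im u"
    using le[of 1] le[of \<i>] by (auto simp: Basis_complex_def inner_complex_def)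
  moreover have "(\<lambda>(x, y). Complex x y) -` box l u = {Re l<..<Re u} \<times> {Im l<..<Im u}"
    by (auto simp: in_box_complex_iff)
  ultimately show "emeasure (distr (lborel \<Otimes>\<^sub>M lborel) borel (\<lambda>(x, y). Complex x y)) (box l u)
      = (\<Prod>b\<in>Basis. (u - l) \<bullet> b)"
    using m by (subst emeasure_distr)
      (auto simp: space_pair_measure lborel.emeasure_pair_measure_Times Basis_complex_def
        inner_complex_def ennreal_mult)
qed simp

lemma distr_lborel_pair_shear_snd:
  "distr (lborel \<Otimes>\<^sub>M lborel) (lborel \<Otimes>\<^sub>M lborel) (\<lambda>(x, y). (x, y + t * x))
    = (lborel \<Otimes>\<^sub>M lborel :: (real \<times> real) measure)" (is "distr ?P _ ?f = _")
proof (rule measure_eqI)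
  have m [measurable]: "?f \<in> ?P \<rightarrow>\<^sub>M ?P"
    by measurable
  fix A assume "A \<in> sets (distr ?P ?P ?f)"
  then have A [measurable]: "A \<in> sets ?P" by simp
  have B: "?f -` A \<inter> space ?P \<in> sets ?P"
    using m A by (rule measurable_sets)
  have *: "emeasure lborel (Pair x -` (?f -` A \<inter> space ?P)) = emeasure lborel (Pair x -` A)" for x
  proof -
    have "Pair x -` (?f -` A \<inter> space ?P) = (+) (t * x) -` (Pair x -` A) \<inter> space lborel"
      by (auto simp: space_pair_measure add.commute)
    moreover have "Pair x -` A \<in> sets borel"
      using sets_Pair1[OF A] by simp
    ultimately have "emeasure lborel (Pair x -` (?f -` A \<inter> space ?P))
        = emeasure (distr lborel borel ((+) (t * x))) (Pair x -` A)"
      by (subst emeasure_distr) auto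
    then show ?thesis
      by (simp add: lborel_distr_plus)
  qed
  show "emeasure (distr ?P ?P ?f) A = emeasure ?P A"
    by (simp only: emeasure_distr[OF m A] lborel.emeasure_pair_measure_alt[OF A]
        lborel.emeasure_pair_measure_alt[OF B] *)
qed simp

text \<open>Conjugating the other shear with the swap of the coordinates gives this one.\<close>

lemma distr_lborel_pair_shear_fst:
  "distr (lborel \<Otimes>\<^sub>M lborel) (lborel \<Otimes>\<^sub>M lborel) (\<lambda>(x, y). (x + t * y, y))
    = (lborel \<Otimes>\<^sub>M lborel :: (real \<times> real) measure)" (is "distr ?P _ ?f = _")
proof -
  let ?s = "\<lambda>(x :: real, y :: real). (y, x)" and ?g = "\<lambda>(x :: real, y :: real). (x, y + t * x)"
  have swap: "distr ?P ?P ?s = ?P"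
    by (rule lborel_pair.distr_pair_swap[symmetric])
  have ms: "?s \<in> ?P \<rightarrow>\<^sub>M ?P" and mg: "?g \<in> ?P \<rightarrow>\<^sub>M ?P"
    by measurable
  have "?P = distr (distr (distr ?P ?P ?s) ?P ?g) ?P ?s"
    by (simp only: swap distr_lborel_pair_shear_snd)
  also have "\<dots> = distr ?P ?P (?s \<circ> (?g \<circ> ?s))"
    by (simp only: distr_distr[OF mg ms] distr_distr[OF ms measurable_comp[OF ms mg]] comp_assoc)
  also have "?s \<circ> (?g \<circ> ?s) = ?f"
    by auto
  finally show ?thesis by (rule sym)
qed

text \<open>A rotation is a product of three shears, and each shear preserves the measure by Fubini.\<close>

lemma distr_lborel_rotation:
  fixes c :: complex
  assumes c: "cmod c = 1" and Im: "Im c \<noteq> 0"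
  shows "distr lborel borel ((*) c) = lborel"
proof -
  let ?P = "lborel \<Otimes>\<^sub>M lborel :: (real \<times> real) measure"
  \<comment> \<open>For c = cos a + i sin a this is tan (a / 2). The two identities below are s sin
    a = 1 - cos a and s (1 + cos a) = sin a; the denominator is the reason for
    \<open>Im c \<noteq> 0\<close>.\<close>
  define s where "s = (1 - Re c) / Im c"
  let ?f = "\<lambda>(x :: real, y :: real). (x + (- s) * y, y)"
  let ?g = "\<lambda>(x :: real, y :: real). (x, y + Im c * x)"
  let ?C = "\<lambda>(x, y). Complex x y"
  have mf: "?f \<in> ?P \<rightarrow>\<^sub>M ?P" and mg: "?g \<in> ?P \<rightarrow>\<^sub>M ?P"
    by measurable
  have mC: "?C \<in> borel_measurable ?P"
    by (simp add: Complex_eq split_beta')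
  have mc: "(*) c \<in> borel_measurable borel" by simp
  have sq: "Re c * Re c + Im c * Im c = 1"
    using c cmod_power2[of c] by (simp add: power2_eq_square)
  have s1: "s * Im c = 1 - Re c"
    using Im by (simp add: s_def)
  have s2: "s + s * Re c = Im c"
  proof -
    have "Im c * (s + s * Re c) = (1 - Re c) * (1 + Re c)"
      by (simp add: algebra_simps flip: s1)
    also have "\<dots> = Im c * Im c"
      using sq by (simp add: algebra_simps)
    finally show ?thesis using Im by simp
  qed
  have shears: "?C \<circ> ?f \<circ> ?g \<circ> ?f = (*) c \<circ> ?C"
  proof (rule ext, clarify)
    fix x y
    have "(x - s * y) - s * (y + Im c * (x - s * y)) = x * (1 - s * Im c) - y * (s + s * (1 - s * Im c))"
      by (simp add: algebra_simps)
    also have "\<dots> = Re c * x - Im c * y"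
      using s1 s2 by simp
    finally have "(x - s * y) - s * (y + Im c * (x - s * y)) = Re c * x - Im c * y" .
    moreover have "y + Im c * (x - s * y) = y * (1 - s * Im c) + Im c * x"
      by (simp add: algebra_simps)
    ultimately show "(?C \<circ> ?f \<circ> ?g \<circ> ?f) (x, y) = ((*) c \<circ> ?C) (x, y)"
      using s1 by (simp add: complex_eq_iff)
  qed
  have "lborel = distr (distr (distr (distr ?P ?P ?f) ?P ?g) ?P ?f) borel ?C"
    by (simp only: distr_lborel_pair_shear_fst distr_lborel_pair_shear_snd lborel_complex_eq_distr_pair)
  also have "\<dots> = distr ?P borel (?C \<circ> ?f \<circ> ?g \<circ> ?f)"
    by (simp only: distr_distr[OF mg mf] distr_distr[OF mf measurable_comp[OF mf mg]] comp_assoc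
        distr_distr[OF mC measurable_comp[OF measurable_comp[OF mf mg] mf]])
  also have "\<dots> = distr (distr ?P borel ?C) borel ((*) c)"
    by (simp only: shears distr_distr[OF mc mC])
  also have "\<dots> = distr lborel borel ((*) c)"
    by (simp only: lborel_complex_eq_distr_pair)
  finally show ?thesis by (rule sym)
qed

text \<open>In the imaginary direction the integral runs over an interval of length 2, a whole
  number of periods of the exponential, so Fubini gives zero. This is the orthogonality behind the
  Riemann-Lebesgue lemma on the disk.\<close>

lemma integral_lborel_square_exp:
  fixes n :: int
  assumes "n \<noteq> 0"
  shows "(LINT z|lborel. indicator (cbox (Complex (-1) (-1)) (Complex 1 1)) z *
    exp (\<i> * of_real (pi * n * Im z))) = 0"
proof -
  let ?P = "lborel \<Otimes>\<^sub>M lborel :: (real \<times> real) measure"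
  let ?C = "\<lambda>(x, y). Complex x y"
  let ?I = "\<lambda>x::real. indicator {-1..1} x :: complex"
  let ?e = "\<lambda>y. exp (\<i> * of_real (pi * n * y)) :: complex"
  let ?F = "\<lambda>z. indicator (cbox (Complex (-1) (-1)) (Complex 1 1)) z * ?e (Im z)"
  have mC [measurable]: "?C \<in> borel_measurable ?P"
    by (simp add: Complex_eq split_beta')
  have mF [measurable]: "?F \<in> borel_measurable borel"
    by (intro borel_measurable_times borel_measurable_indicator borel_measurable_continuous_onI
        continuous_intros) auto
  have indC: "indicator (cbox (Complex (-1) (-1)) (Complex 1 1)) (Complex x y) = ?I x * ?I y" for x y
    by (auto simp: in_cbox_complex_iff indicator_def)
  have ie: "integrable lborel (\<lambda>y. ?I y * ?e y)"
  proof -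
    have "set_integrable lborel {-1..1} ?e"
      by (intro borel_integrable_atLeastAtMost' continuous_intros)
    then show ?thesis
      by (simp add: set_integrable_def scaleR_conv_of_real of_real_indicator)
  qed
  define k where "k = \<i> * pi * n"
  have k: "k \<noteq> 0" "?e = (\<lambda>y. exp (k * of_real y))"
    using assms by (simp_all add: k_def mult_ac)
  have "((\<lambda>y. exp (k * of_real y)) has_integral (exp (k * of_real 1) / k - exp (k * of_real (-1)) / k)) {-1..1}"
  proof (rule fundamental_theorem_of_calculus)
    fix y :: real
    have "((\<lambda>z. exp (k * z) / k) has_field_derivative exp (k * of_real y)) (at (of_real y))"
      using k by (auto intro!: derivative_eq_intros)
    then show "((\<lambda>y. exp (k * of_real y) / k) has_vector_derivative exp (k * of_real y)) (at y within {-1..1})"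
      by (rule has_vector_derivative_real_field)
  qed simp
  moreover have "exp (k * of_real 1) = exp (k * of_real (-1))"
    by (subst exp_eq) (rule exI[of _ n], simp add: k_def)
  ultimately have "((\<lambda>y. exp (k * of_real y)) has_integral 0) {-1..1}"
    by simp
  then have "integral {-1..1} ?e = 0"
    unfolding k(2) by (rule integral_unique)
  moreover have "(LINT y|lborel. ?I y * ?e y) = integral {-1..1} ?e"
  proof -
    have "set_integrable lborel {-1..1} ?e"
      using ie by (simp add: set_integrable_def scaleR_conv_of_real of_real_indicator)
    from set_borel_integral_eq_integral(2)[OF this] show ?thesis
      by (simp add: set_lebesgue_integral_def scaleR_conv_of_real of_real_indicator)
  qed
  ultimately have e0: "(LINT y|lborel. ?I y * ?e y) = 0" by simp
  have "(LINT z|lborel. ?F z) = (LINT p|?P. ?F (?C p))"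
    by (subst lborel_complex_eq_distr_pair) (rule integral_distr; measurable)
  also have "\<dots> = (LINT p|?P. (case p of (x, y) \<Rightarrow> ?I x * (?I y * ?e y)))"
    by (intro Bochner_Integration.integral_cong) (simp_all add: indC split_beta' mult.assoc)
  also have "\<dots> = 0"
  \<comment> \<open>The Bochner integral of a non-integrable function is 0 by convention, so the
    iterated integral has to be computed only in the integrable case.\<close>
  proof (cases "integrable ?P (\<lambda>(x, y). ?I x * (?I y * ?e y))")
    case True
    have "(LINT x|lborel. LINT y|lborel. ?I x * (?I y * ?e y)) = 0"
      by (simp only: integral_mult_right_zero e0 mult_zero_right Bochner_Integration.integral_zero)
    then show ?thesis
      using lborel_pair.integral_fst[OF True] by (simp only:)
  qed (simp add: not_integrable_integral_eq)
  finally show ?thesis .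
qed

section \<open>The normalized area measure on the disk and its rotation invariance\<close>

lemma space_dA [simp]: "space dA = unit_disk"
  by (simp add: dA_def space_restrict_space)

lemma emeasure_unit_disk_finite: "emeasure lborel unit_disk < \<infinity>"
  by (rule emeasure_bounded_finite) simp

lemma finite_measure_dA: "finite_measure dA"
proof (rule finite_measureI)
  have "emeasure dA (space dA) = (\<integral>\<^sup>+z. ennreal (1 / pi) * indicator unit_disk z \<partial>lebesgue_on unit_disk)"
    unfolding space_dA dA_def by (subst emeasure_density) auto
  also have "\<dots> = ennreal (1 / pi) * emeasure lborel unit_disk"
    by (subst nn_integral_cmult_indicator) (auto simp: emeasure_restrict_space)
  also have "\<dots> < \<infinity>"
    using emeasure_unit_disk_finite by (simp add: ennreal_mult_less_top)
  finally show "emeasure dA (space dA) \<noteq> \<infinity>" by simp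
qed

interpretation dA: finite_measure dA
  by (rule finite_measure_dA)

lemma borel_measurable_dA:
  assumes "f \<in> borel_measurable borel"
  shows "f \<in> borel_measurable dA"
  using measurable_restrict_space1[OF measurable_completion[of f lborel borel], of unit_disk] assms
  by (simp add: dA_def)

lemma continuous_on_imp_borel_measurable_dA:
  fixes f :: "complex \<Rightarrow> 'a::real_normed_vector"
  assumes "continuous_on unit_disk f"
  shows "f \<in> borel_measurable dA"
  using continuous_imp_measurable_on_sets_lebesgue[OF assms] by (simp add: dA_def)

lemma AE_dA_iff: "(AE z in dA. P z) \<longleftrightarrow> (AE z in lborel. z \<in> unit_disk \<longrightarrow> P z)"
  unfolding dA_def
  by (simp add: AE_density AE_restrict_space_iff AE_completion_iff)

lemma integral_dA_borel:
  fixes F :: "complex \<Rightarrow> complex"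
  assumes F [measurable]: "F \<in> borel_measurable borel"
  shows "(LINT z|dA. F z) = of_real (1 / pi) * (LINT z|lborel. indicator unit_disk z * F z)"
proof -
  have F': "F \<in> borel_measurable (lebesgue_on unit_disk)"
    using borel_measurable_dA[OF F] by (simp add: dA_def)
  have "(LINT z|dA. F z) = (LINT z|lebesgue_on unit_disk. (1 / pi) *\<^sub>R F z)"
    unfolding dA_def using F' by (subst integral_density) auto
  also have "\<dots> = (1 / pi) *\<^sub>R (LINT z|lebesgue_on unit_disk. F z)"
    by simp
  also have "(LINT z|lebesgue_on unit_disk. F z) = (LINT z|lebesgue. indicator unit_disk z *\<^sub>R F z)"
    by (subst integral_restrict_space) auto
  also have "\<dots> = (LINT z|lborel. indicator unit_disk z *\<^sub>R F z)"
    by (intro integral_completion borel_measurable_scaleR borel_measurable_indicator) auto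
  finally show ?thesis
    by (simp add: scaleR_conv_of_real of_real_indicator)
qed

text \<open>\<open>dA\<close> carries the Lebesgue sigma-algebra, whereas the rotation invariance of
  \<open>lborel\<close> is a statement about Borel sets. A measurable function is therefore
  exchanged for a Borel one that agrees with it almost everywhere.\<close>

lemma borel_representative_dA:
  fixes F :: "complex \<Rightarrow> complex"
  assumes "F \<in> borel_measurable dA"
  obtains G where "G \<in> borel_measurable borel" "AE z in dA. F z = G z"
proof -
  let ?F = "\<lambda>z. if z \<in> unit_disk then F z else 0"
  have "F \<in> borel_measurable (lebesgue_on unit_disk)"
    using assms by (simp add: dA_def)
  then have F: "?F \<in> borel_measurable lebesgue"
    by (rule borel_measurable_if_I) simp
  have "(\<lambda>z. Re (?F z)) \<in> borel_measurable (completion lborel)"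
    using F by measurable
  from completion_ex_borel_measurable_real[OF this]
  obtain R where R: "R \<in> borel_measurable lborel" "AE z in lborel. Re (?F z) = R z" by blast
  have "(\<lambda>z. Im (?F z)) \<in> borel_measurable (completion lborel)"
    using F by measurable
  from completion_ex_borel_measurable_real[OF this]
  obtain I where I: "I \<in> borel_measurable lborel" "AE z in lborel. Im (?F z) = I z" by blast
  show thesis
  proof
    show "(\<lambda>z. Complex (R z) (I z)) \<in> borel_measurable borel"
      using R I by (simp add: Complex_eq)
    show "AE z in dA. F z = Complex (R z) (I z)"
      unfolding AE_dA_iff using R(2) I(2) by eventually_elim (auto simp: complex_eq_iff)
  qed
qed

lemma borel_measurable_cnj [measurable]: "cnj \<in> borel_measurable borel"
  by (intro borel_measurable_continuous_onI continuous_intros)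

lemma integral_dA_rotate:
  fixes F :: "complex \<Rightarrow> complex"
  assumes F [measurable]: "F \<in> borel_measurable borel" and c: "cmod c = 1" "Im c \<noteq> 0"
  shows "(LINT z|dA. F (c * z)) = (LINT z|dA. F z)"
proof -
  have "(LINT z|lborel. indicator unit_disk z * F z)
      = (LINT z|distr lborel borel ((*) c). indicator unit_disk z * F z)"
    by (simp only: distr_lborel_rotation[OF c])
  also have "\<dots> = (LINT z|lborel. indicator unit_disk (c * z) * F (c * z))"
    by (intro integral_distr borel_measurable_times borel_measurable_indicator) auto
  also have "\<dots> = (LINT z|lborel. indicator unit_disk z * F (c * z))"
    using c by (intro Bochner_Integration.integral_cong) (auto simp: indicator_def norm_mult)
  finally show ?thesis
    by (simp add: integral_dA_borel)
qed

lemma AE_dA_rotate: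
  assumes c: "cmod c = 1" "Im c \<noteq> 0" and "AE z in dA. P z"
  shows "AE z in dA. P (c * z)"
proof -
  have "AE z in distr lborel borel ((*) c). z \<in> unit_disk \<longrightarrow> P z"
    using assms(3) by (simp only: distr_lborel_rotation[OF c] AE_dA_iff)
  then have "AE z in lborel. c * z \<in> unit_disk \<longrightarrow> P (c * z)"
    by (rule AE_distrD[rotated]) simp
  then show ?thesis
    unfolding AE_dA_iff using c by (simp add: norm_mult)
qed

text \<open>Rotation by a unit number c multiplies the integral by c^j cnj(c)^k, so the integral
  vanishes as soon as this factor is not 1.\<close>

lemma radial_orthogonal_monomials:
  assumes h: "h \<in> borel_measurable dA" "radial h" and "j \<noteq> k"
  shows "(LINT z|dA. h z * z ^ j * cnj z ^ k) = 0"
proof -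
  obtain c where c: "cmod c = 1" "Im c \<noteq> 0" "c ^ j * cnj c ^ k \<noteq> 1"
  proof -
    define d where "d = (if j < k then k - j else j - k)"
    have d: "d > 0" using \<open>j \<noteq> k\<close> by (auto simp: d_def)
    \<comment> \<open>With d = |j - k| this gives c^d = i, so the factor is i or -i. The angle lies
      strictly between 0 and pi, so \<open>Im c\<close> is nonzero, as the rotation lemmas
      require.\<close>
    define c where "c = cis (pi / (2 * d))"
    have [simp]: "c * cnj c = 1" "cnj c * c = 1"
      by (simp_all add: c_def cis_cnj cis_mult)
    have "real d * (pi / (2 * d)) = pi / 2"
      using d by simp
    then have "c ^ d = \<i>"
      unfolding c_def Complex.DeMoivre by (simp only: cis_pi_half)
    have pw: "c ^ n * cnj c ^ n = 1" for n
      by (simp flip: power_mult_distrib)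
    have "c ^ j * cnj c ^ k = c ^ d \<or> c ^ j * cnj c ^ k = cnj (c ^ d)"
    proof (cases "j < k")
      case True
      then have kd: "k = j + d" by (simp add: d_def)
      have "c ^ j * cnj c ^ k = (c ^ j * cnj c ^ j) * cnj c ^ d"
        by (simp only: kd power_add mult.assoc)
      then show ?thesis by (simp add: pw)
    next
      case False
      then have jd: "j = d + k" by (simp add: d_def)
      have "c ^ j * cnj c ^ k = c ^ d * (c ^ k * cnj c ^ k)"
        by (simp only: jd power_add mult.assoc)
      then show ?thesis by (simp add: pw)
    qed
    moreover have "\<i> \<noteq> 1" "cnj \<i> \<noteq> 1"
      by (simp_all add: complex_eq_iff)
    ultimately have ne: "c ^ j * cnj c ^ k \<noteq> 1"
      unfolding \<open>c ^ d = \<i>\<close> by (elim disjE) (simp_all only: not_False_eq_True)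
    have "pi / (2 * d) < pi"
      using d by (simp add: field_simps)
    then have "sin (pi / (2 * d)) > 0"
      using d by (intro sin_gt_zero) auto
    then show thesis
      using ne by (intro that[of c]) (simp_all add: c_def)
  qed
  from h(2) obtain h' where h': "AE z in dA. h z = h' z" "AE z in dA. h' z = h' (of_real (cmod z))"
    unfolding radial_def by blast
  \<comment> \<open>\<open>r\<close> depends on |z| alone at every point, while \<open>h'\<close>
    does so only almost everywhere. It need not be Borel; it serves to compare \<open>g\<close> with
    its rotated copy almost everywhere.\<close>
  define r where "r z = h' (of_real (cmod z))" for z
  have r: "AE z in dA. h z = r z"
    using h' by eventually_elim (simp add: r_def)
  obtain g where g [measurable]: "g \<in> borel_measurable borel" and hg: "AE z in dA. h z = g z"
    using borel_representative_dA[OF h(1)] by blast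
  have gr: "AE z in dA. g z = r z"
    using r hg by eventually_elim simp
  have gc: "AE z in dA. g (c * z) = g z"
    using gr AE_dA_rotate[OF c(1,2) gr] by eventually_elim (simp add: r_def norm_mult c)
  let ?G = "\<lambda>z. g z * z ^ j * cnj z ^ k"
  have mG: "?G \<in> borel_measurable borel"
    by measurable
  have mG': "(\<lambda>z. ?G (c * z)) \<in> borel_measurable borel"
    by measurable
  have "(LINT z|dA. ?G z) = (LINT z|dA. ?G (c * z))"
    by (rule integral_dA_rotate[symmetric, OF mG c(1,2)])
  also have "\<dots> = (LINT z|dA. (c ^ j * cnj c ^ k) * ?G z)"
  proof (rule integral_cong_AE)
    show "AE z in dA. ?G (c * z) = (c ^ j * cnj c ^ k) * ?G z"
      using gc by eventually_elim (simp add: power_mult_distrib)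
  qed (use mG mG' in \<open>auto intro: borel_measurable_dA\<close>)
  also have "\<dots> = (c ^ j * cnj c ^ k) * (LINT z|dA. ?G z)"
    by simp
  finally have "(LINT z|dA. ?G z) = 0"
    using c(3) by (simp add: mult_cancel_right1)
  moreover have "(LINT z|dA. h z * z ^ j * cnj z ^ k) = (LINT z|dA. ?G z)"
  proof (rule integral_cong_AE)
    show "(\<lambda>z. h z * z ^ j * cnj z ^ k) \<in> borel_measurable dA"
      using h(1) by (intro borel_measurable_times continuous_on_imp_borel_measurable_dA[of "\<lambda>z. z ^ j"]
          continuous_on_imp_borel_measurable_dA[of "\<lambda>z. cnj z ^ k"] continuous_intros)
    show "AE z in dA. h z * z ^ j * cnj z ^ k = ?G z"
      using hg by eventually_elim simp
  qed (use mG in \<open>auto intro: borel_measurable_dA\<close>)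
  ultimately show ?thesis by simp
qed

section \<open>Uniqueness for bounded holomorphic functions in the half plane\<close>

text \<open>For zeros at the points n of the right half plane this is the Blaschke condition, the
  same as in the Muentz theorem. The denominator n + 1 lets 0 belong to the set.\<close>

definition reciprocal_summable :: "nat set \<Rightarrow> bool" where
  "reciprocal_summable Z \<longleftrightarrow> summable (\<lambda>n. indicator Z n / real (Suc n))"

lemma reciprocal_summable_subset:
  assumes "reciprocal_summable Z" "Y \<subseteq> Z"
  shows "reciprocal_summable Y"
  using assms(1) unfolding reciprocal_summable_def
  by (rule summable_comparison_test')
    (use assms(2) in \<open>auto simp: indicator_def\<close>)

lemma reciprocal_summable_Un:
  assumes "reciprocal_summable Z" "reciprocal_summable Y"
  shows "reciprocal_summable (Z \<union> Y)"
proof -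
  have "summable (\<lambda>n. indicator Z n / real (Suc n) + indicator Y n / real (Suc n))"
    using assms unfolding reciprocal_summable_def by (rule summable_add)
  then show ?thesis
    unfolding reciprocal_summable_def
    by (rule summable_comparison_test') (auto simp: indicator_def)
qed

lemma reciprocal_summable_finite:
  assumes "finite Z"
  shows "reciprocal_summable Z"
  unfolding reciprocal_summable_def by (rule summable_finite[OF assms]) auto

lemma reciprocal_summable_UN:
  assumes "finite I" "\<And>i. i \<in> I \<Longrightarrow> reciprocal_summable (Z i)"
  shows "reciprocal_summable (\<Union>i\<in>I. Z i)"
  using assms by (induction) (auto intro: reciprocal_summable_Un reciprocal_summable_finite)

lemma not_reciprocal_summable_UNIV: "\<not> reciprocal_summable UNIV"
proof
  assume "reciprocal_summable UNIV"
  then have "summable (\<lambda>n. inverse (of_nat (Suc n)) :: real)"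
    by (simp add: reciprocal_summable_def inverse_eq_divide)
  then have "summable (\<lambda>n. inverse (of_nat n) :: real)"
    by (subst (asm) summable_Suc_iff)
  then show False
    using not_summable_harmonic by blast
qed

text \<open>The comparison is n + j + 1 \<le> (j + 1)(n + 1). It allows all row and column indices
  to be raised by a common t while they avoid a sparse set.\<close>

lemma reciprocal_summable_shift:
  assumes "reciprocal_summable Z"
  shows "reciprocal_summable {t. t + j \<in> Z}"
proof -
  have "summable (\<lambda>n. indicator Z (n + j) / real (Suc (n + j)))"
    using assms unfolding reciprocal_summable_def by (rule summable_ignore_initial_segment)
  then have *: "summable (\<lambda>n. real (Suc j) * (indicator Z (n + j) / real (Suc (n + j))))"
    by (rule summable_mult)
  show ?thesis
    unfolding reciprocal_summable_def
  proof (rule summable_comparison_test'[OF *])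
    fix n :: nat
    have "real (Suc (n + j)) \<le> real (Suc j) * real (Suc n)"
      by (simp add: algebra_simps)
    then show "norm (indicator {t. t + j \<in> Z} n / real (Suc n))
        \<le> real (Suc j) * (indicator Z (n + j) / real (Suc (n + j)))"
      by (auto simp: indicator_def divide_simps mult_ac)
  qed
qed

text \<open>The bound is the Schwarz lemma, transported to the half plane by a Cayley transform that
  sends \<open>0\<close> to \<open>a\<close>.\<close>

lemma half_plane_divide_zero:
  assumes holo: "\<Phi> holomorphic_on {z. Re z > 0}"
    and bound: "\<And>z. Re z > 0 \<Longrightarrow> cmod (\<Phi> z) \<le> C"
    and a: "a > 0" "\<Phi> (of_real a) = 0"
  obtains \<Psi> where "\<Psi> holomorphic_on {z. Re z > 0}"
    and "\<And>z. Re z > 0 \<Longrightarrow> cmod (\<Psi> z) \<le> C"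
    and "\<And>z. Re z > 0 \<Longrightarrow> \<Phi> z = (z - of_real a) / (z + of_real a) * \<Psi> z"
proof -
  let ?H = "{z. Re z > 0}" and ?a = "complex_of_real a"
  have opn: "open ?H" by (rule open_halfspace_Re_gt)
  \<comment> \<open>The quotient of \<Phi> by the Blaschke factor (z - a) / (z + a) is the
    difference quotient of \<open>g\<close> at a; its singularity there is removable because
    \<open>g\<close> vanishes at a.\<close>
  define g where "g z = \<Phi> z * (z + ?a)" for z
  define \<Psi> where "\<Psi> z = (if z = ?a then deriv g ?a else g z / (z - ?a))" for z
  have g: "g holomorphic_on ?H"
    unfolding g_def by (intro holomorphic_intros holo)
  have "(\<lambda>z. if z = ?a then deriv g ?a else g z / (z - ?a) - g ?a / (z - ?a)) holomorphic_on ?H"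
    by (rule pole_theorem_open[OF g opn]) auto
  then have \<Psi>: "\<Psi> holomorphic_on ?H"
    using a(2) by (simp add: \<Psi>_def[abs_def] g_def cong: if_cong)
  have nz: "z + ?a \<noteq> 0" if "Re z > 0" for z
    using that a(1) by (auto simp: complex_eq_iff)
  have eq: "\<Phi> z = (z - ?a) / (z + ?a) * \<Psi> z" if "Re z > 0" for z
    using nz[OF that] a(2) by (auto simp: \<Psi>_def g_def)
  have C0: "C \<ge> 0"
    using order_trans[OF norm_ge_zero bound[of 1]] by simp
  have off: "cmod (\<Psi> z) \<le> C" if z: "Re z > 0" "z \<noteq> ?a" for z
  proof (rule field_le_epsilon)
    \<comment> \<open>\<open>Schwarz_Lemma\<close> asks for values of modulus strictly below 1,
      hence the division by C + e with e arbitrarily small.\<close>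
    fix e :: real assume e: "e > 0"
    define m where "m w = ?a * (1 + w) / (1 - w)" for w
    define f where "f w = \<Phi> (m w) / of_real (C + e)" for w
    define \<xi> where "\<xi> = (z - ?a) / (z + ?a)"
    have mRe: "Re (m w) > 0" if "cmod w < 1" for w
    proof -
      have w1: "w \<noteq> 1" using that by auto
      have "(1 + w) / (1 - w) = (1 + w) * cnj (1 - w) / of_real ((cmod (1 - w))\<^sup>2)"
        by (rule complex_div_cnj)
      then have "Re ((1 + w) / (1 - w)) = Re ((1 + w) * cnj (1 - w)) / (cmod (1 - w))\<^sup>2"
        by (simp only: Re_divide_of_real)
      also have "Re ((1 + w) * cnj (1 - w)) = 1 - (cmod w)\<^sup>2"
        unfolding cmod_power2 by (simp add: power2_eq_square algebra_simps)
      finally have "Re ((1 + w) / (1 - w)) > 0"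
        using that w1 by (simp add: power_less_one_iff abs_square_less_1)
      moreover have "m w = a *\<^sub>R ((1 + w) / (1 - w))"
        by (simp add: m_def scaleR_conv_of_real)
      ultimately show ?thesis
        using a(1) by (simp only: scaleR_complex.sel zero_less_mult_iff) simp
    qed
    have "cmod (z - ?a) < cmod (z + ?a)"
    proof -
      have "(cmod (z - ?a))\<^sup>2 < (cmod (z + ?a))\<^sup>2"
        using z a(1) unfolding cmod_power2 by (simp add: power2_eq_square algebra_simps)
      then show ?thesis
        by (rule power2_less_imp_less) simp
    qed
    then have \<xi>1: "cmod \<xi> < 1"
      using nz[OF z(1)] by (simp add: \<xi>_def norm_divide)
    have m\<xi>: "m \<xi> = z"
    proof -
      have "1 + \<xi> = 2 * z / (z + ?a)" "1 - \<xi> = 2 * ?a / (z + ?a)"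
        using nz[OF z(1)] by (simp_all add: \<xi>_def field_simps)
      then show ?thesis
        using nz[OF z(1)] a(1) by (simp add: m_def)
    qed
    have "f holomorphic_on ball 0 1"
    proof -
      have "m holomorphic_on ball 0 1"
        unfolding m_def by (intro holomorphic_intros) auto
      moreover have "m ` ball 0 1 \<subseteq> ?H"
        using mRe by auto
      ultimately have "(\<Phi> \<circ> m) holomorphic_on ball 0 1"
        using holo by (meson holomorphic_on_compose_gen)
      then have "(\<lambda>w. \<Phi> (m w)) holomorphic_on ball 0 1"
        by (simp add: o_def)
      then show ?thesis
        unfolding f_def using C0 e by (intro holomorphic_intros) (auto simp flip: of_real_add)
    qed
    moreover have "f 0 = 0"
      using a(2) by (simp add: f_def m_def)
    moreover have "cmod (f w) < 1" if "cmod w < 1" for w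
    proof -
      have "cmod (\<Phi> (m w)) < C + e"
        using bound[OF mRe[OF that]] e by simp
      then show ?thesis
        using C0 e by (simp add: f_def norm_divide flip: of_real_add)
    qed
    ultimately have "cmod (f \<xi>) \<le> cmod \<xi>"
      using \<xi>1 by (rule Schwarz_Lemma(1))
    then have "cmod (\<Phi> z) \<le> cmod \<xi> * (C + e)"
      using C0 e by (simp add: f_def m\<xi> norm_divide divide_simps flip: of_real_add)
    moreover have "cmod (\<Phi> z) = cmod \<xi> * cmod (\<Psi> z)"
      using eq[OF z(1)] by (simp add: \<xi>_def norm_mult norm_divide)
    moreover have "cmod \<xi> > 0"
      using z nz[OF z(1)] by (simp add: \<xi>_def)
    ultimately show "cmod (\<Psi> z) \<le> C + e"
      by simp
  qed
  have aH: "?a \<in> ?H" using a(1) by simp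
  \<comment> \<open>The Schwarz estimate was divided by the Blaschke factor, which vanishes at a; at
    that point the bound follows by continuity.\<close>
  have at: "cmod (\<Psi> ?a) \<le> C"
  proof (rule tendsto_upperbound)
    have "continuous_on ?H \<Psi>"
      using \<Psi> by (rule holomorphic_on_imp_continuous_on)
    then have "isCont \<Psi> ?a"
      using opn aH continuous_on_eq_continuous_at by blast
    then show "((\<lambda>z. cmod (\<Psi> z)) \<longlongrightarrow> cmod (\<Psi> ?a)) (at ?a)"
      by (intro tendsto_norm) (simp add: isCont_def)
    have "eventually (\<lambda>z. z \<in> ?H) (at ?a)"
      using opn aH by (rule eventually_at_in_open')
    then show "\<forall>\<^sub>F z in at ?a. cmod (\<Psi> z) \<le> C"
      using eventually_neq_at_within[of ?a ?a UNIV] by eventually_elim (use off in auto)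
  qed simp
  show thesis
    by (rule that[OF \<Psi> _ eq]) (use off at in metis)
qed

text \<open>Zeros are divided out one at a time. The quotient keeps the bound \<open>C\<close> and
  still vanishes at the remaining points, where the removed Blaschke factor is nonzero.\<close>

lemma half_plane_blaschke_bound:
  assumes "finite A"
    and "\<Phi> holomorphic_on {z. Re z > 0}"
    and "\<And>z. Re z > 0 \<Longrightarrow> cmod (\<Phi> z) \<le> C"
    and "\<And>a. a \<in> A \<Longrightarrow> a > 0 \<and> \<Phi> (of_real a) = 0"
    and "x > 0"
  shows "cmod (\<Phi> (of_real x)) \<le> C * (\<Prod>a\<in>A. \<bar>x - a\<bar> / (x + a))"
  using assms
proof (induction A arbitrary: \<Phi>)
  case empty
  then show ?case by simp
next
  case (insert a A)
  from insert.prems(3)[of a] have a: "a > 0" "\<Phi> (of_real a) = 0" by auto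
  obtain \<Psi> where \<Psi>: "\<Psi> holomorphic_on {z. Re z > 0}"
    "\<And>z. Re z > 0 \<Longrightarrow> cmod (\<Psi> z) \<le> C"
    "\<And>z. Re z > 0 \<Longrightarrow> \<Phi> z = (z - of_real a) / (z + of_real a) * \<Psi> z"
    using half_plane_divide_zero[OF insert.prems(1,2) a] by blast
  have "b > 0 \<and> \<Psi> (of_real b) = 0" if b: "b \<in> A" for b
  proof -
    have b': "b > 0" "\<Phi> (of_real b) = 0" "b \<noteq> a"
      using insert.prems(3)[of b] insert.hyps b by auto
    have "complex_of_real b + of_real a \<noteq> 0"
      using a b' by (simp flip: of_real_add)
    then show ?thesis
      using \<Psi>(3)[of "of_real b"] b' by auto
  qed
  then have IH: "cmod (\<Psi> (of_real x)) \<le> C * (\<Prod>a\<in>A. \<bar>x - a\<bar> / (x + a))"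
    using insert.IH[OF \<Psi>(1,2)] \<open>x > 0\<close> by blast
  have "cmod (\<Phi> (of_real x)) = \<bar>x - a\<bar> / (x + a) * cmod (\<Psi> (of_real x))"
    using \<Psi>(3)[of "of_real x"] \<open>x > 0\<close> a
    by (simp add: norm_mult norm_divide flip: of_real_add of_real_diff)
  also have "\<dots> \<le> \<bar>x - a\<bar> / (x + a) * (C * (\<Prod>a\<in>A. \<bar>x - a\<bar> / (x + a)))"
    using IH \<open>x > 0\<close> a by (intro mult_left_mono) auto
  finally show ?case
    using insert.hyps by (simp add: mult_ac)
qed

text \<open>The Blaschke product over finitely many zeros in \<open>Z\<close> bounds |\<Phi>(x)|. A
  zero n > x contributes the factor 1 - 2 x / (x + n), which is at most exp(-\<kappa> / (n + 1)), so
  a nonzero value at x would bound the partial sums of 1 / (n + 1) over \<open>Z\<close>.\<close>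

lemma half_plane_uniqueness:
  assumes holo: "\<Phi> holomorphic_on {z. Re z > 0}"
    and bound: "\<And>z. Re z > 0 \<Longrightarrow> cmod (\<Phi> z) \<le> C"
    and Z: "\<not> reciprocal_summable Z" "\<And>n. n \<in> Z \<Longrightarrow> n > 0 \<Longrightarrow> \<Phi> (of_nat n) = 0"
    and x: "x > 0"
  shows "\<Phi> (of_real x) = 0"
proof (rule ccontr)
  assume nz: "\<Phi> (of_real x) \<noteq> 0"
  \<comment> \<open>Only n > x are used: they are positive and turn |x - n| into n - x. The finitely
    many smaller elements of \<open>Z\<close> do not affect summability.\<close>
  define N where "N = nat \<lceil>x\<rceil> + 1"
  \<comment> \<open>From x + n \<le> (1 + x)(n + 1) one gets 2 x / (x + n) \<ge> \<kappa> / (n +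
    1).\<close>
  define \<kappa> where "\<kappa> = 2 * x / (1 + x)"
  have \<kappa>: "\<kappa> > 0" using x by (simp add: \<kappa>_def)
  have N: "real n > x" "n > 0" if "n \<ge> N" for n
  proof -
    have "real n \<ge> real (nat \<lceil>x\<rceil> + 1)"
      using that unfolding N_def by (simp only: of_nat_le_iff)
    then show "real n > x" by linarith
    show "n > 0" using that by (simp add: N_def)
  qed
  have C0: "C > 0"
    using bound[of "of_real x"] x nz by (smt (verit) Re_complex_of_real zero_less_norm_iff)
  have fin: "(\<Sum>k\<le>m. indicator (Z \<inter> {N..}) k / real (Suc k)) \<le> ln (C / cmod (\<Phi> (of_real x))) / \<kappa>" for m
  proof -
    let ?A = "Z \<inter> {N..m}"
    have "cmod (\<Phi> (of_real x)) \<le> C * (\<Prod>a\<in>real ` ?A. \<bar>x - a\<bar> / (x + a))"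
      by (rule half_plane_blaschke_bound[OF _ holo bound]) (use Z(2) N x in \<open>force+\<close>)
    also have "(\<Prod>a\<in>real ` ?A. \<bar>x - a\<bar> / (x + a)) = (\<Prod>n\<in>?A. \<bar>x - real n\<bar> / (x + real n))"
      by (subst prod.reindex) (auto simp: inj_on_def)
    also have "\<dots> \<le> (\<Prod>n\<in>?A. exp (- (\<kappa> / real (Suc n))))"
    proof (rule prod_mono, safe)
      fix n assume n: "n \<in> {N..m}"
      then have xn: "real n > x" "n > 0" using N by auto
      have "x + real n \<le> (1 + x) * real (Suc n)"
        using x by (simp add: algebra_simps)
      then have "2 * x / ((1 + x) * real (Suc n)) \<le> 2 * x / (x + real n)"
        using x xn by (intro divide_left_mono mult_pos_pos) auto
      then have "\<kappa> / real (Suc n) \<le> 2 * x / (x + real n)"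
        by (simp add: \<kappa>_def)
      moreover have "\<bar>x - real n\<bar> / (x + real n) = 1 - 2 * x / (x + real n)"
        using x xn by (simp add: field_simps)
      ultimately have "\<bar>x - real n\<bar> / (x + real n) \<le> 1 + (- (\<kappa> / real (Suc n)))"
        by linarith
      also have "\<dots> \<le> exp (- (\<kappa> / real (Suc n)))"
        by (rule exp_ge_add_one_self)
      finally show "\<bar>x - real n\<bar> / (x + real n) \<le> exp (- (\<kappa> / real (Suc n)))" .
      show "0 \<le> \<bar>x - real n\<bar> / (x + real n)" using x by simp
    qed
    also have "\<dots> = exp (- \<kappa> * (\<Sum>n\<in>?A. 1 / real (Suc n)))"
      by (subst exp_sum[symmetric]) (auto simp: sum_distrib_left sum_negf)
    also have "(\<Sum>n\<in>?A. 1 / real (Suc n)) = (\<Sum>k\<le>m. indicator (Z \<inter> {N..}) k / real (Suc k))"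
      by (rule sum.mono_neutral_cong_left) (auto simp: indicator_def)
    finally have le: "cmod (\<Phi> (of_real x)) \<le> C * exp (- \<kappa> * (\<Sum>k\<le>m. indicator (Z \<inter> {N..}) k / real (Suc k)))"
      using C0 by simp
    let ?S = "\<Sum>k\<le>m. indicator (Z \<inter> {N..}) k / real (Suc k)"
    have "exp (\<kappa> * ?S) \<le> C / cmod (\<Phi> (of_real x))"
      using le nz by (simp add: exp_minus divide_simps mult_ac)
    then have "\<kappa> * ?S \<le> ln (C / cmod (\<Phi> (of_real x)))"
      using C0 nz by (subst ln_ge_iff) auto
    then show ?thesis
      using \<kappa> by (simp add: field_simps)
  qed
  have "reciprocal_summable (Z \<inter> {N..})"
    unfolding reciprocal_summable_def by (rule bounded_imp_summable[OF _ fin]) simp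
  then have "reciprocal_summable ((Z \<inter> {N..}) \<union> {..<N})"
    by (rule reciprocal_summable_Un) (simp add: reciprocal_summable_finite)
  then have "reciprocal_summable Z"
    by (rule reciprocal_summable_subset) auto
  with Z(1) show False by blast
qed

section \<open>Minors and rank\<close>

text \<open>The size is a parameter and the entries are a function, so the submatrix with rows
  \<open>J\<close> and columns \<open>K\<close> is just \<open>\<lambda>i l. a (J i) (K l)\<close>.
  The selections may repeat an index; a repetition among the first n makes the minor 0.\<close>

definition minor :: "nat \<Rightarrow> (nat \<Rightarrow> nat \<Rightarrow> complex) \<Rightarrow> complex" where
  "minor n A = Determinant.det (Matrix.mat n n (\<lambda>(i, j). A i j))"

lemma minor_Leibniz:
  "minor n A = (\<Sum>p | p permutes {0..<n}. of_int (sign p) * (\<Prod>i = 0..<n. A i (p i)))"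
proof -
  have "minor n A = (\<Sum>p | p permutes {0..<n}. of_int (sign p) *
      (\<Prod>i = 0..<n. Matrix.mat n n (\<lambda>(i, j). A i j) $$ (i, p i)))"
    unfolding minor_def by (rule det_def'[of _ n]) simp
  also have "\<dots> = (\<Sum>p | p permutes {0..<n}. of_int (sign p) * (\<Prod>i = 0..<n. A i (p i)))"
    by (intro sum.cong prod.cong refl arg_cong2[where f = "(*)"]) (auto dest: permutes_nat_less)
  finally show ?thesis .
qed

lemma minor_0 [simp]: "minor 0 A = 1"
  unfolding minor_def by (rule det_dim_zero) simp

lemma minor_1: "minor (Suc 0) A = A 0 0"
  unfolding minor_def by (subst det_single) simp_all

lemma minor_cong:
  assumes "\<And>i j. i < n \<Longrightarrow> j < n \<Longrightarrow> A i j = B i j"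
  shows "minor n A = minor n B"
  unfolding minor_def by (intro arg_cong[where f = Determinant.det]) (auto intro!: eq_matI simp: assms)

lemma minor_mult:
  "minor n (\<lambda>i k. \<Sum>l<n. A i l * B l k) = minor n A * minor n B"
proof -
  have "Matrix.mat n n (\<lambda>(i, k). \<Sum>l<n. A i l * B l k)
      = Matrix.mat n n (\<lambda>(i, j). A i j) * Matrix.mat n n (\<lambda>(i, j). B i j)"
    by (rule eq_matI) (auto simp: scalar_prod_def atLeast0LessThan)
  then show ?thesis
    by (simp add: minor_def det_mult[of _ n])
qed

lemma minor_transpose: "minor n (\<lambda>i j. A j i) = minor n A"
proof -
  have "Matrix.mat n n (\<lambda>(i, j). A j i) = transpose_mat (Matrix.mat n n (\<lambda>(i, j). A i j))"
    by (rule eq_matI) auto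
  then show ?thesis
    by (simp add: minor_def det_transpose[of _ n])
qed

lemma minor_scale:
  "minor n (\<lambda>i k. \<alpha> i * \<beta> k * A i k) = (\<Prod>i<n. \<alpha> i) * (\<Prod>i<n. \<beta> i) * minor n A"
proof -
  have "(\<Prod>i = 0..<n. \<alpha> i * \<beta> (p i) * A i (p i))
      = (\<Prod>i<n. \<alpha> i) * (\<Prod>i<n. \<beta> i) * (\<Prod>i = 0..<n. A i (p i))" if "p permutes {0..<n}" for p
    using prod.permute[OF that, of \<beta>] by (simp add: prod.distrib atLeast0LessThan o_def)
  then have "minor n (\<lambda>i k. \<alpha> i * \<beta> k * A i k) = (\<Sum>p | p permutes {0..<n}. of_int (sign p) *
      ((\<Prod>i<n. \<alpha> i) * (\<Prod>i<n. \<beta> i) * (\<Prod>i = 0..<n. A i (p i))))"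
    unfolding minor_Leibniz by (intro sum.cong refl arg_cong2[where f = "(*)"]) simp
  then show ?thesis
    by (simp add: minor_Leibniz sum_distrib_left mult_ac)
qed

lemma minor_eq_0_iff:
  "minor n A = 0 \<longleftrightarrow> (\<exists>v. (\<exists>l<n. v l \<noteq> 0) \<and> (\<forall>i<n. (\<Sum>l<n. A i l * v l) = 0))"
proof -
  let ?M = "Matrix.mat n n (\<lambda>(i, j). A i j)"
  have "minor n A = 0 \<longleftrightarrow> (\<exists>v. v \<in> carrier_vec n \<and> v \<noteq> 0\<^sub>v n \<and> ?M *\<^sub>v v = 0\<^sub>v n)"
    unfolding minor_def by (rule det_0_iff_vec_prod_zero) simp
  also have "\<dots> \<longleftrightarrow> (\<exists>v. (\<exists>l<n. v l \<noteq> 0) \<and> (\<forall>i<n. (\<Sum>l<n. A i l * v l) = 0))"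
  proof safe
    fix v :: "complex Matrix.vec"
    assume v: "v \<in> carrier_vec n" "v \<noteq> 0\<^sub>v n" "?M *\<^sub>v v = 0\<^sub>v n"
    have "\<exists>l<n. vec_index v l \<noteq> 0"
      using v(1,2) by (metis carrier_vecD eq_vecI index_zero_vec)
    moreover have "(\<Sum>l<n. A i l * vec_index v l) = 0" if "i < n" for i
    proof -
      have "vec_index (?M *\<^sub>v v) i = 0" using v(3) that by simp
      then show ?thesis using that v(1) by (simp add: scalar_prod_def atLeast0LessThan)
    qed
    ultimately show "\<exists>v. (\<exists>l<n. v l \<noteq> 0) \<and> (\<forall>i<n. (\<Sum>l<n. A i l * v l) = 0)" by blast
  next
    fix v :: "nat \<Rightarrow> complex" and l
    assume v: "\<forall>i<n. (\<Sum>l<n. A i l * v l) = 0" and l: "l < n" "v l \<noteq> 0"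
    have "Matrix.vec n v \<noteq> 0\<^sub>v n"
      using l by (metis index_vec index_zero_vec(1))
    moreover have "?M *\<^sub>v Matrix.vec n v = 0\<^sub>v n"
      by (rule eq_vecI) (use v in \<open>auto simp: scalar_prod_def atLeast0LessThan\<close>)
    ultimately show "\<exists>v. v \<in> carrier_vec n \<and> v \<noteq> 0\<^sub>v n \<and> ?M *\<^sub>v v = 0\<^sub>v n"
      by (intro exI[of _ "Matrix.vec n v"]) auto
  qed
  finally show ?thesis .
qed

text \<open>Fewer equations than unknowns. Padded with zero rows to a square matrix of size
  \<open>n\<close>, the system has determinant 0, because row \<open>card B\<close> is zero.\<close>

lemma linear_dependence_exists:
  fixes c :: "nat \<Rightarrow> 'b \<Rightarrow> complex"
  assumes "finite B" "card B < n"
  obtains v where "\<exists>l<n. v l \<noteq> 0" "\<And>b. b \<in> B \<Longrightarrow> (\<Sum>l<n. v l * c l b) = 0"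
proof -
  obtain h where h: "bij_betw h {0..<card B} B"
    using ex_bij_betw_nat_finite[OF assms(1)] by blast
  define A where "A i l = (if i < card B then c l (h i) else 0)" for i l
  have "minor n A = 0"
    unfolding minor_Leibniz
  proof (intro sum.neutral ballI)
    fix p
    have "(\<Prod>i = 0..<n. A i (p i)) = 0"
      using assms(2) by (intro prod_zero) (auto simp: A_def intro!: bexI[of _ "card B"])
    then show "of_int (sign p) * (\<Prod>i = 0..<n. A i (p i)) = 0" by simp
  qed
  then obtain v where v: "\<exists>l<n. v l \<noteq> 0" "\<forall>i<n. (\<Sum>l<n. A i l * v l) = 0"
    unfolding minor_eq_0_iff by blast
  show thesis
  proof
    fix b assume "b \<in> B"
    then have "b \<in> h ` {0..<card B}"
      using h by (simp add: bij_betw_def)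
    then obtain i where i: "i < card B" "b = h i"
      by auto
    then show "(\<Sum>l<n. v l * c l b) = 0"
      using v(2)[rule_format, of i] assms(2) by (simp add: A_def mult.commute)
  qed (rule v(1))
qed

text \<open>The inverse is the adjugate divided by the determinant.\<close>

lemma minor_inverse:
  assumes "minor n A \<noteq> 0"
  obtains B where "\<And>i k. i < n \<Longrightarrow> k < n \<Longrightarrow> (\<Sum>l<n. B i l * A l k) = (if i = k then 1 else 0)"
proof -
  let ?M = "Matrix.mat n n (\<lambda>(i, j). A i j)"
  have M: "?M \<in> carrier_mat n n" by simp
  define B where "B i l = adj_mat ?M $$ (i, l) / minor n A" for i l
  show thesis
  proof
    fix i k assume ik: "i < n" "k < n"
    have adj: "adj_mat ?M \<in> carrier_mat n n" using adj_mat(1)[OF M] .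
    have "(\<Sum>l<n. adj_mat ?M $$ (i, l) * A l k) = (adj_mat ?M * ?M) $$ (i, k)"
      using ik adj by (auto simp: scalar_prod_def atLeast0LessThan)
    also have "\<dots> = minor n A * (if i = k then 1 else 0)"
      using ik unfolding adj_mat(3)[OF M] minor_def by simp
    finally have *: "(\<Sum>l<n. adj_mat ?M $$ (i, l) * A l k) = minor n A * (if i = k then 1 else 0)" .
    have "(\<Sum>l<n. B i l * A l k) = (\<Sum>l<n. adj_mat ?M $$ (i, l) * A l k) / minor n A"
      by (simp add: B_def sum_divide_distrib)
    then show "(\<Sum>l<n. B i l * A l k) = (if i = k then 1 else 0)"
      using assms * by simp
  qed
qed

text \<open>Bordering a nonzero minor of maximal size by one more row and column gives the
  factorization \<open>a = P B Q\<close>, where \<open>B\<close> is the inverse of the submatrix.\<close>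

lemma rank_factorization:
  fixes a :: "nat \<Rightarrow> nat \<Rightarrow> complex"
  assumes nz: "minor n (\<lambda>i l. a (J i) (K l)) \<noteq> 0"
    and zero: "\<And>J K. minor (Suc n) (\<lambda>i l. a (J i) (K l)) = 0"
  obtains B where "\<And>j k. a j k = (\<Sum>l<n. a j (K l) * (\<Sum>i<n. B l i * a (J i) k))"
    and "minor n B * minor n (\<lambda>i l. a (J i) (K l)) = 1"
proof -
  obtain B where B: "\<And>i k. i < n \<Longrightarrow> k < n \<Longrightarrow> (\<Sum>l<n. B i l * a (J l) (K k)) = (if i = k then 1 else 0)"
    using minor_inverse[OF nz] by blast
  show thesis
  proof
    have "minor n B * minor n (\<lambda>i l. a (J i) (K l)) = minor n (\<lambda>i k. if i = k then 1 else 0)"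
      by (subst minor_mult[symmetric]) (rule minor_cong, rule B)
    also have "Matrix.mat n n (\<lambda>(i, k). if i = k then 1 else 0 :: complex) = 1\<^sub>m n"
      by (rule eq_matI) auto
    then have "minor n (\<lambda>i k. if i = k then 1 else 0) = 1"
      by (simp add: minor_def)
    finally show "minor n B * minor n (\<lambda>i l. a (J i) (K l)) = 1" .
  next
    fix j k
    \<comment> \<open>A kernel vector of the bordered matrix. Its first n equations express
      \<open>v l\<close> through \<open>v n\<close>, so \<open>v n\<close> is nonzero, and the last
      equation becomes the formula for \<open>a j k\<close>.\<close>
    from zero[of "J(n := j)" "K(n := k)"] obtain v where v: "\<exists>l<Suc n. v l \<noteq> 0"
      "\<And>i. i < Suc n \<Longrightarrow> (\<Sum>l<Suc n. a ((J(n := j)) i) ((K(n := k)) l) * v l) = 0"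
      unfolding minor_eq_0_iff by blast
    have vi: "(\<Sum>l<n. a (J i) (K l) * v l) = - a (J i) k * v n" if "i < n" for i
    proof -
      have "(\<Sum>l<n. a (J i) (K l) * v l) = (\<Sum>l<n. a ((J(n := j)) i) ((K(n := k)) l) * v l)"
        using that by (intro sum.cong) auto
      then show ?thesis
        using v(2)[of i] that by (simp add: add_eq_0_iff2)
    qed
    have vn: "(\<Sum>l<n. a j (K l) * v l) = - a j k * v n"
    proof -
      have "(\<Sum>l<n. a j (K l) * v l) = (\<Sum>l<n. a ((J(n := j)) n) ((K(n := k)) l) * v l)"
        by (intro sum.cong) auto
      then show ?thesis
        using v(2)[of n] by (simp add: add_eq_0_iff2)
    qed
    have vl: "v l = - (\<Sum>i<n. B l i * a (J i) k) * v n" if l: "l < n" for l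
    proof -
      have "v l = (\<Sum>m<n. (if l = m then 1 else 0) * v m)"
        using l by (simp add: if_distrib[of "\<lambda>x. x * _"] cong: if_cong)
      also have "\<dots> = (\<Sum>m<n. (\<Sum>i<n. B l i * a (J i) (K m)) * v m)"
        using l by (intro sum.cong refl) (simp only: B lessThan_iff)
      also have "\<dots> = (\<Sum>i<n. B l i * (\<Sum>m<n. a (J i) (K m) * v m))"
        unfolding sum_distrib_left sum_distrib_right mult.assoc by (rule sum.swap)
      also have "\<dots> = (\<Sum>i<n. B l i * (- a (J i) k * v n))"
        by (intro sum.cong refl) (simp only: vi lessThan_iff)
      finally show ?thesis
        by (simp add: sum_distrib_right sum_negf mult.assoc)
    qed
    have "v n \<noteq> 0"
    proof
      assume "v n = 0"
      then have "v l = 0" if "l < Suc n" for l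
        using vl[of l] that by (cases "l = n") auto
      then show False using v(1) by blast
    qed
    moreover have "a j k * v n = (\<Sum>l<n. a j (K l) * (\<Sum>i<n. B l i * a (J i) k)) * v n"
    proof -
      have "a j k * v n = - (\<Sum>l<n. a j (K l) * v l)"
        using vn by simp
      also have "(\<Sum>l<n. a j (K l) * v l) = (\<Sum>l<n. a j (K l) * (- (\<Sum>i<n. B l i * a (J i) k) * v n))"
        by (intro sum.cong refl) (simp only: vl[symmetric] lessThan_iff)
      finally show ?thesis
        by (simp add: sum_distrib_right sum_negf mult.assoc)
    qed
    ultimately show "a j k = (\<Sum>l<n. a j (K l) * (\<Sum>i<n. B l i * a (J i) k))"
      by simp
  qed
qed

section \<open>Integrals depending holomorphically on an exponent\<close>

text \<open>The exponential series may be integrated termwise because all partial sums of its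
  absolute values are dominated by |v| exp(R |L|).\<close>

lemma exp_integral_sums:
  fixes v L :: "'a \<Rightarrow> complex"
  assumes [measurable]: "v \<in> borel_measurable M" "L \<in> borel_measurable M"
    and int: "integrable M (\<lambda>x. cmod (v x) * exp (R * cmod (L x)))" and t: "cmod t \<le> R"
  shows exp_integral_integrable: "integrable M (\<lambda>x. v x * exp (t * L x))"
    and "(\<lambda>n. (LINT x|M. v x * L x ^ n) / fact n * t ^ n) sums (LINT x|M. v x * exp (t * L x))"
proof -
  define f where "f n x = v x * ((t * L x) ^ n /\<^sub>R fact n)" for n x
  have R: "R \<ge> 0" using t norm_ge_zero[of t] by linarith
  have nf: "cmod (f n x) = cmod (v x) * (cmod (t * L x) ^ n /\<^sub>R fact n)" for n x
    by (simp add: f_def norm_mult norm_power)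
  have partial: "(\<Sum>k\<in>I. cmod (f k x)) \<le> cmod (v x) * exp (R * cmod (L x))" if "finite I" for I x
  proof -
    have "(\<Sum>k\<in>I. cmod (t * L x) ^ k /\<^sub>R fact k) \<le> (\<Sum>k. cmod (t * L x) ^ k /\<^sub>R fact k)"
      by (rule sum_le_suminf[OF summable_exp_generic that]) auto
    also have "\<dots> = exp (cmod (t * L x))"
      by (simp add: exp_def)
    also have "\<dots> \<le> exp (R * cmod (L x))"
      using t by (simp add: norm_mult mult_right_mono)
    finally show ?thesis
      by (simp add: nf mult_left_mono flip: sum_distrib_left)
  qed
  have mf: "f n \<in> borel_measurable M" for n
    unfolding f_def by measurable
  have fi: "integrable M (f n)" for n
  proof (rule Bochner_Integration.integrable_bound[OF int mf])
    show "AE x in M. norm (f n x) \<le> norm (cmod (v x) * exp (R * cmod (L x)))"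
      using partial[of "{n}"] by simp
  qed
  have "(\<lambda>n. f n x) sums (v x * exp (t * L x))" for x
    unfolding f_def by (intro sums_mult exp_converges)
  then have suminf: "(\<Sum>n. f n x) = v x * exp (t * L x)" for x
    by (rule sums_unique[symmetric])
  have AEs: "AE x in M. summable (\<lambda>n. norm (f n x))"
    unfolding nf by (intro AE_I2 summable_mult summable_exp_generic)
  have sumi: "summable (\<lambda>n. LINT x|M. norm (f n x))"
  proof (rule bounded_imp_summable)
    fix n
    have "(\<Sum>k\<le>n. (LINT x|M. norm (f k x))) = (LINT x|M. (\<Sum>k\<le>n. norm (f k x)))"
      using fi by (intro Bochner_Integration.integral_sum[symmetric]) simp
    also have "\<dots> \<le> (LINT x|M. cmod (v x) * exp (R * cmod (L x)))"
      using fi partial by (intro integral_mono Bochner_Integration.integrable_sum int) auto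
    finally show "(\<Sum>k\<le>n. (LINT x|M. norm (f k x))) \<le> (LINT x|M. cmod (v x) * exp (R * cmod (L x)))" .
  qed simp
  show "integrable M (\<lambda>x. v x * exp (t * L x))"
    using integrable_suminf[OF fi AEs sumi] by (simp add: suminf)
  have "(LINT x|M. f n x) = (LINT x|M. v x * L x ^ n) / fact n * t ^ n" for n
  proof -
    have "(LINT x|M. f n x) = (LINT x|M. (t ^ n / fact n) * (v x * L x ^ n))"
      by (intro Bochner_Integration.integral_cong)
        (simp_all add: f_def scaleR_conv_of_real power_mult_distrib field_simps)
    also have "\<dots> = (t ^ n / fact n) * (LINT x|M. v x * L x ^ n)"
      by (rule integral_mult_right_zero)
    finally show ?thesis by simp
  qed
  then show "(\<lambda>n. (LINT x|M. v x * L x ^ n) / fact n * t ^ n) sums (LINT x|M. v x * exp (t * L x))"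
    using sums_integral[OF fi AEs sumi] by (simp add: suminf)
qed

text \<open>Recentering: exp(t L) = exp(c L) exp((t - c) L), so the series at 0 for the function v
  exp(c L) is a power series around c.\<close>

lemma exp_integral_holomorphic_on_ball:
  fixes v L :: "'a \<Rightarrow> complex"
  assumes [measurable]: "v \<in> borel_measurable M" "L \<in> borel_measurable M"
    and int: "integrable M (\<lambda>x. cmod (v x * exp (c * L x)) * exp (R * cmod (L x)))"
  shows "(\<lambda>t. LINT x|M. v x * exp (t * L x)) holomorphic_on ball c R"
proof (rule power_series_holomorphic)
  fix w assume "w \<in> ball c R"
  then have w: "cmod (w - c) \<le> R"
    by (simp add: dist_norm norm_minus_commute)
  have "(\<lambda>n. (LINT x|M. (v x * exp (c * L x)) * L x ^ n) / fact n * (w - c) ^ n)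
      sums (LINT x|M. (v x * exp (c * L x)) * exp ((w - c) * L x))"
    by (rule exp_integral_sums(2)[OF _ _ int w]) measurable
  moreover have "(v x * exp (c * L x)) * exp ((w - c) * L x) = v x * exp (w * L x)" for x
    by (simp add: algebra_simps flip: exp_add)
  ultimately show "(\<lambda>n. (LINT x|M. (v x * exp (c * L x)) * L x ^ n) / fact n * (w - c) ^ n)
      sums (LINT x|M. v x * exp (w * L x))"
    by simp
qed

lemma laplace_integral_half_plane:
  fixes v :: "'a \<Rightarrow> complex" and l :: "'a \<Rightarrow> real"
  assumes v: "integrable M v" and l: "l \<in> borel_measurable M" "\<And>x. x \<in> space M \<Longrightarrow> l x \<le> 0"
  shows laplace_integral_holomorphic:
      "(\<lambda>t. LINT x|M. v x * exp (t * of_real (l x))) holomorphic_on {t. Re t > 0}"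
    and laplace_integral_bound:
      "Re t > 0 \<Longrightarrow> cmod (LINT x|M. v x * exp (t * of_real (l x))) \<le> (LINT x|M. cmod (v x))"
proof -
  have [measurable]: "v \<in> borel_measurable M" "l \<in> borel_measurable M"
    using v l by auto
  have "(\<lambda>t. LINT x|M. v x * exp (t * of_real (l x))) analytic_on {t. Re t > 0}"
    unfolding analytic_on_def
  proof safe
    fix c :: complex assume c: "Re c > 0"
    \<comment> \<open>Since l \<le> 0, the growth exp(Re c |l|) exactly cancels |exp(c l)|. Hence
      the radius can be Re c, the distance from c to the boundary of the half plane.\<close>
    have "cmod (v x * exp (c * of_real (l x))) * exp (Re c * cmod (of_real (l x))) = cmod (v x)"
      if "x \<in> space M" for x
      using l(2)[OF that] by (simp add: norm_mult flip: exp_add)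
    then have "integrable M (\<lambda>x. cmod (v x * exp (c * of_real (l x))) * exp (Re c * cmod (of_real (l x))))"
      using v by (subst Bochner_Integration.integrable_cong[OF refl]) auto
    then have "(\<lambda>t. LINT x|M. v x * exp (t * of_real (l x))) holomorphic_on ball c (Re c)"
      by (intro exp_integral_holomorphic_on_ball) measurable
    with c show "\<exists>e>0. (\<lambda>t. LINT x|M. v x * exp (t * of_real (l x))) holomorphic_on ball c e"
      by blast
  qed
  then show "(\<lambda>t. LINT x|M. v x * exp (t * of_real (l x))) holomorphic_on {t. Re t > 0}"
    by (rule analytic_imp_holomorphic)
  assume t: "Re t > 0"
  have le: "cmod (v x * exp (t * of_real (l x))) \<le> cmod (v x)" if "x \<in> space M" for x
  proof -
    have "Re t * l x \<le> 0" using t l(2)[OF that] by (simp add: mult_nonneg_nonpos)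
    then show ?thesis by (simp add: norm_mult mult_left_le)
  qed
  have "integrable M (\<lambda>x. v x * exp (t * of_real (l x)))"
    by (rule Bochner_Integration.integrable_bound[OF v]) (use le in auto)
  then have "cmod (LINT x|M. v x * exp (t * of_real (l x))) \<le> (LINT x|M. cmod (v x * exp (t * of_real (l x))))"
    by simp
  also have "\<dots> \<le> (LINT x|M. cmod (v x))"
    using \<open>integrable M (\<lambda>x. v x * exp (t * of_real (l x)))\<close> v le
    by (intro integral_mono) auto
  finally show "cmod (LINT x|M. v x * exp (t * of_real (l x))) \<le> (LINT x|M. cmod (v x))" .
qed

section \<open>Square-integrable functions\<close>

definition square_integrable :: "'a measure \<Rightarrow> ('a \<Rightarrow> complex) \<Rightarrow> bool" where
  "square_integrable M f \<longleftrightarrow> f \<in> borel_measurable M \<and> integrable M (\<lambda>x. (cmod (f x))\<^sup>2)"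

lemma square_integrableD:
  assumes "square_integrable M f"
  shows "f \<in> borel_measurable M" "integrable M (\<lambda>x. (cmod (f x))\<^sup>2)"
  using assms by (auto simp: square_integrable_def)

lemma square_integrable_bound:
  assumes "square_integrable M g" "f \<in> borel_measurable M" "AE x in M. cmod (f x) \<le> C * cmod (g x)"
  shows "square_integrable M f"
  unfolding square_integrable_def
proof (intro conjI)
  show "integrable M (\<lambda>x. (cmod (f x))\<^sup>2)"
  proof (rule Bochner_Integration.integrable_bound)
    show "integrable M (\<lambda>x. C\<^sup>2 * (cmod (g x))\<^sup>2)"
      using square_integrableD(2)[OF assms(1)] by simp
    show "AE x in M. norm ((cmod (f x))\<^sup>2) \<le> norm (C\<^sup>2 * (cmod (g x))\<^sup>2)"
      using assms(3)
    proof eventually_elim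
      case (elim x)
      then have "(cmod (f x))\<^sup>2 \<le> (C * cmod (g x))\<^sup>2"
        by (intro power_mono) auto
      then show ?case by (simp add: power_mult_distrib)
    qed
  qed (use assms in measurable)
qed (rule assms)

lemma square_integrable_cmult:
  assumes "square_integrable M f"
  shows "square_integrable M (\<lambda>x. c * f x)"
  using assms by (auto simp: square_integrable_def norm_mult power_mult_distrib)

lemma square_integrable_add:
  assumes "square_integrable M f" "square_integrable M g"
  shows "square_integrable M (\<lambda>x. f x + g x)"
  unfolding square_integrable_def
proof (intro conjI)
  have [measurable]: "f \<in> borel_measurable M" "g \<in> borel_measurable M"
    using assms by (auto simp: square_integrable_def)
  show "(\<lambda>x. f x + g x) \<in> borel_measurable M" by measurable
  show "integrable M (\<lambda>x. (cmod (f x + g x))\<^sup>2)"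
  proof (rule Bochner_Integration.integrable_bound)
    show "integrable M (\<lambda>x. 2 * (cmod (f x))\<^sup>2 + 2 * (cmod (g x))\<^sup>2)"
      using assms by (auto simp: square_integrable_def)
    have "(cmod (f x + g x))\<^sup>2 \<le> 2 * (cmod (f x))\<^sup>2 + 2 * (cmod (g x))\<^sup>2" for x
    proof -
      have "(cmod (f x + g x))\<^sup>2 \<le> (cmod (f x) + cmod (g x))\<^sup>2"
        by (intro power_mono norm_triangle_ineq) simp
      also have "\<dots> \<le> 2 * (cmod (f x))\<^sup>2 + 2 * (cmod (g x))\<^sup>2"
        using zero_le_power2[of "cmod (f x) - cmod (g x)"] by (simp add: power2_sum power2_diff)
      finally show ?thesis .
    qed
    then show "AE x in M. norm ((cmod (f x + g x))\<^sup>2) \<le> norm (2 * (cmod (f x))\<^sup>2 + 2 * (cmod (g x))\<^sup>2)"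
      by simp
  qed measurable
qed

lemma square_integrable_diff:
  assumes "square_integrable M f" "square_integrable M g"
  shows "square_integrable M (\<lambda>x. f x - g x)"
  using square_integrable_add[OF assms(1) square_integrable_cmult[OF assms(2), of "-1"]] by simp

lemma square_integrable_0 [simp]: "square_integrable M (\<lambda>x. 0)"
  by (simp add: square_integrable_def)

lemma square_integrable_sum:
  assumes "\<And>i. i \<in> I \<Longrightarrow> square_integrable M (f i)"
  shows "square_integrable M (\<lambda>x. \<Sum>i\<in>I. f i x)"
  using assms by (induction I rule: infinite_finite_induct) (auto intro: square_integrable_add)

lemma integrable_inner_square_integrable:
  assumes "square_integrable M f" "square_integrable M g"
  shows "integrable M (\<lambda>x. f x * cnj (g x))"
proof (rule Bochner_Integration.integrable_bound)
  have [measurable]: "f \<in> borel_measurable M" "g \<in> borel_measurable M"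
    using assms by (auto simp: square_integrable_def)
  have [measurable]: "(\<lambda>x. cnj (g x)) \<in> borel_measurable M"
    by (rule borel_measurable_continuous_on[OF _ \<open>g \<in> _\<close>]) (intro continuous_intros)
  show "(\<lambda>x. f x * cnj (g x)) \<in> borel_measurable M" by measurable
  show "integrable M (\<lambda>x. (cmod (f x))\<^sup>2 + (cmod (g x))\<^sup>2)"
    using assms by (auto simp: square_integrable_def)
  have "cmod (f x) * cmod (g x) \<le> (cmod (f x))\<^sup>2 + (cmod (g x))\<^sup>2" for x
  proof -
    have "0 \<le> cmod (f x) * cmod (g x)" by simp
    then show ?thesis
      using zero_le_power2[of "cmod (f x) - cmod (g x)"] unfolding power2_diff by linarith
  qed
  then show "AE x in M. norm (f x * cnj (g x)) \<le> norm ((cmod (f x))\<^sup>2 + (cmod (g x))\<^sup>2)"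
    by (simp add: norm_mult)
qed

text \<open>The free weight \<open>e\<close> takes the place of square roots: at the application it
  is chosen so that the first term is small, and the approximating function afterwards so that the
  second one is.\<close>

lemma weighted_Cauchy_Schwarz:
  assumes f: "square_integrable M f" and g: "square_integrable M g" and e: "e > 0"
  shows "cmod (LINT x|M. f x * cnj (g x)) \<le>
    e * (LINT x|M. (cmod (f x))\<^sup>2) + (LINT x|M. (cmod (g x))\<^sup>2) / e"
proof -
  have le: "cmod (f x) * cmod (g x) \<le> e * (cmod (f x))\<^sup>2 + (cmod (g x))\<^sup>2 / e" for x
  proof -
    have "0 \<le> (e * cmod (f x) - cmod (g x))\<^sup>2 / e" using e by simp
    moreover have "(e * cmod (f x) - cmod (g x))\<^sup>2 / e
        = e * (cmod (f x))\<^sup>2 - 2 * (cmod (f x) * cmod (g x)) + (cmod (g x))\<^sup>2 / e"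
      using e by (simp add: power2_eq_square field_simps)
    moreover have "0 \<le> cmod (f x) * cmod (g x)" by simp
    ultimately show ?thesis by linarith
  qed
  have i: "integrable M (\<lambda>x. f x * cnj (g x))"
    by (rule integrable_inner_square_integrable[OF f g])
  have "cmod (LINT x|M. f x * cnj (g x)) \<le> (LINT x|M. cmod (f x * cnj (g x)))"
    by simp
  also have "\<dots> \<le> (LINT x|M. e * (cmod (f x))\<^sup>2 + (cmod (g x))\<^sup>2 / e)"
    using integrable_norm[OF i] f g le
    by (intro integral_mono) (auto simp: square_integrable_def norm_mult)
  also have "\<dots> = e * (LINT x|M. (cmod (f x))\<^sup>2) + (LINT x|M. (cmod (g x))\<^sup>2) / e"
    using f g by (subst Bochner_Integration.integral_add) (auto simp: square_integrable_def)
  finally show ?thesis .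
qed

text \<open>With s the orthogonal projection of v onto the span of the \<open>e i\<close>, both (v,
  s) and (s, s) equal the left side, and the squared norm of v - s is nonnegative. The system is not
  normalized; \<open>c i\<close> is the squared norm of \<open>e i\<close>.\<close>

lemma Bessel_inequality:
  assumes v: "square_integrable M v" and I: "finite I"
    and e: "\<And>i. i \<in> I \<Longrightarrow> square_integrable M (e i)"
    and orth: "\<And>i j. i \<in> I \<Longrightarrow> j \<in> I \<Longrightarrow> i \<noteq> j \<Longrightarrow> (LINT x|M. e i x * cnj (e j x)) = 0"
    and c: "\<And>i. i \<in> I \<Longrightarrow> (LINT x|M. e i x * cnj (e i x)) = of_real (c i)"
      "\<And>i. i \<in> I \<Longrightarrow> c i > 0"
  shows "(\<Sum>i\<in>I. (cmod (LINT x|M. v x * cnj (e i x)))\<^sup>2 / c i) \<le> (LINT x|M. (cmod (v x))\<^sup>2)"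
proof -
  define b where "b i = (LINT x|M. v x * cnj (e i x))" for i
  define a where "a i = b i / of_real (c i)" for i
  define s where "s x = (\<Sum>i\<in>I. a i * e i x)" for x
  have s: "square_integrable M s"
    unfolding s_def by (intro square_integrable_sum square_integrable_cmult e)
  have vs: "(LINT x|M. v x * cnj (s x)) = of_real (\<Sum>i\<in>I. (cmod (b i))\<^sup>2 / c i)"
  proof -
    have "(LINT x|M. v x * cnj (s x)) = (LINT x|M. (\<Sum>i\<in>I. cnj (a i) * (v x * cnj (e i x))))"
      by (simp add: s_def cnj_sum sum_distrib_left mult_ac)
    also have "\<dots> = (\<Sum>i\<in>I. (LINT x|M. cnj (a i) * (v x * cnj (e i x))))"
      by (intro Bochner_Integration.integral_sum integrable_mult_right
          integrable_inner_square_integrable v e)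
    also have "\<dots> = (\<Sum>i\<in>I. of_real ((cmod (b i))\<^sup>2 / c i))"
      by (intro sum.cong refl)
        (simp add: b_def[symmetric] a_def complex_norm_square[symmetric] mult.commute[of "cnj _"])
    finally show ?thesis by simp
  qed
  have ss: "(LINT x|M. s x * cnj (s x)) = of_real (\<Sum>i\<in>I. (cmod (b i))\<^sup>2 / c i)"
  proof -
    have "(LINT x|M. s x * cnj (s x))
        = (LINT x|M. (\<Sum>i\<in>I. (\<Sum>j\<in>I. (a i * cnj (a j)) * (e i x * cnj (e j x)))))"
      by (simp add: s_def cnj_sum sum_product mult_ac)
    also have "\<dots> = (\<Sum>i\<in>I. (LINT x|M. (\<Sum>j\<in>I. (a i * cnj (a j)) * (e i x * cnj (e j x)))))"
      by (intro Bochner_Integration.integral_sum Bochner_Integration.integrable_sum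
          integrable_mult_right integrable_inner_square_integrable e)
    also have "\<dots> = (\<Sum>i\<in>I. of_real ((cmod (b i))\<^sup>2 / c i))"
    proof (intro sum.cong refl)
      fix i assume i: "i \<in> I"
      have "(LINT x|M. (\<Sum>j\<in>I. (a i * cnj (a j)) * (e i x * cnj (e j x))))
          = (\<Sum>j\<in>I. (LINT x|M. (a i * cnj (a j)) * (e i x * cnj (e j x))))"
        using i by (intro Bochner_Integration.integral_sum
          integrable_mult_right integrable_inner_square_integrable e)
      also have "\<dots> = (\<Sum>j\<in>I. if j = i then a i * cnj (a i) * of_real (c i) else 0)"
        using i orth c(1) by (intro sum.cong) auto
      also have "\<dots> = a i * cnj (a i) * of_real (c i)"
        using i I by simp
      also have "\<dots> = of_real ((cmod (b i))\<^sup>2 / c i)"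
        using c(2)[OF i] by (simp add: a_def complex_norm_square[symmetric])
      finally show "(LINT x|M. (\<Sum>j\<in>I. (a i * cnj (a j)) * (e i x * cnj (e j x))))
          = of_real ((cmod (b i))\<^sup>2 / c i)" .
    qed
    finally show ?thesis by simp
  qed
  have ns: "(cmod z)\<^sup>2 = Re (z * cnj z)" for z
    by (simp add: complex_norm_square[symmetric])
  have "0 \<le> (LINT x|M. (cmod (v x - s x))\<^sup>2)"
    by simp
  also have "\<dots> = (LINT x|M. (cmod (v x))\<^sup>2 - 2 * Re (v x * cnj (s x)) + Re (s x * cnj (s x)))"
  proof (rule Bochner_Integration.integral_cong)
    fix x
    show "(cmod (v x - s x))\<^sup>2 = (cmod (v x))\<^sup>2 - 2 * Re (v x * cnj (s x)) + Re (s x * cnj (s x))"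
      unfolding cmod_power2 by (simp add: power2_eq_square algebra_simps)
  qed simp
  also have "\<dots> = (LINT x|M. (cmod (v x))\<^sup>2) - 2 * (LINT x|M. Re (v x * cnj (s x)))
      + (LINT x|M. Re (s x * cnj (s x)))"
    using integrable_Re[OF integrable_inner_square_integrable[OF v s]]
      integrable_Re[OF integrable_inner_square_integrable[OF s s]] square_integrableD(2)[OF v]
    by (subst Bochner_Integration.integral_add Bochner_Integration.integral_diff;
        simp only: Bochner_Integration.integrable_diff integrable_mult_right integral_mult_right_zero)+
  also have "(LINT x|M. Re (v x * cnj (s x))) = (\<Sum>i\<in>I. (cmod (b i))\<^sup>2 / c i)"
    using integral_Re[OF integrable_inner_square_integrable[OF v s]] vs by simp
  also have "(LINT x|M. Re (s x * cnj (s x))) = (\<Sum>i\<in>I. (cmod (b i))\<^sup>2 / c i)"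
    using integral_Re[OF integrable_inner_square_integrable[OF s s]] ss by simp
  finally show ?thesis
    by (simp add: b_def)
qed

lemma integrable_monomial_mult:
  fixes w :: "complex \<Rightarrow> complex"
  assumes "integrable dA w"
  shows "integrable dA (\<lambda>z. w z * z ^ j * cnj z ^ k)"
proof (rule Bochner_Integration.integrable_bound[OF assms])
  show "(\<lambda>z. w z * z ^ j * cnj z ^ k) \<in> borel_measurable dA"
    using assms by (intro borel_measurable_times continuous_on_imp_borel_measurable_dA[of "\<lambda>z. z ^ j"]
        continuous_on_imp_borel_measurable_dA[of "\<lambda>z. cnj z ^ k"] continuous_intros) auto
  have "cmod (z ^ j * cnj z ^ k) \<le> 1" if "z \<in> unit_disk" for z
    using that by (simp add: norm_mult norm_power mult_le_one power_le_one)
  then have "cmod (w z * (z ^ j * cnj z ^ k)) \<le> cmod (w z)" if "z \<in> unit_disk" for z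
    using that by (subst norm_mult) (simp add: mult_left_le)
  then show "AE z in dA. norm (w z * z ^ j * cnj z ^ k) \<le> norm (w z)"
    by (intro AE_I2) (simp add: mult.assoc)
qed

text \<open>Fatou's lemma for the squared moduli. It turns pointwise convergence of polynomial
  partial sums in the disk into norm estimates for the limit.\<close>

lemma square_integrable_Fatou:
  assumes S: "\<And>n. square_integrable M (S n)" and lim: "\<And>x. x \<in> space M \<Longrightarrow> (\<lambda>n. S n x) \<longlonglongrightarrow> g x"
    and F: "\<And>n. (LINT x|M. (cmod (S n x))\<^sup>2) \<le> F"
  shows "square_integrable M g" and "(LINT x|M. (cmod (g x))\<^sup>2) \<le> F"
proof -
  have [measurable]: "S n \<in> borel_measurable M" for n
    using S by (auto simp: square_integrable_def)
  have g [measurable]: "g \<in> borel_measurable M"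
    by (rule borel_measurable_LIMSEQ_metric[OF _ lim]) measurable
  have F0: "F \<ge> 0"
    using order_trans[OF _ F[of 0]] by simp
  have "(\<integral>\<^sup>+x. ennreal ((cmod (g x))\<^sup>2) \<partial>M) = (\<integral>\<^sup>+x. liminf (\<lambda>n. ennreal ((cmod (S n x))\<^sup>2)) \<partial>M)"
  proof (rule nn_integral_cong)
    fix x assume "x \<in> space M"
    then have "(\<lambda>n. ennreal ((cmod (S n x))\<^sup>2)) \<longlonglongrightarrow> ennreal ((cmod (g x))\<^sup>2)"
      by (intro tendsto_ennrealI tendsto_intros lim)
    then show "ennreal ((cmod (g x))\<^sup>2) = liminf (\<lambda>n. ennreal ((cmod (S n x))\<^sup>2))"
      by (intro lim_imp_Liminf[symmetric]) auto
  qed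
  also have "\<dots> \<le> liminf (\<lambda>n. \<integral>\<^sup>+x. ennreal ((cmod (S n x))\<^sup>2) \<partial>M)"
    by (rule nn_integral_liminf) measurable
  also have "\<dots> \<le> liminf (\<lambda>n. ennreal F)"
  proof (intro Liminf_mono always_eventually allI)
    fix n
    show "(\<integral>\<^sup>+x. ennreal ((cmod (S n x))\<^sup>2) \<partial>M) \<le> ennreal F"
      using S[of n] F[of n] F0
      by (subst nn_integral_eq_integral) (auto simp: square_integrable_def ennreal_leI)
  qed
  also have "\<dots> = ennreal F"
    by (rule Liminf_const) simp
  finally have le: "(\<integral>\<^sup>+x. ennreal ((cmod (g x))\<^sup>2) \<partial>M) \<le> ennreal F" .
  have i: "integrable M (\<lambda>x. (cmod (g x))\<^sup>2)"
  proof (rule integrableI_bounded)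
    show "(\<integral>\<^sup>+x. ennreal (norm ((cmod (g x))\<^sup>2)) \<partial>M) < \<infinity>"
      using le_less_trans[OF le, of \<infinity>] by simp
  qed measurable
  then show "square_integrable M g"
    using g by (simp add: square_integrable_def)
  show "(LINT x|M. (cmod (g x))\<^sup>2) \<le> F"
    using le i F0 by (subst (asm) nn_integral_eq_integral) (auto simp: ennreal_le_iff)
qed

section \<open>Moments determine a function\<close>

text \<open>The monomials in z and cnj z span all polynomials in Re z and Im z, which are dense in
  the continuous functions on the closed disk.\<close>

definition annihilates_monomials :: "(complex \<Rightarrow> complex) \<Rightarrow> bool" where
  "annihilates_monomials w \<longleftrightarrow>
     integrable dA w \<and> (\<forall>j k. (LINT z|dA. w z * z ^ j * cnj z ^ k) = 0)"

lemma annihilates_monomials_integrable: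
  "annihilates_monomials w \<Longrightarrow> integrable dA w"
  by (simp add: annihilates_monomials_def)

lemma annihilates_monomials_integral:
  assumes "annihilates_monomials w"
  shows "(LINT z|dA. w z) = 0"
proof -
  have "(LINT z|dA. w z * z ^ 0 * cnj z ^ 0) = 0"
    using assms unfolding annihilates_monomials_def by blast
  then show ?thesis by simp
qed

lemma annihilates_monomials_cmult:
  assumes "annihilates_monomials w"
  shows "annihilates_monomials (\<lambda>z. c * w z)"
  using assms by (simp add: annihilates_monomials_def mult.assoc)

lemma annihilates_monomials_add:
  assumes "annihilates_monomials w" "annihilates_monomials w'"
  shows "annihilates_monomials (\<lambda>z. w z + w' z)"
proof -
  have "(LINT z|dA. (w z + w' z) * z ^ j * cnj z ^ k) =
      (LINT z|dA. w z * z ^ j * cnj z ^ k) + (LINT z|dA. w' z * z ^ j * cnj z ^ k)" for j k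
    using assms unfolding distrib_right
    by (intro Bochner_Integration.integral_add integrable_monomial_mult)
      (simp_all add: annihilates_monomials_def)
  then show ?thesis
    using assms by (simp add: annihilates_monomials_def)
qed

lemma annihilates_monomials_monomial_mult:
  assumes "annihilates_monomials w"
  shows "annihilates_monomials (\<lambda>z. w z * z ^ m * cnj z ^ n)"
proof -
  have "w z * z ^ m * cnj z ^ n * z ^ j * cnj z ^ k = w z * z ^ (m + j) * cnj z ^ (n + k)" for j k z
    by (simp only: power_add mult_ac)
  then show ?thesis
    using assms integrable_monomial_mult by (simp only: annihilates_monomials_def simp_thms)
qed

text \<open>Induction on the polynomial with \<open>w\<close> arbitrary: for a product, the
  hypothesis on the second factor is applied to w times the first.\<close>

lemma annihilates_monomials_real_polynomial_mult:
  assumes "real_polynomial_function p" "annihilates_monomials w"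
  shows "annihilates_monomials (\<lambda>z. w z * of_real (p z))"
  using assms
proof (induction arbitrary: w)
  case (linear f)
  then interpret bounded_linear f by simp
  \<comment> \<open>Substituting Re z = (z + cnj z) / 2 and Im z = (z - cnj z) / (2 i) into f z = Re
    z f(1) + Im z f(i) gives these coefficients.\<close>
  define \<alpha> \<beta> where "\<alpha> = (of_real (f 1) - \<i> * of_real (f \<i>)) / 2"
    and "\<beta> = (of_real (f 1) + \<i> * of_real (f \<i>)) / 2"
  have "complex_of_real (f z) = \<alpha> * z + \<beta> * cnj z" for z
  proof -
    have "f z = f (Re z *\<^sub>R 1 + Im z *\<^sub>R \<i>)"
      by (rule arg_cong[where f = f]) (simp add: complex_eq_iff)
    also have "\<dots> = Re z * f 1 + Im z * f \<i>"
      by (simp only: add scaleR) simp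
    finally show ?thesis
      by (simp add: complex_eq_iff \<alpha>_def \<beta>_def field_simps)
  qed
  then have eq: "(\<lambda>z. w z * of_real (f z)) = (\<lambda>z. \<alpha> * (w z * z ^ 1 * cnj z ^ 0) + \<beta> * (w z * z ^ 0 * cnj z ^ 1))"
    by (simp add: fun_eq_iff algebra_simps)
  show ?case
    unfolding eq
    by (intro annihilates_monomials_add annihilates_monomials_cmult
        annihilates_monomials_monomial_mult linear.prems)
next
  case (const c)
  then show ?case
    using annihilates_monomials_cmult[of w "of_real c"] by (simp add: mult.commute)
next
  case (add f g)
  then show ?case
    using annihilates_monomials_add by (simp add: distrib_left)
next
  case (mult f g)
  then show ?case
    by (simp add: mult.assoc[symmetric])
qed

text \<open>Stone-Weierstrass on the closed disk. The tolerance e / (W + 1), with W the L^1 norm of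
  w, makes the error at most e and is defined even when W = 0.\<close>

lemma annihilates_monomials_continuous:
  fixes \<phi> :: "complex \<Rightarrow> real"
  assumes w: "annihilates_monomials w" and \<phi>: "continuous_on (cball 0 1) \<phi>"
  shows "(LINT z|dA. w z * of_real (\<phi> z)) = 0"
proof -
  define W where "W = (LINT z|dA. cmod (w z))"
  have wi: "integrable dA w" using w by (simp add: annihilates_monomials_def)
  have "cmod (LINT z|dA. w z * of_real (\<phi> z)) \<le> 0 + e" if e: "e > 0" for e
  proof -
    have W0: "W \<ge> 0" unfolding W_def by simp
    then have e': "e / (W + 1) > 0" using e by simp
    obtain p where p: "real_polynomial_function p" "\<And>z. z \<in> cball 0 1 \<Longrightarrow> \<bar>\<phi> z - p z\<bar> < e / (W + 1)"
      using Stone_Weierstrass_real_polynomial_function[OF compact_cball \<phi> e'] by blast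
    have wp: "annihilates_monomials (\<lambda>z. w z * of_real (p z))"
      by (rule annihilates_monomials_real_polynomial_mult[OF p(1) w])
    then have wp0: "(LINT z|dA. w z * of_real (p z)) = 0" "integrable dA (\<lambda>z. w z * of_real (p z))"
      by (rule annihilates_monomials_integral annihilates_monomials_integrable)+
    have "continuous_on (cball 0 1) (\<lambda>z. \<phi> z - p z)"
      by (intro continuous_intros \<phi> continuous_at_imp_continuous_on ballI continuous_real_polymonial_function p(1))
    then have "(\<lambda>z. \<phi> z - p z) \<in> borel_measurable dA"
      by (intro continuous_on_imp_borel_measurable_dA) (rule continuous_on_subset, auto)
    then have m: "(\<lambda>z. w z * of_real (\<phi> z - p z)) \<in> borel_measurable dA"
      using wi by measurable
    have le: "cmod (w z * of_real (\<phi> z - p z)) \<le> cmod (w z) * (e / (W + 1))" if "z \<in> unit_disk" for z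
      unfolding norm_mult norm_of_real using p(2)[of z] that by (intro mult_left_mono) auto
    have i: "integrable dA (\<lambda>z. w z * of_real (\<phi> z - p z))"
    proof (rule Bochner_Integration.integrable_bound[OF _ m])
      show "integrable dA (\<lambda>z. cmod (w z) * (e / (W + 1)))" using wi by simp
      show "AE z in dA. norm (w z * of_real (\<phi> z - p z)) \<le> norm (cmod (w z) * (e / (W + 1)))"
      proof (intro AE_I2)
        fix z assume "z \<in> space dA"
        then have "z \<in> unit_disk" by simp
        from order_trans[OF le[OF this] abs_ge_self]
        show "norm (w z * of_real (\<phi> z - p z)) \<le> norm (cmod (w z) * (e / (W + 1)))"
          by (simp only: real_norm_def)
      qed
    qed
    have "(LINT z|dA. w z * of_real (\<phi> z)) = (LINT z|dA. w z * of_real (\<phi> z - p z) + w z * of_real (p z))"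
      by (simp add: algebra_simps)
    also have "\<dots> = (LINT z|dA. w z * of_real (\<phi> z - p z))"
      by (subst Bochner_Integration.integral_add[OF i wp0(2)]) (simp add: wp0(1))
    finally have "cmod (LINT z|dA. w z * of_real (\<phi> z)) \<le> (LINT z|dA. cmod (w z * of_real (\<phi> z - p z)))"
      by simp
    also have "\<dots> \<le> (LINT z|dA. cmod (w z) * (e / (W + 1)))"
      using i wi le by (intro integral_mono) auto
    also have "\<dots> = W * (e / (W + 1))"
      by (simp add: W_def)
    also have "\<dots> \<le> e"
      using e W0 by (simp add: divide_simps)
    finally show ?thesis by simp
  qed
  then show ?thesis
    using field_le_epsilon[of "cmod (LINT z|dA. w z * of_real (\<phi> z))" 0] by simp
qed

lemma Int_unit_disk_sets_dA:
  assumes "A \<in> sets borel"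
  shows "A \<inter> unit_disk \<in> sets dA"
  using assms by (auto simp: dA_def sets_restrict_space)

text \<open>Closed sets generate the Borel sets and are stable under intersection, so Dynkin's
  argument reduces the claim to a closed C, whose indicator is the pointwise limit of max(0, 1 - n
  dist(z, C)).\<close>

lemma annihilates_monomials_borel:
  assumes w: "annihilates_monomials w" and A: "A \<in> sets borel"
  shows "(LINT z:(A \<inter> unit_disk)|dA. w z) = 0"
proof -
  have wi [measurable]: "integrable dA w" using w by (simp add: annihilates_monomials_def)
  have si: "set_integrable dA (A \<inter> unit_disk) w" if "A \<in> sets borel" for A
    unfolding set_integrable_def by (intro integrable_mult_indicator Int_unit_disk_sets_dA that wi)
  have stable: "Int_stable (Collect closed :: complex set set)"
    by (auto simp: Int_stable_def)
  have "A \<in> sigma_sets UNIV (Collect closed)"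
    using A by (simp add: borel_eq_closed)
  from stable subset_UNIV[of "Collect closed", folded Pow_UNIV] this show ?thesis
  proof (induction rule: sigma_sets_induct_disjoint)
    case (basic C)
    then have C: "closed C" by simp
    show ?case
    \<comment> \<open>By convention \<open>infdist z {} = 0\<close>, which would make every
      \<open>\<phi> n\<close> below constantly 1; the empty set is treated on its own.\<close>
    proof (cases "C = {}")
      case True then show ?thesis by (simp add: set_lebesgue_integral_def)
    next
      case False
      define \<phi> where "\<phi> n z = max 0 (1 - real n * infdist z C)" for n z
      have "(\<lambda>n. LINT z|dA. w z * of_real (\<phi> n z)) \<longlonglongrightarrow> (LINT z|dA. indicator (C \<inter> unit_disk) z *\<^sub>R w z)"
      proof (rule integral_dominated_convergence[where w = "\<lambda>z. cmod (w z)"])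
        show "(\<lambda>z. indicator (C \<inter> unit_disk) z *\<^sub>R w z) \<in> borel_measurable dA"
          using si[of C] C by (auto simp: set_integrable_def)
        have "continuous_on unit_disk (\<phi> n)" for n
          unfolding \<phi>_def by (intro continuous_intros)
        then have [measurable]: "\<phi> n \<in> borel_measurable dA" for n
          by (rule continuous_on_imp_borel_measurable_dA)
        show "(\<lambda>z. w z * of_real (\<phi> n z)) \<in> borel_measurable dA" for n
          by measurable
        show "AE z in dA. norm (w z * of_real (\<phi> n z)) \<le> cmod (w z)" for n
          by (intro AE_I2) (auto simp: norm_mult \<phi>_def infdist_nonneg intro!: mult_left_le)
        show "AE z in dA. (\<lambda>n. w z * of_real (\<phi> n z)) \<longlonglongrightarrow> indicator (C \<inter> unit_disk) z *\<^sub>R w z"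
        proof (intro AE_I2)
          fix z assume z: "z \<in> space dA"
          have "(\<lambda>n. \<phi> n z) \<longlonglongrightarrow> indicator C z"
          proof (cases "z \<in> C")
            case True
            then show ?thesis by (simp add: \<phi>_def)
          next
            case nC: False
            then have d: "infdist z C > 0"
              using C False by (simp add: infdist_pos_not_in_closed)
            obtain N where N: "real N * infdist z C > 1"
              using d ex_less_of_nat_mult by blast
            have "\<phi> n z = 0" if "n \<ge> N" for n
            proof -
              have "real N * infdist z C \<le> real n * infdist z C"
                using that d by (intro mult_right_mono) auto
              then show ?thesis using N by (simp add: \<phi>_def)
            qed
            then have "\<forall>\<^sub>F n in sequentially. \<phi> n z = 0"
              by (auto simp: eventually_sequentially)
            then show ?thesis using nC by (simp add: tendsto_eventually)
          qed
          then have "(\<lambda>n. w z * of_real (\<phi> n z)) \<longlonglongrightarrow> w z * of_real (indicator C z)"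
            by (intro tendsto_intros)
          then show "(\<lambda>n. w z * of_real (\<phi> n z)) \<longlonglongrightarrow> indicator (C \<inter> unit_disk) z *\<^sub>R w z"
            using z by (cases "z \<in> C") auto
        qed
      qed (use wi in auto)
      moreover have "(LINT z|dA. w z * of_real (\<phi> n z)) = 0" for n
        by (rule annihilates_monomials_continuous[OF w]) (auto simp: \<phi>_def intro!: continuous_intros)
      ultimately show ?thesis
        by (simp add: set_lebesgue_integral_def LIMSEQ_const_iff)
    qed
  next
    case empty
    show ?case by (simp add: set_lebesgue_integral_def)
  next
    case (compl A)
    have A: "A \<in> sets borel" using compl(1) by (simp add: borel_eq_closed)
    have "(LINT z|dA. w z) = 0"
      using w by (rule annihilates_monomials_integral)
    moreover have "(LINT z|dA. w z) = (LINT z|dA. indicator ((UNIV - A) \<inter> unit_disk) z *\<^sub>R w z + indicator (A \<inter> unit_disk) z *\<^sub>R w z)"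
      by (intro Bochner_Integration.integral_cong) (auto simp: indicator_def)
    moreover have "\<dots> = (LINT z:((UNIV - A) \<inter> unit_disk)|dA. w z) + (LINT z:(A \<inter> unit_disk)|dA. w z)"
      unfolding set_lebesgue_integral_def
      using si[of "UNIV - A"] si[of A] A
      by (intro Bochner_Integration.integral_add) (auto simp: set_integrable_def)
    ultimately show ?case using compl(2) by simp
  next
    case (union A)
    have A: "A i \<in> sets borel" for i using union(2) by (auto simp: borel_eq_closed)
    have UN_eq: "(\<Union>i. A i \<inter> unit_disk) = (\<Union>i. A i) \<inter> unit_disk"
      by blast
    have "(LINT z:(\<Union>i. A i \<inter> unit_disk)|dA. w z) = (\<Sum>i. LINT z:(A i \<inter> unit_disk)|dA. w z)"
    proof (rule lebesgue_integral_countable_add)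
      show "set_integrable dA (\<Union>i. A i \<inter> unit_disk) w"
        unfolding UN_eq by (rule si) (use A in blast)
      show "(A i \<inter> unit_disk) \<inter> (A j \<inter> unit_disk) = {}" if "i \<noteq> j" for i j
        using union(1) that by (auto simp: disjoint_family_on_def)
    qed (rule Int_unit_disk_sets_dA[OF A])
    then show ?case
      unfolding UN_eq by (simp only: union(3) suminf_zero)
  qed
qed

text \<open>The set A where a Borel representative has positive real part is a Borel test set. Over
  it Re w is positive almost everywhere and yet integrates to 0, so A meets the disk in a null
  set.\<close>

lemma annihilates_monomials_Re_nonpos:
  assumes w: "annihilates_monomials w"
  shows "AE z in dA. Re (w z) \<le> 0"
proof -
  have wi: "integrable dA w" using w by (simp add: annihilates_monomials_def)
  obtain G where G [measurable]: "G \<in> borel_measurable borel" and wG: "AE z in dA. w z = G z"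
    using borel_representative_dA[OF borel_measurable_integrable[OF wi]] by blast
  define A where "A = {z. Re (G z) > 0}"
  have "A = {z \<in> space borel. Re (G z) > 0}" by (simp add: A_def)
  also have "\<dots> \<in> sets borel" by measurable
  finally have A: "A \<in> sets borel" .
  let ?f = "\<lambda>z. indicator (A \<inter> unit_disk) z *\<^sub>R w z"
  have fi: "integrable dA ?f"
    by (intro integrable_mult_indicator Int_unit_disk_sets_dA A wi)
  have "(LINT z|dA. Re (?f z)) = Re (LINT z|dA. ?f z)"
    using fi by (rule integral_Re)
  also have "\<dots> = 0"
    using annihilates_monomials_borel[OF w A] by (simp add: set_lebesgue_integral_def)
  finally have 0: "(LINT z|dA. Re (?f z)) = 0" .
  have ri: "integrable dA (\<lambda>z. Re (?f z))" using fi by (rule integrable_Re)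
  have "AE z in dA. 0 \<le> Re (?f z)"
    using wG by eventually_elim (simp add: A_def indicator_def)
  with 0 have "AE z in dA. Re (?f z) = 0"
    using integral_nonneg_eq_0_iff_AE[OF ri] by blast
  moreover have "AE z in dA. z \<in> unit_disk"
    by (intro AE_I2) simp
  ultimately show ?thesis
    using wG by eventually_elim (auto simp: A_def indicator_def split: if_splits)
qed

text \<open>The one-sided estimate for w, -w, i w and -i w bounds the real and the imaginary part
  from both sides.\<close>

theorem annihilates_monomials_imp_AE_zero:
  assumes w: "annihilates_monomials w"
  shows "AE z in dA. w z = 0"
  using annihilates_monomials_Re_nonpos[OF w]
    annihilates_monomials_Re_nonpos[OF annihilates_monomials_cmult[OF w, of "-1"]]
    annihilates_monomials_Re_nonpos[OF annihilates_monomials_cmult[OF w, of "\<i>"]]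
    annihilates_monomials_Re_nonpos[OF annihilates_monomials_cmult[OF w, of "-\<i>"]]
  by eventually_elim (simp add: complex_eq_iff)

section \<open>The Bergman projection\<close>

lemma mem_L2_iff: "f \<in> L2 \<longleftrightarrow> square_integrable dA f"
  by (simp add: L2_def square_integrable_def)

lemma square_integrable_dA_bounded_mult:
  assumes "square_integrable dA f" "\<phi> \<in> borel_measurable dA" "AE z in dA. cmod (\<phi> z) \<le> C"
  shows "square_integrable dA (\<lambda>z. \<phi> z * f z)"
proof (rule square_integrable_bound[OF assms(1)])
  show "(\<lambda>z. \<phi> z * f z) \<in> borel_measurable dA"
    using assms by (auto dest: square_integrableD(1))
  show "AE z in dA. cmod (\<phi> z * f z) \<le> C * cmod (f z)"
    using assms(3) by eventually_elim (auto simp: norm_mult intro: mult_right_mono)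
qed

lemma square_integrable_dA_bounded:
  assumes "\<phi> \<in> borel_measurable dA" "AE z in dA. cmod (\<phi> z) \<le> C"
  shows "square_integrable dA \<phi>"
proof -
  have "square_integrable dA (\<lambda>z. 1)"
    by (simp add: square_integrable_def)
  from square_integrable_dA_bounded_mult[OF this assms] show ?thesis by simp
qed

lemma square_integrable_dA_imp_integrable:
  assumes "square_integrable dA f"
  shows "integrable dA f"
  using integrable_inner_square_integrable[OF assms square_integrable_dA_bounded[of "\<lambda>z. 1" 1]]
  by simp

lemma square_integrable_power: "square_integrable dA (\<lambda>z. z ^ k)"
  by (rule square_integrable_dA_bounded[of _ 1])
    (auto intro!: continuous_on_imp_borel_measurable_dA continuous_intros AE_I2
      simp: norm_power power_le_one)

lemma not_AE_dA_notin_open: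
  assumes "open U" "U \<noteq> {}" "U \<subseteq> unit_disk"
  shows "\<not> (AE z in dA. z \<notin> U)"
proof
  assume "AE z in dA. z \<notin> U"
  then have "AE z in lborel. z \<notin> U"
    unfolding AE_dA_iff using assms(3) by (auto elim!: eventually_mono)
  then have "U \<in> null_sets lborel"
    using assms(1) by (subst AE_iff_null_sets) auto
  then have "negligible U"
    unfolding negligible_iff_null_sets by (rule null_sets_completionI)
  with assms(1,2) show False
    using open_not_negligible by blast
qed

definition monomial_norm2 :: "nat \<Rightarrow> real" where
  "monomial_norm2 k = (LINT z|dA. cmod z ^ (2 * k))"

lemma power_mult_cnj_power: "z ^ k * cnj z ^ k = of_real (cmod z ^ (2 * k))"
proof -
  have "z ^ k * cnj z ^ k = (z * cnj z) ^ k"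
    by (simp add: power_mult_distrib)
  also have "\<dots> = of_real ((cmod z)\<^sup>2) ^ k"
    by (simp only: complex_norm_square)
  finally show ?thesis
    by (simp add: power_mult)
qed

lemma integral_monomial_norm2: "(LINT z|dA. z ^ k * cnj z ^ k) = of_real (monomial_norm2 k)"
  unfolding power_mult_cnj_power monomial_norm2_def by (rule integral_complex_of_real)

text \<open>\<open>m\<close> is the measure of the annulus r < |z| < 1, on which |z|^(2k) is at
  least r^(2k). The bound limits the growth of the coefficients of a projection and thereby secures
  its convergence in the disk.\<close>

lemma monomial_norm2_lower_bound:
  assumes r: "0 \<le> r" "r < 1"
  obtains m where "m > 0" "\<And>k. m * r ^ (2 * k) \<le> monomial_norm2 k"
proof
  define U where "U = {z :: complex. r < cmod z \<and> cmod z < 1}"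
  have "open U"
    unfolding U_def by (intro open_Collect_conj open_Collect_less continuous_intros)
  have mU [measurable]: "(indicator U :: complex \<Rightarrow> real) \<in> borel_measurable dA"
    using \<open>open U\<close> by (intro borel_measurable_dA borel_measurable_indicator) auto
  have iU: "integrable dA (indicator U :: complex \<Rightarrow> real)"
    by (rule dA.integrable_const_bound[where B = 1]) (auto simp: indicator_def)
  have "of_real ((r + 1) / 2) \<in> U"
    using r by (simp add: U_def del: of_real_divide of_real_add)
  then have "U \<noteq> {}" by blast
  have "(LINT z|dA. indicator U z) \<noteq> (0 :: real)"
  proof
    assume "(LINT z|dA. indicator U z) = (0 :: real)"
    then have "AE z in dA. indicator U z = (0 :: real)"
      using integral_nonneg_eq_0_iff_AE[OF iU] by simp
    then have "AE z in dA. z \<notin> U"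
      by eventually_elim (simp add: indicator_def split: if_splits)
    moreover have "U \<subseteq> unit_disk" by (auto simp: U_def)
    ultimately show False
      using not_AE_dA_notin_open[OF \<open>open U\<close> \<open>U \<noteq> {}\<close>] by blast
  qed
  moreover have "(LINT z|dA. indicator U z) \<ge> (0 :: real)" by simp
  ultimately show "(LINT z|dA. indicator U z) > (0 :: real)" by linarith
  fix k
  have "(LINT z|dA. indicator U z) * r ^ (2 * k) = (LINT z|dA. indicator U z * r ^ (2 * k))"
    by simp
  also have "\<dots> \<le> monomial_norm2 k"
    unfolding monomial_norm2_def
  proof (rule integral_mono)
    show "integrable dA (\<lambda>z. cmod z ^ (2 * k))"
      by (rule dA.integrable_const_bound[where B = 1])
        (auto intro!: continuous_on_imp_borel_measurable_dA continuous_intros AE_I2 simp: power_le_one)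
    show "indicator U z * r ^ (2 * k) \<le> cmod z ^ (2 * k)" for z
      using r by (auto simp: U_def indicator_def intro!: power_mono)
  qed (use iU in simp)
  finally show "(LINT z|dA. indicator U z) * r ^ (2 * k) \<le> monomial_norm2 k" .
qed

lemma monomial_norm2_pos: "monomial_norm2 k > 0"
proof -
  obtain m where m: "m > 0" "\<And>k. m * (1 / 2) ^ (2 * k) \<le> monomial_norm2 k"
    using monomial_norm2_lower_bound[of "1 / 2"] by auto
  have "0 < m * (1 / 2) ^ (2 * k)" using m(1) by simp
  then show ?thesis using m(2)[of k] by linarith
qed

lemma monomials_orthogonal:
  assumes "j \<noteq> k"
  shows "(LINT z|dA. z ^ j * cnj (z ^ k)) = 0"
proof -
  have "radial (\<lambda>z. 1)" by (auto simp: radial_def)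
  from radial_orthogonal_monomials[OF _ this assms] show ?thesis by simp
qed

text \<open>The power series may be integrated termwise only over a smaller disk, where it converges
  uniformly; the cut-off symbol is still radial.\<close>

lemma radial_integral_power_series:
  assumes g: "g \<in> borel_measurable dA" "radial g" "AE z in dA. cmod (g z) \<le> C"
    and h: "integrable dA h" "\<And>z. z \<in> unit_disk \<Longrightarrow> (\<lambda>j. b j * z ^ j) sums h z"
  shows "(LINT z|dA. g z * h z * cnj z ^ k) = b k * (LINT z|dA. g z * of_real (cmod z ^ (2 * k)))"
proof -
  have [measurable]: "g \<in> borel_measurable dA" "h \<in> borel_measurable dA" using g h by auto
  have pm [measurable]: "(\<lambda>z. z ^ j) \<in> borel_measurable dA" "(\<lambda>z. cnj z ^ j) \<in> borel_measurable dA"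
      "(\<lambda>z. complex_of_real (cmod z ^ j)) \<in> borel_measurable dA" for j
    by (auto intro!: continuous_on_imp_borel_measurable_dA continuous_intros)
  define C' where "C' = max C 0"
  have C': "C' \<ge> 0" "AE z in dA. cmod (g z) \<le> C'"
    using g(3) by (auto simp: C'_def elim!: eventually_mono)
  have im [measurable]: "(indicator (ball 0 r) :: complex \<Rightarrow> complex) \<in> borel_measurable dA" for r
    by (intro borel_measurable_dA borel_measurable_indicator) simp
  have zk: "cmod z ^ k \<le> 1" if "z \<in> unit_disk" for z :: complex and k
    using that by (simp add: power_le_one)
  have cut: "(LINT z|dA. indicator (ball 0 r) z * (g z * h z * cnj z ^ k))
      = b k * (LINT z|dA. indicator (ball 0 r) z * (g z * of_real (cmod z ^ (2 * k))))"
    if r: "0 < r" "r < 1" for r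
  proof -
    define gr where "gr z = indicator (ball 0 r) z * g z" for z
    have gr [measurable]: "gr \<in> borel_measurable dA" unfolding gr_def by measurable
    obtain g' where g': "AE z in dA. g z = g' z" "AE z in dA. g' z = g' (of_real (cmod z))"
      using g(2) unfolding radial_def by blast
    have rad: "radial gr"
      unfolding radial_def
    proof (intro exI[of _ "\<lambda>z. indicator (ball 0 r) z * g' z"] conjI)
      show "AE z in dA. gr z = indicator (ball 0 r) z * g' z"
        using g'(1) by eventually_elim (simp add: gr_def)
      show "AE z in dA. indicator (ball 0 r) z * g' z
          = indicator (ball 0 r) (complex_of_real (cmod z)) * g' (of_real (cmod z))"
        using g'(2) by eventually_elim (auto simp: indicator_def)
    qed
    define f where "f j z = b j * (gr z * z ^ j * cnj z ^ k)" for j z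
    have fm [measurable]: "f j \<in> borel_measurable dA" for j
      unfolding f_def by measurable
    have sb: "summable (\<lambda>j. cmod (b j * of_real r ^ j))"
    proof -
      \<comment> \<open>Convergence at a point s strictly between r and 1 gives absolute convergence
        at r, which supplies the summable bound on the cut-off terms.\<close>
      define s where "s = (1 + r) / 2"
      have s: "r < s" "s < 1" using r by (auto simp: s_def)
      have "summable (\<lambda>j. b j * of_real s ^ j)"
        using h(2)[of "of_real s"] s r by (auto simp: sums_iff)
      then show ?thesis
        by (rule powser_insidea) (use s r in auto)
    qed
    have fb: "AE z in dA. cmod (f j z) \<le> C' * cmod (b j * of_real r ^ j)" for j
      using C'(2) AE_space
    proof eventually_elim
      case (elim z)
      show ?case
      proof (cases "cmod z < r")
        case True
        have "cmod (f j z) = cmod (b j) * (cmod (g z) * cmod z ^ j * cmod z ^ k)"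
          using True by (simp add: f_def gr_def norm_mult norm_power)
        also have "\<dots> \<le> cmod (b j) * (C' * r ^ j * 1)"
          using True elim C'(1) zk[of z k] r
          by (intro mult_left_mono mult_mono power_mono) auto
        finally show ?thesis using r by (simp add: norm_mult norm_power mult_ac)
      next
        case False
        then show ?thesis using C'(1) by (simp add: f_def gr_def)
      qed
    qed
    have fi: "integrable dA (f j)" for j
      by (rule dA.integrable_const_bound[OF fb fm])
    have s1: "AE z in dA. summable (\<lambda>j. norm (f j z))"
    proof -
      have "AE z in dA. \<forall>j. cmod (f j z) \<le> C' * cmod (b j * of_real r ^ j)"
        using fb by (simp add: AE_all_countable)
      then show ?thesis
      proof eventually_elim
        case (elim z)
        show ?case
          by (rule summable_comparison_test'[OF summable_mult[OF sb, of C']]) (use elim in simp)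
      qed
    qed
    have s2: "summable (\<lambda>j. LINT z|dA. norm (f j z))"
    proof (rule summable_comparison_test'[OF summable_mult[OF sb, of "C' * measure dA unit_disk"]])
      fix j
      have "(LINT z|dA. norm (f j z)) \<le> (LINT z|dA. C' * cmod (b j * of_real r ^ j))"
        using fi[of j] fb[of j] by (intro integral_mono_AE) auto
      also have "\<dots> = C' * measure dA unit_disk * cmod (b j * of_real r ^ j)"
        by simp
      finally show "norm (LINT z|dA. norm (f j z)) \<le> C' * measure dA unit_disk * cmod (b j * of_real r ^ j)"
        by simp
    qed
    have sums: "(\<lambda>j. LINT z|dA. f j z) sums (LINT z|dA. (\<Sum>j. f j z))"
      by (rule sums_integral[OF fi s1 s2])
    have suminf: "(\<Sum>j. f j z) = indicator (ball 0 r) z * (g z * h z * cnj z ^ k)" if "z \<in> unit_disk" for z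
    proof -
      have "(\<lambda>j. (b j * z ^ j) * (gr z * cnj z ^ k)) sums (h z * (gr z * cnj z ^ k))"
        by (intro sums_mult2 h(2) that)
      then have "(\<lambda>j. f j z) sums (h z * (gr z * cnj z ^ k))"
        by (simp add: f_def mult_ac)
      then show ?thesis
        by (simp add: sums_iff gr_def mult_ac)
    qed
    \<comment> \<open>Orthogonality against the radial symbol \<open>gr\<close> leaves only the term
      j = k of the series.\<close>
    have "(LINT z|dA. f j z) = 0" if "j \<noteq> k" for j
      unfolding f_def using radial_orthogonal_monomials[OF gr rad that] by simp
    then have single: "(\<lambda>j. LINT z|dA. f j z) = (\<lambda>j. if j = k then LINT z|dA. f j z else 0)"
      by (auto simp: fun_eq_iff)
    have "(\<lambda>j. LINT z|dA. f j z) sums (LINT z|dA. f k z)"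
      by (subst single) (rule sums_single)
    then have "(LINT z|dA. (\<Sum>j. f j z)) = (LINT z|dA. f k z)"
      using sums sums_unique2 by blast
    also have "(LINT z|dA. f k z) = b k * (LINT z|dA. indicator (ball 0 r) z * (g z * of_real (cmod z ^ (2 * k))))"
      unfolding f_def gr_def by (simp add: mult.assoc power_mult_cnj_power)
    also have "(LINT z|dA. (\<Sum>j. f j z)) = (LINT z|dA. indicator (ball 0 r) z * (g z * h z * cnj z ^ k))"
      by (intro Bochner_Integration.integral_cong refl suminf) simp
    finally show ?thesis .
  qed
  \<comment> \<open>The radii increase from 1/2 to 1; the shift by 2 keeps the first one
    positive.\<close>
  define r where "r n = 1 - 1 / (real n + 2)" for n
  have r: "0 < r n" "r n < 1" for n by (auto simp: r_def divide_simps)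
  have rlim: "r \<longlonglongrightarrow> 1"
    unfolding r_def by real_asymp
  have ind: "(\<lambda>n. indicator (ball 0 (r n)) z * c) \<longlonglongrightarrow> (c :: complex)" if "z \<in> unit_disk" for z c
  proof (rule tendsto_eventually)
    have "\<forall>\<^sub>F n in sequentially. cmod z < r n"
      using order_tendstoD(1)[OF rlim] that by simp
    then show "\<forall>\<^sub>F n in sequentially. indicator (ball 0 (r n)) z * c = c"
      by eventually_elim simp
  qed
  have lim: "(\<lambda>n. LINT z|dA. indicator (ball 0 (r n)) z * \<phi> z) \<longlonglongrightarrow> (LINT z|dA. \<phi> z)"
    if "integrable dA \<phi>" for \<phi> :: "complex \<Rightarrow> complex"
  proof (rule integral_dominated_convergence[where w = "\<lambda>z. cmod (\<phi> z)"])
    show "AE z in dA. (\<lambda>n. indicator (ball 0 (r n)) z * \<phi> z) \<longlonglongrightarrow> \<phi> z"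
      by (intro AE_I2 ind) simp
    show "AE z in dA. norm (indicator (ball 0 (r n)) z * \<phi> z) \<le> cmod (\<phi> z)" for n
      by (intro AE_I2) (simp add: indicator_def)
  qed (use that in auto)
  have i1: "integrable dA (\<lambda>z. g z * h z * cnj z ^ k)"
  proof (rule Bochner_Integration.integrable_bound)
    show "integrable dA (\<lambda>z. C' * cmod (h z))" using h(1) by simp
    show "AE z in dA. norm (g z * h z * cnj z ^ k) \<le> norm (C' * cmod (h z))"
      using C'(2) AE_space
    proof eventually_elim
      case (elim z)
      have "cmod (g z) * cmod (h z) * cmod z ^ k \<le> C' * cmod (h z) * 1"
        using elim C'(1) zk[of z k] by (intro mult_mono) auto
      then show ?case using C'(1) by (simp add: norm_mult norm_power)
    qed
  qed measurable
  have i2: "integrable dA (\<lambda>z. g z * of_real (cmod z ^ (2 * k)))"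
  proof (rule dA.integrable_const_bound[where B = C'])
    show "AE z in dA. norm (g z * of_real (cmod z ^ (2 * k))) \<le> C'"
      using C'(2) AE_space
    proof eventually_elim
      case (elim z)
      have "cmod (g z) * cmod z ^ (2 * k) \<le> C' * 1"
        using elim C'(1) zk[of z "2 * k"] by (intro mult_mono) auto
      then show ?case by (simp add: norm_mult norm_power)
    qed
  qed measurable
  show ?thesis
  proof (rule LIMSEQ_unique)
    show "(\<lambda>n. LINT z|dA. indicator (ball 0 (r n)) z * (g z * h z * cnj z ^ k))
        \<longlonglongrightarrow> (LINT z|dA. g z * h z * cnj z ^ k)"
      by (rule lim[OF i1])
    show "(\<lambda>n. LINT z|dA. indicator (ball 0 (r n)) z * (g z * h z * cnj z ^ k))
        \<longlonglongrightarrow> b k * (LINT z|dA. g z * of_real (cmod z ^ (2 * k)))"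
      unfolding cut[OF r] by (intro tendsto_mult_left lim[OF i2])
  qed
qed

section \<open>Taylor coefficients and polynomial approximation in the Bergman space\<close>

definition taylor_coeff :: "(complex \<Rightarrow> complex) \<Rightarrow> nat \<Rightarrow> complex" where
  "taylor_coeff h k = (deriv ^^ k) h 0 / fact k"

lemma bergman_spaceD:
  assumes "h \<in> bergman_space"
  shows "square_integrable dA h" "h holomorphic_on unit_disk" "z \<notin> unit_disk \<Longrightarrow> h z = 0"
    and "z \<in> unit_disk \<Longrightarrow> (\<lambda>j. taylor_coeff h j * z ^ j) sums h z"
  using assms holomorphic_power_series[of h 0 1 z]
  by (auto simp: bergman_space_def mem_L2_iff taylor_coeff_def)

lemma power_series_inner_monomial:
  assumes "integrable dA h" "\<And>z. z \<in> unit_disk \<Longrightarrow> (\<lambda>j. b j * z ^ j) sums h z"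
  shows "(LINT z|dA. h z * cnj z ^ k) = b k * of_real (monomial_norm2 k)"
proof -
  have rad: "radial (\<lambda>z. 1)" by (auto simp: radial_def)
  have "(LINT z|dA. 1 * h z * cnj z ^ k) = b k * (LINT z|dA. 1 * of_real (cmod z ^ (2 * k)))"
    by (rule radial_integral_power_series[OF _ rad _ assms, of 1]) auto
  then show ?thesis
    by (simp only: mult_1_left integral_complex_of_real monomial_norm2_def)
qed

lemma bergman_Bessel:
  assumes "square_integrable dA f" "finite I"
  shows "(\<Sum>k\<in>I. (cmod (LINT z|dA. f z * cnj z ^ k))\<^sup>2 / monomial_norm2 k) \<le> (LINT z|dA. (cmod (f z))\<^sup>2)"
proof -
  have "(\<Sum>k\<in>I. (cmod (LINT z|dA. f z * cnj (z ^ k)))\<^sup>2 / monomial_norm2 k) \<le> (LINT z|dA. (cmod (f z))\<^sup>2)"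
    by (rule Bessel_inequality[OF assms])
      (use monomials_orthogonal monomial_norm2_pos integral_monomial_norm2 in
        \<open>simp_all add: square_integrable_power\<close>)
  then show ?thesis by simp
qed

lemma polynomial_norm2:
  assumes "finite I"
  shows "(LINT z|dA. (cmod (\<Sum>k\<in>I. b k * z ^ k))\<^sup>2) = (\<Sum>k\<in>I. (cmod (b k))\<^sup>2 * monomial_norm2 k)"
proof -
  let ?p = "\<lambda>z. \<Sum>k\<in>I. b k * z ^ k"
  have i: "integrable dA (\<lambda>z. z ^ j * cnj (z ^ k))" for j k
    by (intro integrable_inner_square_integrable square_integrable_power)
  have "complex_of_real (LINT z|dA. (cmod (?p z))\<^sup>2) = (LINT z|dA. ?p z * cnj (?p z))"
    unfolding complex_norm_square[symmetric] by (rule integral_complex_of_real[symmetric])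
  also have "\<dots> = (LINT z|dA. (\<Sum>j\<in>I. \<Sum>k\<in>I. (b j * cnj (b k)) * (z ^ j * cnj (z ^ k))))"
    by (intro Bochner_Integration.integral_cong refl) (simp add: cnj_sum sum_product mult_ac)
  also have "\<dots> = (\<Sum>j\<in>I. \<Sum>k\<in>I. (LINT z|dA. (b j * cnj (b k)) * (z ^ j * cnj (z ^ k))))"
    by (subst Bochner_Integration.integral_sum)
      (intro sum.cong refl Bochner_Integration.integral_sum Bochner_Integration.integrable_sum
        integrable_mult_right i)+
  also have "\<dots> = (\<Sum>j\<in>I. \<Sum>k\<in>I. if k = j then of_real ((cmod (b j))\<^sup>2 * monomial_norm2 j) else 0)"
  proof (intro sum.cong refl)
    fix j k
    have "(LINT z|dA. (b j * cnj (b k)) * (z ^ j * cnj (z ^ k)))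
        = (b j * cnj (b k)) * (LINT z|dA. z ^ j * cnj (z ^ k))"
      by (rule integral_mult_right_zero)
    also have "\<dots> = (if k = j then of_real ((cmod (b j))\<^sup>2 * monomial_norm2 j) else 0)"
    proof (cases "k = j")
      case True
      then show ?thesis
        using integral_monomial_norm2[of j] by (simp add: complex_norm_square[symmetric])
    qed (use monomials_orthogonal[of j k] in auto)
    finally show "(LINT z|dA. (b j * cnj (b k)) * (z ^ j * cnj (z ^ k)))
        = (if k = j then of_real ((cmod (b j))\<^sup>2 * monomial_norm2 j) else 0)" .
  qed
  also have "\<dots> = of_real (\<Sum>k\<in>I. (cmod (b k))\<^sup>2 * monomial_norm2 k)"
    using assms by (simp add: sum.delta)
  finally show ?thesis
    by (simp only: of_real_eq_iff)
qed

text \<open>Bessel's inequality makes the squared norms of the Taylor terms summable, so the blocks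
  from n to m are small in norm uniformly in m, and Fatou's lemma carries this to the limit in
  m.\<close>

lemma bergman_partial_sums_approx:
  assumes h: "h \<in> bergman_space" and e: "e > 0"
  obtains n where "(LINT z|dA. (cmod (h z - (\<Sum>k<n. taylor_coeff h k * z ^ k)))\<^sup>2) \<le> e"
proof -
  define b where "b = taylor_coeff h"
  define t where "t k = (cmod (b k))\<^sup>2 * monomial_norm2 k" for k
  note hs = bergman_spaceD(1)[OF h]
  have t0: "t k \<ge> 0" for k
    using monomial_norm2_pos[of k] by (simp add: t_def)
  have bk: "(LINT z|dA. h z * cnj z ^ k) = b k * of_real (monomial_norm2 k)" for k
    unfolding b_def by (rule power_series_inner_monomial)
      (use h hs bergman_spaceD(4) in \<open>auto intro: square_integrable_dA_imp_integrable\<close>)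
  have "summable t"
  proof (rule bounded_imp_summable[OF t0])
    fix n
    have "(\<Sum>k\<le>n. t k) = (\<Sum>k\<le>n. (cmod (LINT z|dA. h z * cnj z ^ k))\<^sup>2 / monomial_norm2 k)"
      unfolding bk t_def
      by (intro sum.cong refl) (use monomial_norm2_pos in
        \<open>simp add: norm_mult power_mult_distrib power2_eq_square less_imp_le less_imp_neq[symmetric]\<close>)
    then show "(\<Sum>k\<le>n. t k) \<le> (LINT z|dA. (cmod (h z))\<^sup>2)"
      using bergman_Bessel[OF hs, of "{..n}"] by simp
  qed
  then obtain n where n: "\<And>m. m \<ge> n \<Longrightarrow> norm (sum t {n..<m}) < e"
    unfolding summable_Cauchy using e by blast
  define S where "S m z = (\<Sum>k\<in>{n..<m}. b k * z ^ k)" for m z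
  have "(LINT z|dA. (cmod (h z - (\<Sum>k<n. b k * z ^ k)))\<^sup>2) \<le> e"
  proof (rule square_integrable_Fatou(2)[of dA S])
    show "square_integrable dA (S m)" for m
      unfolding S_def by (intro square_integrable_sum square_integrable_cmult square_integrable_power)
    show "(LINT z|dA. (cmod (S m z))\<^sup>2) \<le> e" for m
    proof -
      have "(LINT z|dA. (cmod (S m z))\<^sup>2) = sum t {n..<m}"
        unfolding S_def t_def by (rule polynomial_norm2) simp
      then show ?thesis
        using n[of m] e by (cases "m \<ge> n") auto
    qed
    show "(\<lambda>m. S m z) \<longlonglongrightarrow> h z - (\<Sum>k<n. b k * z ^ k)" if "z \<in> space dA" for z
    proof -
      have "(\<lambda>k. b k * z ^ k) sums h z"
        unfolding b_def using bergman_spaceD(4)[OF h] that by simp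
      then have "(\<lambda>m. (\<Sum>k<m. b k * z ^ k) - (\<Sum>k<n. b k * z ^ k)) \<longlonglongrightarrow> h z - (\<Sum>k<n. b k * z ^ k)"
        unfolding sums_def by (intro tendsto_diff tendsto_const)
      moreover have "\<forall>\<^sub>F m in sequentially. (\<Sum>k<m. b k * z ^ k) - (\<Sum>k<n. b k * z ^ k) = S m z"
        using eventually_ge_at_top[of n]
      proof eventually_elim
        case (elim m)
        have "(\<Sum>k<m. b k * z ^ k) = (\<Sum>k<n. b k * z ^ k) + S m z"
          unfolding S_def using elim
          by (metis atLeast0LessThan le0 sum.atLeastLessThan_concat)
        then show ?case by simp
      qed
      ultimately show ?thesis
        by (rule Lim_transform_eventually)
    qed
  qed
  then show thesis
    unfolding b_def by (rule that)
qed

text \<open>h is replaced by a Taylor polynomial, to which u is orthogonal; the error is estimated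
  by the weighted Cauchy-Schwarz inequality.\<close>

lemma orthogonal_monomials_imp_orthogonal_bergman:
  assumes u: "square_integrable dA u" "\<And>k. (LINT z|dA. u z * cnj z ^ k) = 0"
    and h: "h \<in> bergman_space"
  shows "(LINT z|dA. u z * cnj (h z)) = 0"
proof -
  note hs = bergman_spaceD(1)[OF h]
  define U where "U = (LINT z|dA. (cmod (u z))\<^sup>2)"
  have U0: "U \<ge> 0" by (simp add: U_def)
  have "cmod (LINT z|dA. u z * cnj (h z)) \<le> 0 + e" if e: "e > 0" for e
  proof -
    \<comment> \<open>This weight makes d U \<le> e / 2; the approximation error d e / 2 below makes
      the other term at most e / 2.\<close>
    define d where "d = e / (2 * (U + 1))"
    have d: "d > 0" using e U0 by (simp add: d_def)
    have "d * e / 2 > 0" using d e by simp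
    then obtain n where n: "(LINT z|dA. (cmod (h z - (\<Sum>k<n. taylor_coeff h k * z ^ k)))\<^sup>2) \<le> d * e / 2"
      using bergman_partial_sums_approx[OF h] by blast
    define p where "p z = (\<Sum>k<n. taylor_coeff h k * z ^ k)" for z
    have p: "square_integrable dA p"
      unfolding p_def by (intro square_integrable_sum square_integrable_cmult square_integrable_power)
    have ui: "integrable dA (\<lambda>z. u z * cnj z ^ k)" for k
      using integrable_inner_square_integrable[OF u(1) square_integrable_power[of k]] by simp
    have "(LINT z|dA. u z * cnj (p z)) = (LINT z|dA. (\<Sum>k<n. cnj (taylor_coeff h k) * (u z * cnj z ^ k)))"
      by (simp add: p_def sum_distrib_left mult_ac)
    also have "\<dots> = (\<Sum>k<n. (LINT z|dA. cnj (taylor_coeff h k) * (u z * cnj z ^ k)))"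
      by (intro Bochner_Integration.integral_sum integrable_mult_right ui)
    also have "\<dots> = 0"
      by (simp add: u(2))
    finally have up: "(LINT z|dA. u z * cnj (p z)) = 0" .
    have hp: "square_integrable dA (\<lambda>z. h z - p z)"
      by (rule square_integrable_diff[OF hs p])
    have "(LINT z|dA. u z * cnj (h z)) = (LINT z|dA. u z * cnj (h z - p z) + u z * cnj (p z))"
      by (simp add: algebra_simps)
    also have "\<dots> = (LINT z|dA. u z * cnj (h z - p z)) + (LINT z|dA. u z * cnj (p z))"
      by (intro Bochner_Integration.integral_add integrable_inner_square_integrable u(1) hp p)
    finally have "cmod (LINT z|dA. u z * cnj (h z)) = cmod (LINT z|dA. u z * cnj (h z - p z))"
      by (simp add: up)
    also have "\<dots> \<le> d * U + (LINT z|dA. (cmod (h z - p z))\<^sup>2) / d"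
      unfolding U_def by (rule weighted_Cauchy_Schwarz[OF u(1) hp d])
    also have "\<dots> \<le> e / 2 + e / 2"
    proof (rule add_mono)
      show "d * U \<le> e / 2"
        using e U0 by (simp add: d_def field_simps)
      show "(LINT z|dA. (cmod (h z - p z))\<^sup>2) / d \<le> e / 2"
        using n d by (simp add: p_def field_simps)
    qed
    finally show ?thesis by simp
  qed
  then show ?thesis
    using field_le_epsilon[of "cmod (LINT z|dA. u z * cnj (h z))" 0] by simp
qed

lemma monomial_mem_bergman_space: "(\<lambda>z. if z \<in> unit_disk then z ^ k else 0) \<in> bergman_space"
proof -
  have "(\<lambda>z. if z \<in> unit_disk then z ^ k else 0) holomorphic_on unit_disk"
    by (rule holomorphic_transform[of "\<lambda>z. z ^ k"]) (auto intro: holomorphic_intros)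
  moreover have "square_integrable dA (\<lambda>z. if z \<in> unit_disk then z ^ k else 0)"
    using square_integrable_power[of k] unfolding square_integrable_def
    by (subst measurable_cong[where g = "\<lambda>z. z ^ k"], simp,
        subst Bochner_Integration.integrable_cong[where g = "\<lambda>z. (cmod (z ^ k))\<^sup>2"]) auto
  ultimately show ?thesis
    by (simp add: bergman_space_def mem_L2_iff)
qed

text \<open>Inner products with monomials determine the Taylor coefficients, and outside the disk
  both functions are 0. This yields equality of functions, not merely almost everywhere.\<close>

lemma bergman_space_eqI:
  assumes f: "f \<in> bergman_space" and g: "g \<in> bergman_space"
    and eq: "\<And>k. (LINT z|dA. f z * cnj z ^ k) = (LINT z|dA. g z * cnj z ^ k)"
  shows "f = g"
proof
  have coeff: "taylor_coeff h k = (LINT z|dA. h z * cnj z ^ k) / of_real (monomial_norm2 k)"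
    if h: "h \<in> bergman_space" for h k
  proof -
    have "(LINT z|dA. h z * cnj z ^ k) = taylor_coeff h k * of_real (monomial_norm2 k)"
      by (rule power_series_inner_monomial)
        (use h bergman_spaceD in \<open>auto intro: square_integrable_dA_imp_integrable\<close>)
    then show ?thesis using monomial_norm2_pos[of k] by simp
  qed
  fix z
  show "f z = g z"
  proof (cases "z \<in> unit_disk")
    case True
    have "taylor_coeff f = taylor_coeff g"
      by (rule ext) (simp add: coeff f g eq)
    then show ?thesis
      using bergman_spaceD(4)[OF f True] bergman_spaceD(4)[OF g True] sums_unique2 by metis
  next
    case False
    then show ?thesis
      using bergman_spaceD(3)[OF f] bergman_spaceD(3)[OF g] by simp
  qed
qed

text \<open>The definite description in \<open>bergman_proj\<close> is resolved here. Orthogonality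
  to the monomials gives orthogonality to the whole space; conversely the monomials belong to the
  space, so two candidates have the same inner products with them.\<close>

lemma bergman_proj_eqI:
  assumes f: "square_integrable dA f" and g: "g \<in> bergman_space"
    and eq: "\<And>k. (LINT z|dA. f z * cnj z ^ k) = (LINT z|dA. g z * cnj z ^ k)"
  shows "bergman_proj f = g"
  unfolding bergman_proj_def
proof (rule the_equality)
  have i: "integrable dA (\<lambda>z. h z * cnj z ^ k)" if "square_integrable dA h" for h k
    using integrable_inner_square_integrable[OF that square_integrable_power[of k]] by simp
  have diff: "(LINT z|dA. (f z - h z) * cnj z ^ k)
      = (LINT z|dA. f z * cnj z ^ k) - (LINT z|dA. h z * cnj z ^ k)"
    if "square_integrable dA h" for h k
    unfolding left_diff_distrib by (intro Bochner_Integration.integral_diff i f that)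
  show "g \<in> bergman_space \<and> (\<forall>h\<in>bergman_space. L2_inner (\<lambda>z. f z - g z) h = 0)"
  proof (intro conjI ballI g)
    fix h assume "h \<in> bergman_space"
    from orthogonal_monomials_imp_orthogonal_bergman[OF square_integrable_diff[OF f bergman_spaceD(1)[OF g]] _ this]
    show "L2_inner (\<lambda>z. f z - g z) h = 0"
      by (simp add: L2_inner_def diff[OF bergman_spaceD(1)[OF g]] eq)
  qed
  fix g' assume g': "g' \<in> bergman_space \<and> (\<forall>h\<in>bergman_space. L2_inner (\<lambda>z. f z - g' z) h = 0)"
  show "g' = g"
  proof (rule bergman_space_eqI[OF _ g])
    show "g' \<in> bergman_space" using g' by blast
    fix k
    have "L2_inner (\<lambda>z. f z - g' z) (\<lambda>z. if z \<in> unit_disk then z ^ k else 0) = 0"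
      using g' monomial_mem_bergman_space by blast
    then have "(LINT z|dA. (f z - g' z) * cnj z ^ k) = 0"
      unfolding L2_inner_def by (subst (asm) Bochner_Integration.integral_cong[OF refl]) auto
    then show "(LINT z|dA. g' z * cnj z ^ k) = (LINT z|dA. g z * cnj z ^ k)"
      using diff[of g' k] bergman_spaceD(1) g' eq by auto
  qed
qed

text \<open>The projection is the power series whose k-th coefficient is the inner product of f with
  z^k over the squared norm of z^k. Bessel's inequality gives its convergence in the disk, and
  Fatou's lemma puts the sum into L^2.\<close>

lemma bergman_proj_exists:
  assumes f: "square_integrable dA f"
  obtains g where "g \<in> bergman_space"
    "\<And>k. (LINT z|dA. f z * cnj z ^ k) = (LINT z|dA. g z * cnj z ^ k)"
proof -
  define a where "a k = (LINT z|dA. f z * cnj z ^ k) / of_real (monomial_norm2 k)" for k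
  define F where "F = (LINT z|dA. (cmod (f z))\<^sup>2)"
  have Bessel: "(\<Sum>k\<in>I. (cmod (a k))\<^sup>2 * monomial_norm2 k) \<le> F" if "finite I" for I
  proof -
    have "(\<Sum>k\<in>I. (cmod (a k))\<^sup>2 * monomial_norm2 k)
        = (\<Sum>k\<in>I. (cmod (LINT z|dA. f z * cnj z ^ k))\<^sup>2 / monomial_norm2 k)"
      unfolding a_def
      by (intro sum.cong refl) (use monomial_norm2_pos in
        \<open>simp add: norm_divide power_divide power2_eq_square less_imp_le less_imp_neq[symmetric]\<close>)
    then show ?thesis
      using bergman_Bessel[OF f that] by (simp add: F_def)
  qed
  have summ: "summable (\<lambda>k. a k * z ^ k)" if z: "z \<in> unit_disk" for z
  proof -
    \<comment> \<open>An intermediate radius: |a k| r^k stays bounded, so Abel's lemma gives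
      absolute convergence at |z| < r.\<close>
    define r where "r = (1 + cmod z) / 2"
    have r: "cmod z < r" "0 \<le> r" "r < 1" using z by (auto simp: r_def)
    obtain m where m: "m > 0" "\<And>k. m * r ^ (2 * k) \<le> monomial_norm2 k"
      using monomial_norm2_lower_bound[OF r(2,3)] by blast
    have "cmod (a k) * r ^ k \<le> sqrt (F / m)" for k
    proof (rule real_le_rsqrt)
      have "(cmod (a k))\<^sup>2 * (m * r ^ (2 * k)) \<le> (cmod (a k))\<^sup>2 * monomial_norm2 k"
        using m(2) by (intro mult_left_mono) auto
      also have "\<dots> \<le> F"
        using Bessel[of "{k}"] by simp
      finally show "(cmod (a k) * r ^ k)\<^sup>2 \<le> F / m"
        using m(1) by (simp add: power_mult_distrib power_even_eq field_simps flip: power_mult)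
    qed
    then have "summable (\<lambda>k. cmod (a k) * cmod z ^ k)"
      by (intro Abel_lemma[OF _ r(1)]) auto
    then show ?thesis
      by (intro summable_norm_cancel[of "\<lambda>k. a k * z ^ k"]) (simp add: norm_mult norm_power)
  qed
  define g where "g z = (if z \<in> unit_disk then (\<Sum>k. a k * z ^ k) else 0)" for z
  have gs: "(\<lambda>k. a k * z ^ k) sums g z" if "z \<in> unit_disk" for z
    using summ[OF that] that by (simp add: g_def summable_sums)
  have "g holomorphic_on unit_disk"
    by (rule power_series_holomorphic[where a = a]) (use gs in simp)
  moreover have g2: "square_integrable dA g"
  proof (rule square_integrable_Fatou(1)[of dA "\<lambda>n z. \<Sum>k<n. a k * z ^ k" _ F])
    show "square_integrable dA (\<lambda>z. \<Sum>k<n. a k * z ^ k)" for n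
      by (intro square_integrable_sum square_integrable_cmult square_integrable_power)
    show "(\<lambda>n. \<Sum>k<n. a k * z ^ k) \<longlonglongrightarrow> g z" if "z \<in> space dA" for z
      using gs that by (simp add: sums_def)
    show "(LINT z|dA. (cmod (\<Sum>k<n. a k * z ^ k))\<^sup>2) \<le> F" for n
      using Bessel[of "{..<n}"] by (simp add: polynomial_norm2)
  qed
  ultimately have g: "g \<in> bergman_space"
    by (simp add: bergman_space_def mem_L2_iff g_def)
  moreover have "(LINT z|dA. f z * cnj z ^ k) = (LINT z|dA. g z * cnj z ^ k)" for k
  proof -
    have "(LINT z|dA. g z * cnj z ^ k) = a k * of_real (monomial_norm2 k)"
      by (rule power_series_inner_monomial[OF square_integrable_dA_imp_integrable[OF g2] gs])
    then show ?thesis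
      using monomial_norm2_pos[of k] by (simp add: a_def)
  qed
  ultimately show thesis by (rule that)
qed

lemma bergman_proj:
  assumes f: "square_integrable dA f"
  shows bergman_proj_mem: "bergman_proj f \<in> bergman_space"
    and bergman_proj_inner_monomial:
      "(LINT z|dA. bergman_proj f z * cnj z ^ k) = (LINT z|dA. f z * cnj z ^ k)"
proof -
  obtain g where g: "g \<in> bergman_space"
    "\<And>k. (LINT z|dA. f z * cnj z ^ k) = (LINT z|dA. g z * cnj z ^ k)"
    using bergman_proj_exists[OF f] by blast
  have "bergman_proj f = g"
    by (rule bergman_proj_eqI[OF f g])
  then show "bergman_proj f \<in> bergman_space"
    and "(LINT z|dA. bergman_proj f z * cnj z ^ k) = (LINT z|dA. f z * cnj z ^ k)"
    using g by auto
qed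

section \<open>Toeplitz operators with radial symbols\<close>

text \<open>For bounded radial g these are the eigenvalues of the Toeplitz operator on the monomials
  z^k. For k > 0 the numerator is the value at k of the Mellin transform introduced below.\<close>

definition radial_symbol :: "(complex \<Rightarrow> complex) \<Rightarrow> nat \<Rightarrow> complex" where
  "radial_symbol g k = (LINT z|dA. g z * of_real (cmod z ^ (2 * k))) / of_real (monomial_norm2 k)"

lemma LinfD:
  assumes "g \<in> Linf"
  obtains C where "g \<in> borel_measurable dA" "AE z in dA. cmod (g z) \<le> C"
  using assms by (auto simp: Linf_def)

text \<open>The projection leaves the inner product with z^k unchanged, and the radial factor lets
  only the k-th Taylor term of \<phi> survive in it.\<close>

lemma toeplitz_radial:
  assumes g: "g \<in> Linf" "radial g" and \<phi>: "\<phi> \<in> bergman_space"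
  shows "toeplitz g \<phi> \<in> bergman_space"
    and "(LINT z|dA. toeplitz g \<phi> z * cnj z ^ k) = radial_symbol g k * (LINT z|dA. \<phi> z * cnj z ^ k)"
proof -
  obtain C where C: "g \<in> borel_measurable dA" "AE z in dA. cmod (g z) \<le> C"
    using LinfD[OF g(1)] by blast
  have sq: "square_integrable dA (\<lambda>z. g z * \<phi> z)"
    by (rule square_integrable_dA_bounded_mult[OF bergman_spaceD(1)[OF \<phi>] C])
  show "toeplitz g \<phi> \<in> bergman_space"
    unfolding toeplitz_def by (rule bergman_proj_mem[OF sq])
  have i: "integrable dA \<phi>"
    by (rule square_integrable_dA_imp_integrable[OF bergman_spaceD(1)[OF \<phi>]])
  have "(LINT z|dA. toeplitz g \<phi> z * cnj z ^ k) = (LINT z|dA. g z * \<phi> z * cnj z ^ k)"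
    unfolding toeplitz_def by (rule bergman_proj_inner_monomial[OF sq])
  also have "\<dots> = taylor_coeff \<phi> k * (LINT z|dA. g z * of_real (cmod z ^ (2 * k)))"
    by (rule radial_integral_power_series[OF C(1) g(2) C(2) i bergman_spaceD(4)[OF \<phi>]])
  also have "\<dots> = radial_symbol g k * (taylor_coeff \<phi> k * of_real (monomial_norm2 k))"
    using monomial_norm2_pos[of k] by (simp add: radial_symbol_def)
  also have "taylor_coeff \<phi> k * of_real (monomial_norm2 k) = (LINT z|dA. \<phi> z * cnj z ^ k)"
    by (rule power_series_inner_monomial[symmetric, OF i bergman_spaceD(4)[OF \<phi>]])
  finally show "(LINT z|dA. toeplitz g \<phi> z * cnj z ^ k)
      = radial_symbol g k * (LINT z|dA. \<phi> z * cnj z ^ k)" .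
qed

lemma foldr_toeplitz_radial:
  assumes "\<And>g. g \<in> set gs \<Longrightarrow> g \<in> Linf \<and> radial g" "\<phi> \<in> bergman_space"
  shows "foldr toeplitz gs \<phi> \<in> bergman_space \<and>
    (\<forall>k. (LINT z|dA. foldr toeplitz gs \<phi> z * cnj z ^ k)
      = (\<Prod>g\<leftarrow>gs. radial_symbol g k) * (LINT z|dA. \<phi> z * cnj z ^ k))"
  using assms
proof (induction gs)
  case (Cons g gs)
  then have IH: "foldr toeplitz gs \<phi> \<in> bergman_space"
    "\<And>k. (LINT z|dA. foldr toeplitz gs \<phi> z * cnj z ^ k)
      = (\<Prod>g\<leftarrow>gs. radial_symbol g k) * (LINT z|dA. \<phi> z * cnj z ^ k)"
    by auto
  have g: "g \<in> Linf" "radial g" using Cons.prems(1) by auto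
  show ?case
    using toeplitz_radial[OF g IH(1)] IH(2) by (simp add: mult.assoc)
qed simp

text \<open>Cut off outside the disk to match the representatives in \<open>bergman_space\<close>
  and \<open>disk_polynomials\<close>.\<close>

definition disk_monomial :: "nat \<Rightarrow> complex \<Rightarrow> complex" where
  "disk_monomial j = (\<lambda>z. if z \<in> unit_disk then z ^ j else 0)"

lemma disk_monomial_mem_bergman: "disk_monomial j \<in> bergman_space"
  unfolding disk_monomial_def by (rule monomial_mem_bergman_space)

lemma integral_disk_monomial:
  "(LINT z|dA. F z * disk_monomial j z * G z) = (LINT z|dA. F z * z ^ j * G z)"
  by (intro Bochner_Integration.integral_cong) (auto simp: disk_monomial_def)

lemma bergman_space_cmult:
  assumes "\<phi> \<in> bergman_space"
  shows "(\<lambda>z. c * \<phi> z) \<in> bergman_space"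
proof -
  have "(\<lambda>z. c * \<phi> z) holomorphic_on unit_disk"
    using bergman_spaceD(2)[OF assms] by (intro holomorphic_intros)
  moreover have "square_integrable dA (\<lambda>z. c * \<phi> z)"
    by (rule square_integrable_cmult[OF bergman_spaceD(1)[OF assms]])
  ultimately show ?thesis
    using bergman_spaceD(3)[OF assms] by (simp add: bergman_space_def mem_L2_iff)
qed

lemma foldr_toeplitz_radial_monomial:
  assumes "\<And>g. g \<in> set gs \<Longrightarrow> g \<in> Linf \<and> radial g"
  shows "foldr toeplitz gs (disk_monomial j) = (\<lambda>z. (\<Prod>g\<leftarrow>gs. radial_symbol g j) * disk_monomial j z)"
proof (rule bergman_space_eqI)
  note * = foldr_toeplitz_radial[OF assms disk_monomial_mem_bergman[of j]]
  show "foldr toeplitz gs (disk_monomial j) \<in> bergman_space" using * by blast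
  show "(\<lambda>z. (\<Prod>g\<leftarrow>gs. radial_symbol g j) * disk_monomial j z) \<in> bergman_space"
    by (intro bergman_space_cmult disk_monomial_mem_bergman)
  fix k
  have "(LINT z|dA. foldr toeplitz gs (disk_monomial j) z * cnj z ^ k)
      = (\<Prod>g\<leftarrow>gs. radial_symbol g k) * (LINT z|dA. disk_monomial j z * cnj z ^ k)"
    using * by blast
  also have "\<dots> = (\<Prod>g\<leftarrow>gs. radial_symbol g j) * (LINT z|dA. disk_monomial j z * cnj z ^ k)"
    using integral_disk_monomial[of "\<lambda>z. 1" j "\<lambda>z. cnj z ^ k"] monomials_orthogonal[of j k]
    by (cases "j = k") simp_all
  also have "\<dots> = (LINT z|dA. (\<Prod>g\<leftarrow>gs. radial_symbol g j) * disk_monomial j z * cnj z ^ k)"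
    by (simp only: mult.assoc integral_mult_right_zero)
  finally show "(LINT z|dA. foldr toeplitz gs (disk_monomial j) z * cnj z ^ k)
      = (LINT z|dA. (\<Prod>g\<leftarrow>gs. radial_symbol g j) * disk_monomial j z * cnj z ^ k)" .
qed

text \<open>The operators in \<open>fs\<close> act first and see only z^j; those in
  \<open>gs\<close> act last and scale the k-th inner product. Only f in the middle mixes j and
  k.\<close>

lemma toeplitz_product_monomial:
  assumes fs: "\<And>h. h \<in> set fs \<Longrightarrow> h \<in> Linf \<and> radial h" and gs: "\<And>h. h \<in> set gs \<Longrightarrow> h \<in> Linf \<and> radial h"
    and f: "f \<in> L2"
  defines "T \<equiv> \<lambda>\<phi>. foldr toeplitz gs (toeplitz f (foldr toeplitz fs \<phi>))"
  shows "T (disk_monomial j) \<in> bergman_space"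
    and "(LINT z|dA. T (disk_monomial j) z * cnj z ^ k)
      = (\<Prod>h\<leftarrow>fs. radial_symbol h j) * (\<Prod>g\<leftarrow>gs. radial_symbol g k) * (LINT z|dA. f z * z ^ j * cnj z ^ k)"
proof -
  define s where "s = (\<Prod>h\<leftarrow>fs. radial_symbol h j)"
  have f2: "square_integrable dA f" using f by (simp add: mem_L2_iff)
  have m: "(\<lambda>z. s * disk_monomial j z) \<in> bergman_space"
    by (intro bergman_space_cmult disk_monomial_mem_bergman)
  have "square_integrable dA (\<lambda>z. (s * disk_monomial j z) * f z)"
  proof (rule square_integrable_dA_bounded_mult[OF f2, where C = "cmod s"])
    show "(\<lambda>z. s * disk_monomial j z) \<in> borel_measurable dA"
      using bergman_spaceD(1)[OF m] by (rule square_integrableD(1))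
    show "AE z in dA. cmod (s * disk_monomial j z) \<le> cmod s"
      by (intro AE_I2) (auto simp: disk_monomial_def norm_mult norm_power power_le_one intro!: mult_left_le)
  qed
  then have sq: "square_integrable dA (\<lambda>z. f z * (s * disk_monomial j z))"
    by (simp add: mult.commute)
  have fs_monomial: "foldr toeplitz fs (disk_monomial j) = (\<lambda>z. s * disk_monomial j z)"
    unfolding s_def by (rule foldr_toeplitz_radial_monomial) (rule fs)
  define \<psi> where "\<psi> = toeplitz f (foldr toeplitz fs (disk_monomial j))"
  have \<psi>: "\<psi> = bergman_proj (\<lambda>z. f z * (s * disk_monomial j z))"
    unfolding \<psi>_def fs_monomial by (simp only: toeplitz_def)
  have \<psi>b: "\<psi> \<in> bergman_space"
    unfolding \<psi> by (rule bergman_proj_mem[OF sq])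
  have \<psi>k: "(LINT z|dA. \<psi> z * cnj z ^ k) = s * (LINT z|dA. f z * z ^ j * cnj z ^ k)"
  proof -
    have "(LINT z|dA. \<psi> z * cnj z ^ k) = (LINT z|dA. f z * (s * disk_monomial j z) * cnj z ^ k)"
      unfolding \<psi> by (rule bergman_proj_inner_monomial[OF sq])
    also have "\<dots> = (LINT z|dA. s * (f z * disk_monomial j z * cnj z ^ k))"
      by (simp only: mult_ac)
    also have "\<dots> = s * (LINT z|dA. f z * z ^ j * cnj z ^ k)"
      unfolding integral_disk_monomial[symmetric] by (rule integral_mult_right_zero)
    finally show ?thesis .
  qed
  have T: "T (disk_monomial j) = foldr toeplitz gs \<psi>"
    by (simp add: T_def \<psi>_def)
  note * = foldr_toeplitz_radial[OF gs \<psi>b]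
  show "T (disk_monomial j) \<in> bergman_space"
    unfolding T using * by blast
  show "(LINT z|dA. T (disk_monomial j) z * cnj z ^ k)
      = (\<Prod>h\<leftarrow>fs. radial_symbol h j) * (\<Prod>g\<leftarrow>gs. radial_symbol g k) * (LINT z|dA. f z * z ^ j * cnj z ^ k)"
    unfolding T s_def[symmetric] using * \<psi>k by simp
qed

text \<open>\<open>N\<close> is one more than the number of spanning functions, so the images of N
  monomials are linearly dependent, and one relation \<open>v\<close> serves for every k at once.
  The factors \<alpha> and \<beta> are nonzero at the selected indices and can be divided out of the
  determinant.\<close>

lemma finite_rank_imp_minors_zero:
  assumes fr: "finite_rank_on disk_polynomials T"
    and T: "\<And>j. T (disk_monomial j) \<in> bergman_space"
    and coeff: "\<And>j k. (LINT z|dA. T (disk_monomial j) z * cnj z ^ k) = \<alpha> j * \<beta> k * a j k"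
  obtains N where "\<And>J K. (\<And>i. i < N \<Longrightarrow> \<alpha> (J i) \<noteq> 0) \<Longrightarrow> (\<And>i. i < N \<Longrightarrow> \<beta> (K i) \<noteq> 0) \<Longrightarrow>
    minor N (\<lambda>i l. a (J i) (K l)) = 0"
proof -
  obtain B where B: "finite B"
    "\<And>\<phi>. \<phi> \<in> disk_polynomials \<Longrightarrow> \<exists>c. \<forall>z \<in> unit_disk. T \<phi> z = (\<Sum>b\<in>B. c b * b z)"
    using fr unfolding finite_rank_on_def by blast
  have "disk_monomial j \<in> disk_polynomials" for j
    unfolding disk_polynomials_def disk_monomial_def
    by (intro CollectI exI[of _ "monom 1 j"]) (auto simp: poly_monom)
  then have "\<exists>c. \<forall>z \<in> unit_disk. T (disk_monomial j) z = (\<Sum>b\<in>B. c b * b z)" for j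
    using B(2) by blast
  then obtain c where c: "\<And>j z. z \<in> unit_disk \<Longrightarrow> T (disk_monomial j) z = (\<Sum>b\<in>B. c j b * b z)"
    by metis
  define N where "N = Suc (card B)"
  show thesis
  proof
    fix J K assume J: "\<And>i. i < N \<Longrightarrow> \<alpha> (J i) \<noteq> 0" and K: "\<And>i. i < N \<Longrightarrow> \<beta> (K i) \<noteq> 0"
    obtain v where v: "\<exists>l<N. v l \<noteq> 0" "\<And>b. b \<in> B \<Longrightarrow> (\<Sum>l<N. v l * c (J l) b) = 0"
      using linear_dependence_exists[OF B(1), of N "\<lambda>l. c (J l)"] by (auto simp: N_def)
    have comb: "(\<Sum>l<N. v l * T (disk_monomial (J l)) z) = 0" if z: "z \<in> unit_disk" for z
    proof -
      have "(\<Sum>l<N. v l * T (disk_monomial (J l)) z) = (\<Sum>l<N. \<Sum>b\<in>B. (v l * c (J l) b) * b z)"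
        by (simp only: c[OF z] sum_distrib_left mult.assoc)
      also have "\<dots> = (\<Sum>b\<in>B. \<Sum>l<N. (v l * c (J l) b) * b z)"
        by (rule sum.swap)
      also have "\<dots> = 0"
      proof (rule sum.neutral, rule ballI)
        fix b assume b: "b \<in> B"
        have "(\<Sum>l<N. (v l * c (J l) b) * b z) = (\<Sum>l<N. v l * c (J l) b) * b z"
          by (simp only: sum_distrib_right)
        then show "(\<Sum>l<N. (v l * c (J l) b) * b z) = 0"
          by (simp only: v(2)[OF b] mult_zero_left)
      qed
      finally show ?thesis .
    qed
    have zero: "(\<Sum>l<N. v l * (\<alpha> (J l) * \<beta> k * a (J l) k)) = 0" for k
    proof -
      have i: "integrable dA (\<lambda>z. T (disk_monomial j) z * cnj z ^ k)" for j
        using integrable_inner_square_integrable[OF bergman_spaceD(1)[OF T[of j]] square_integrable_power[of k]]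
        by simp
      have "(\<Sum>l<N. v l * (\<alpha> (J l) * \<beta> k * a (J l) k))
          = (\<Sum>l<N. (LINT z|dA. v l * (T (disk_monomial (J l)) z * cnj z ^ k)))"
        by (simp only: coeff integral_mult_right_zero)
      also have "\<dots> = (LINT z|dA. (\<Sum>l<N. v l * (T (disk_monomial (J l)) z * cnj z ^ k)))"
        by (intro Bochner_Integration.integral_sum[symmetric] integrable_mult_right i)
      also have "\<dots> = (LINT z|dA. (\<Sum>l<N. v l * T (disk_monomial (J l)) z) * cnj z ^ k)"
        by (simp only: sum_distrib_right mult.assoc)
      also have "\<dots> = (LINT z|dA. 0)"
        by (intro Bochner_Integration.integral_cong) (simp_all only: comb space_dA mult_zero_left)
      finally show ?thesis by simp
    qed
    \<comment> \<open>The relation \<open>v\<close> runs over the rows \<open>J\<close>, whereas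
      \<open>minor_eq_0_iff\<close> asks for a relation among columns, hence the transposed
      matrix.\<close>
    have "minor N (\<lambda>i l. \<alpha> (J l) * \<beta> (K i) * a (J l) (K i)) = 0"
      unfolding minor_eq_0_iff
    proof (intro exI[of _ v] conjI allI impI)
      fix i
      show "(\<Sum>l<N. \<alpha> (J l) * \<beta> (K i) * a (J l) (K i) * v l) = 0"
        using zero[of "K i"] by (simp only: mult_ac)
    qed (rule v(1))
    then have "minor N (\<lambda>i l. \<alpha> (J i) * \<beta> (K l) * a (J i) (K l)) = 0"
      using minor_transpose[of N "\<lambda>i l. \<alpha> (J i) * \<beta> (K l) * a (J i) (K l)"] by simp
    then have "(\<Prod>i<N. \<alpha> (J i)) * (\<Prod>i<N. \<beta> (K i)) * minor N (\<lambda>i l. a (J i) (K l)) = 0"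
      by (simp only: minor_scale[of N "\<lambda>i. \<alpha> (J i)" "\<lambda>l. \<beta> (K l)"])
    moreover have "(\<Prod>i<N. \<alpha> (J i)) \<noteq> 0" "(\<Prod>i<N. \<beta> (K i)) \<noteq> 0"
      using J K by (auto simp: prod_zero_iff)
    ultimately show "minor N (\<lambda>i l. a (J i) (K l)) = 0"
      by simp
  qed
qed

section \<open>Luecking's theorem\<close>

lemma Riemann_Lebesgue_disk:
  assumes v: "square_integrable dA v"
  shows "(\<lambda>n. LINT z|dA. v z * exp (\<i> * of_real (pi * real n * Im z))) \<longlonglongrightarrow> 0"
proof -
  \<comment> \<open>Bessel's inequality for the exponentials, which are orthogonal on a square containing the disk.\<close>
  let ?S = "cbox (Complex (-1) (-1)) (Complex 1 1)"
  let ?M = "restrict_space lborel ?S :: complex measure"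
  obtain w where w [measurable]: "w \<in> borel_measurable borel" and vw: "AE z in dA. v z = w z"
    using borel_representative_dA[OF square_integrableD(1)[OF v]] by blast
  define u where "u z = indicator unit_disk z * w z" for z
  have u [measurable]: "u \<in> borel_measurable borel"
    unfolding u_def by (intro borel_measurable_times borel_measurable_indicator w) simp
  define e where "e n z = exp (- (\<i> * of_real (pi * real n * Im z)))" for n :: nat and z
  have e [measurable]: "e n \<in> borel_measurable borel" for n
    unfolding e_def by (intro borel_measurable_continuous_onI continuous_intros)
  have ne [simp]: "cmod (e n z) = 1" for n z
    by (simp add: e_def)
  have ee: "e i z * cnj (e j z) = exp (\<i> * of_real (pi * real_of_int (int j - int i) * Im z))" for i j z
  proof -
    have "cnj (e j z) = exp (\<i> * of_real (pi * real j * Im z))"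
      by (simp add: e_def exp_cnj)
    then show ?thesis
      by (simp add: e_def algebra_simps flip: exp_add)
  qed
  have Sm [measurable]: "?S \<in> sets lborel" by simp
  have disk_S: "unit_disk \<subseteq> ?S"
  proof
    fix z :: complex assume "z \<in> unit_disk"
    then have "\<bar>Re z\<bar> < 1" "\<bar>Im z\<bar> < 1"
      using abs_Re_le_cmod[of z] abs_Im_le_cmod[of z] by auto
    then show "z \<in> ?S" by (auto simp: in_cbox_complex_iff abs_less_iff)
  qed
  have Mint: "(LINT z|?M. F z) = (LINT z|lborel. indicator ?S z * F z)" for F :: "complex \<Rightarrow> complex"
    by (subst integral_restrict_space) (simp_all add: scaleR_conv_of_real of_real_indicator)
  have fin: "emeasure lborel ?S < \<infinity>"
    by (rule emeasure_bounded_finite) simp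
  have fm: "finite_measure ?M"
    by (rule finite_measureI) (use fin in \<open>simp add: emeasure_restrict_space space_restrict_space\<close>)
  have eL2: "square_integrable ?M (e n)" for n
    unfolding square_integrable_def
  proof
    show "e n \<in> borel_measurable ?M"
      by (rule measurable_restrict_space1) simp
    show "integrable ?M (\<lambda>z. (cmod (e n z))\<^sup>2)"
      using finite_measure.integrable_const[OF fm, of "1 :: real"] by simp
  qed
  have orth: "(LINT z|?M. e i z * cnj (e j z)) = 0" if "i \<noteq> j" for i j
    unfolding Mint ee using integral_lborel_square_exp[of "int j - int i"] that by simp
  define c where "c = measure lborel ?S"
  have c: "c = 4"
  proof -
    have "0 \<in> ?S" by (simp add: in_cbox_complex_iff)
    then have "?S \<noteq> {}" by blast
    then show ?thesis
      unfolding c_def by (simp add: content_cbox_if Basis_complex_def inner_complex_def)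
  qed
  have norm1: "(LINT z|?M. e i z * cnj (e i z)) = of_real c" for i
  proof -
    have "(LINT z|?M. e i z * cnj (e i z)) = (LINT z|?M. 1)"
      unfolding ee by simp
    also have "\<dots> = of_real (measure ?M ?S)"
      by (simp add: space_restrict_space scaleR_conv_of_real)
    also have "measure ?M ?S = c"
      unfolding c_def by (rule measure_restrict_space) auto
    finally show ?thesis .
  qed
  have um: "u \<in> borel_measurable ?M"
    by (rule measurable_restrict_space1) simp
  have uL2: "square_integrable ?M u"
  proof -
    have "integrable dA (\<lambda>z. (cmod (w z))\<^sup>2)"
    proof (rule integrable_cong_AE_imp[OF square_integrableD(2)[OF v]])
      show "(\<lambda>z. (cmod (w z))\<^sup>2) \<in> borel_measurable dA"
        by (intro borel_measurable_dA) measurable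
      show "AE z in dA. (cmod (v z))\<^sup>2 = (cmod (w z))\<^sup>2"
        using vw by eventually_elim simp
    qed
    then have "integrable (lebesgue_on unit_disk) (\<lambda>z. (1 / pi) *\<^sub>R (cmod (w z))\<^sup>2)"
      unfolding dA_def
      by (subst (asm) integrable_density)
        (auto intro!: measurable_restrict_space1 measurable_completion)
    then have "integrable (lebesgue_on unit_disk) (\<lambda>z. pi * ((1 / pi) *\<^sub>R (cmod (w z))\<^sup>2))"
      by (rule integrable_mult_right)
    then have "integrable (lebesgue_on unit_disk) (\<lambda>z. (cmod (w z))\<^sup>2)"
      by simp
    then have "integrable lebesgue (\<lambda>z. indicator unit_disk z *\<^sub>R (cmod (w z))\<^sup>2)"
      by (subst (asm) integrable_restrict_space) auto
    then have "integrable lborel (\<lambda>z. indicator unit_disk z *\<^sub>R (cmod (w z))\<^sup>2)"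
      by (rule integrable_completion[THEN iffD1, rotated])
        (intro borel_measurable_scaleR borel_measurable_indicator; measurable)
    moreover have "indicator unit_disk z *\<^sub>R (cmod (w z))\<^sup>2 = indicator ?S z *\<^sub>R (cmod (u z))\<^sup>2" for z
      using disk_S by (auto simp: u_def indicator_def norm_mult)
    ultimately have "integrable ?M (\<lambda>z. (cmod (u z))\<^sup>2)"
      by (subst integrable_restrict_space) auto
    then show ?thesis using um by (simp add: square_integrable_def)
  qed
  define b where "b n = (LINT z|?M. u z * cnj (e n z))" for n
  have bd: "b n = of_real pi * (LINT z|dA. v z * exp (\<i> * of_real (pi * real n * Im z)))" for n
  proof -
    have cn: "cnj (e n z) = exp (\<i> * of_real (pi * real n * Im z))" for z
      by (simp add: e_def exp_cnj)
    have "b n = (LINT z|lborel. indicator unit_disk z * (w z * cnj (e n z)))"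
      unfolding b_def Mint using disk_S
      by (intro Bochner_Integration.integral_cong) (auto simp: u_def indicator_def)
    also have "\<dots> = of_real pi * (LINT z|dA. w z * cnj (e n z))"
      by (subst integral_dA_borel) auto
    also have "(LINT z|dA. w z * cnj (e n z)) = (LINT z|dA. v z * cnj (e n z))"
    proof (rule integral_cong_AE)
      show "AE z in dA. w z * cnj (e n z) = v z * cnj (e n z)"
        using vw by eventually_elim simp
      show "(\<lambda>z. w z * cnj (e n z)) \<in> borel_measurable dA"
        by (intro borel_measurable_dA) measurable
      show "(\<lambda>z. v z * cnj (e n z)) \<in> borel_measurable dA"
        by (intro borel_measurable_times square_integrableD(1)[OF v] borel_measurable_dA) measurable
    qed
    finally show ?thesis by (simp only: cn)
  qed
  have "summable (\<lambda>n. (cmod (b n))\<^sup>2 / c)"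
  proof (rule bounded_imp_summable)
    fix n
    show "(\<Sum>k\<le>n. (cmod (b k))\<^sup>2 / c) \<le> (LINT z|?M. (cmod (u z))\<^sup>2)"
      unfolding b_def
      by (rule Bessel_inequality[OF uL2]) (use eL2 orth norm1 c in auto)
  qed (simp add: c)
  then have "(\<lambda>n. (cmod (b n))\<^sup>2 / c) \<longlonglongrightarrow> 0"
    by (rule summable_LIMSEQ_zero)
  then have "(\<lambda>n. sqrt (c * ((cmod (b n))\<^sup>2 / c))) \<longlonglongrightarrow> sqrt (c * 0)"
    by (intro tendsto_intros)
  then have "(\<lambda>n. cmod (b n)) \<longlonglongrightarrow> 0"
    by (simp add: c)
  then have "b \<longlonglongrightarrow> 0"
    by (rule tendsto_norm_zero_cancel)
  then have "(\<lambda>n. b n / of_real pi) \<longlonglongrightarrow> 0 / of_real pi"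
    by (intro tendsto_intros) simp_all
  then show ?thesis
    by (simp add: bd)
qed

lemma holomorphic_on_minor:
  assumes "\<And>i j. (\<lambda>t. A t i j) holomorphic_on S"
  shows "(\<lambda>t. minor n (A t)) holomorphic_on S"
  unfolding minor_Leibniz by (intro holomorphic_intros assms)

lemma tendsto_minor:
  assumes "\<And>i j. ((\<lambda>t. A t i j) \<longlongrightarrow> B i j) F"
  shows "((\<lambda>t. minor n (A t)) \<longlongrightarrow> minor n B) F"
  unfolding minor_Leibniz by (intro tendsto_intros assms)

lemma minor_zero:
  assumes "n > 0"
  shows "minor n (\<lambda>i j. 0) = 0"
  unfolding minor_eq_0_iff using assms by (intro exI[of _ "\<lambda>_. 1"]) auto

text \<open>The right side is n! L^n, left as the sum over permutations that the Leibniz formula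
  produces.\<close>

lemma cmod_minor_le:
  assumes "\<And>i j. cmod (A i j) \<le> L"
  shows "cmod (minor n A) \<le> (\<Sum>p | p permutes {0..<n}. L ^ n)"
  unfolding minor_Leibniz
proof (rule sum_norm_le)
  fix p
  have "cmod (of_int (sign p) * (\<Prod>i = 0..<n. A i (p i))) = (\<Prod>i = 0..<n. cmod (A i (p i)))"
    by (simp add: norm_mult sign_def flip: prod_norm)
  also have "\<dots> \<le> (\<Prod>i = 0..<n. L)"
    by (intro prod_mono conjI norm_ge_zero assms)
  finally show "cmod (of_int (sign p) * (\<Prod>i = 0..<n. A i (p i))) \<le> L ^ n"
    by simp
qed

text \<open>Meant for \<open>L\<close> the identity or complex conjugation. On the disk |L z| = |z|
  < 1, so exp(R |L z|) is bounded for every R and the integral is entire in t.\<close>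

lemma exp_integral_dA:
  fixes v L :: "complex \<Rightarrow> complex"
  assumes v: "integrable dA v" and L: "L \<in> borel_measurable dA" "\<And>z. cmod (L z) = cmod z"
  shows exp_integral_dA_integrable: "integrable dA (\<lambda>z. v z * exp (t * L z))"
    and exp_integral_dA_sums:
      "(\<lambda>n. (LINT z|dA. v z * L z ^ n) / fact n * t ^ n) sums (LINT z|dA. v z * exp (t * L z))"
    and exp_integral_dA_entire: "(\<lambda>t. LINT z|dA. v z * exp (t * L z)) holomorphic_on UNIV"
proof -
  have [measurable]: "v \<in> borel_measurable dA" "L \<in> borel_measurable dA" using v L by auto
  have int: "integrable dA (\<lambda>z. cmod (v z) * exp (R * cmod (L z)))" if "R \<ge> 0" for R
  proof (rule Bochner_Integration.integrable_bound)
    show "integrable dA (\<lambda>z. cmod (v z) * exp R)" using v by simp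
    show "AE z in dA. norm (cmod (v z) * exp (R * cmod (L z))) \<le> norm (cmod (v z) * exp R)"
      using that by (intro AE_I2) (auto simp: L(2) abs_mult intro!: mult_left_mono mult_left_le)
  qed measurable
  note * = exp_integral_sums[OF _ _ int[of "cmod t"] order_refl]
  show "integrable dA (\<lambda>z. v z * exp (t * L z))"
    and "(\<lambda>n. (LINT z|dA. v z * L z ^ n) / fact n * t ^ n) sums (LINT z|dA. v z * exp (t * L z))"
    using * by auto
  have ball: "(\<lambda>t. LINT z|dA. v z * exp (t * L z)) holomorphic_on ball 0 R" if "R > 0" for R
    by (rule exp_integral_holomorphic_on_ball) (use int[of R] that in auto)
  have "(\<lambda>t. LINT z|dA. v z * exp (t * L z)) analytic_on UNIV"
    unfolding analytic_on_def
  proof (intro ballI)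
    fix c :: complex
    have "ball c 1 \<subseteq> ball 0 (cmod c + 1)"
      by (simp add: ball_subset_ball_iff)
    moreover have "(\<lambda>t. LINT z|dA. v z * exp (t * L z)) holomorphic_on ball 0 (cmod c + 1)"
      by (rule ball) (simp add: add_nonneg_pos)
    ultimately show "\<exists>e>0. (\<lambda>t. LINT z|dA. v z * exp (t * L z)) holomorphic_on ball c e"
      using holomorphic_on_subset by (intro exI[of _ 1]) auto
  qed
  then show "(\<lambda>t. LINT z|dA. v z * exp (t * L z)) holomorphic_on UNIV"
    by (rule analytic_imp_holomorphic)
qed

theorem Luecking:
  assumes u: "square_integrable dA u"
    and minors: "\<And>J K. minor N (\<lambda>i l. LINT z|dA. u z * z ^ J i * cnj z ^ K l) = 0"
  shows "AE z in dA. u z = 0"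
proof -
  define a where "a j k = (LINT z|dA. u z * z ^ j * cnj z ^ k)" for j k
  define P where "P n \<longleftrightarrow> (\<forall>J K. minor n (\<lambda>i l. a (J i) (K l)) = 0)" for n :: nat
  have "P N" using minors by (simp add: P_def a_def)
  moreover have "\<not> P 0" by (simp add: P_def)
  \<comment> \<open>\<open>m\<close> is the rank of the moment matrix: some minor of size m is
    nonzero, all of size m + 1 vanish. \<open>P 0\<close> fails because the empty determinant is
    1.\<close>
  ultimately obtain m where m: "P (Suc m)" "\<not> P m"
    using ex_least_nat_less[of P N] by blast
  then obtain J K where nz: "minor m (\<lambda>i l. a (J i) (K l)) \<noteq> 0"
    by (auto simp: P_def)
  have ui: "integrable dA u" by (rule square_integrable_dA_imp_integrable[OF u])
  have "m = 0"
  proof (rule ccontr)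
    assume "m \<noteq> 0"
    define M where "M = minor m (\<lambda>i l. a (J i) (K l))"
    obtain B where B: "\<And>j k. a j k = (\<Sum>l<m. a j (K l) * (\<Sum>i<m. B l i * a (J i) k))"
      "minor m B * M = 1"
      using rank_factorization[where a = a and J = J and K = K and n = m, OF nz] m(1)
      unfolding P_def M_def by blast
    \<comment> \<open>The right factor: in every row, the entry of column k is the combination of
      the entries of the columns \<open>K l\<close> with coefficients \<open>w l k\<close>.\<close>
    define w where "w l k = (\<Sum>i<m. B l i * a (J i) k)" for l k
    have uz: "integrable dA (\<lambda>z. u z * z ^ j * cnj z ^ k)" for j k
      by (rule integrable_monomial_mult[OF ui])
    have mz: "(\<lambda>z. z) \<in> borel_measurable dA" "cnj \<in> borel_measurable dA"
      by (auto intro!: continuous_on_imp_borel_measurable_dA continuous_intros)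
    \<comment> \<open>The factorization of the moments extends to exponentials, by expanding these into power series.\<close>
    define E1 where "E1 \<mu> j k = (LINT z|dA. u z * z ^ j * cnj z ^ k * exp (\<mu> * z))" for \<mu> j k
    define E3 where "E3 \<nu> j k = (LINT z|dA. u z * z ^ j * cnj z ^ k * exp (\<nu> * cnj z))" for \<nu> j k
    define E2 where "E2 \<mu> \<nu> j k = (LINT z|dA. u z * z ^ j * cnj z ^ k * exp (\<mu> * z) * exp (\<nu> * cnj z))" for \<mu> \<nu> j k
    have E1i: "integrable dA (\<lambda>z. u z * z ^ j * cnj z ^ k * exp (\<mu> * z))" for j k \<mu>
      by (rule exp_integral_dA_integrable[OF uz mz(1)]) simp
    have E1s: "(\<lambda>n. a (j + n) k / fact n * \<mu> ^ n) sums E1 \<mu> j k" for \<mu> j k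
    proof -
      have "(\<lambda>n. (LINT z|dA. u z * z ^ j * cnj z ^ k * z ^ n) / fact n * \<mu> ^ n) sums E1 \<mu> j k"
        unfolding E1_def by (rule exp_integral_dA_sums[OF uz mz(1)]) simp
      moreover have "(LINT z|dA. u z * z ^ j * cnj z ^ k * z ^ n) = a (j + n) k" for n
        by (simp add: a_def power_add mult_ac)
      ultimately show ?thesis by simp
    qed
    have E3s: "(\<lambda>n. a j (k + n) / fact n * \<nu> ^ n) sums E3 \<nu> j k" for \<nu> j k
    proof -
      have "(\<lambda>n. (LINT z|dA. u z * z ^ j * cnj z ^ k * cnj z ^ n) / fact n * \<nu> ^ n) sums E3 \<nu> j k"
        unfolding E3_def by (rule exp_integral_dA_sums[OF uz mz(2)]) simp
      moreover have "(LINT z|dA. u z * z ^ j * cnj z ^ k * cnj z ^ n) = a j (k + n)" for n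
        by (simp add: a_def power_add mult_ac)
      ultimately show ?thesis by simp
    qed
    have E2s: "(\<lambda>n. E1 \<mu> j (k + n) / fact n * \<nu> ^ n) sums E2 \<mu> \<nu> j k" for \<mu> \<nu> j k
    proof -
      have "(\<lambda>n. (LINT z|dA. u z * z ^ j * cnj z ^ k * exp (\<mu> * z) * cnj z ^ n) / fact n * \<nu> ^ n)
          sums E2 \<mu> \<nu> j k"
        unfolding E2_def by (rule exp_integral_dA_sums[OF E1i mz(2)]) simp
      moreover have "(LINT z|dA. u z * z ^ j * cnj z ^ k * exp (\<mu> * z) * cnj z ^ n) = E1 \<mu> j (k + n)" for n
        by (simp add: E1_def power_add mult_ac)
      ultimately show ?thesis by simp
    qed
    have E1w: "E1 \<mu> j k = (\<Sum>l<m. E1 \<mu> j (K l) * w l k)" for \<mu> j k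
    proof (rule sums_unique2[OF E1s])
      have "(\<lambda>n. \<Sum>l<m. a (j + n) (K l) / fact n * \<mu> ^ n * w l k) sums (\<Sum>l<m. E1 \<mu> j (K l) * w l k)"
        by (intro sums_sum sums_mult2 E1s)
      moreover have "(\<Sum>l<m. a (j + n) (K l) / fact n * \<mu> ^ n * w l k) = a (j + n) k / fact n * \<mu> ^ n" for n
      proof -
        have "a (j + n) k = (\<Sum>l<m. a (j + n) (K l) * w l k)"
          unfolding w_def by (rule B(1))
        then show ?thesis
          by (simp only: sum_distrib_right sum_divide_distrib)
            (intro sum.cong refl, simp)
      qed
      ultimately show "(\<lambda>n. a (j + n) k / fact n * \<mu> ^ n) sums (\<Sum>l<m. E1 \<mu> j (K l) * w l k)"
        by simp
    qed
    \<comment> \<open>The two expansions are made one after the other: each coefficient of the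
      series in \<nu> is an \<open>E1\<close> with second index k + n, to which the relation for
      \<open>E1\<close> applies.\<close>
    have E2w: "E2 \<mu> \<nu> j k = (\<Sum>l<m. E1 \<mu> j (K l) * (\<Sum>i<m. B l i * E3 \<nu> (J i) k))" for \<mu> \<nu> j k
    proof (rule sums_unique2[OF E2s])
      have "(\<lambda>n. \<Sum>l<m. E1 \<mu> j (K l) * (\<Sum>i<m. B l i * (a (J i) (k + n) / fact n * \<nu> ^ n)))
          sums (\<Sum>l<m. E1 \<mu> j (K l) * (\<Sum>i<m. B l i * E3 \<nu> (J i) k))"
        by (intro sums_sum sums_mult E3s)
      moreover have "(\<Sum>l<m. E1 \<mu> j (K l) * (\<Sum>i<m. B l i * (a (J i) (k + n) / fact n * \<nu> ^ n)))
          = E1 \<mu> j (k + n) / fact n * \<nu> ^ n" for n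
        unfolding E1w[of \<mu> j "k + n"] w_def
        by (simp only: sum_distrib_left sum_distrib_right sum_divide_distrib)
          (intro sum.cong refl, simp)
      ultimately show "(\<lambda>n. E1 \<mu> j (k + n) / fact n * \<nu> ^ n)
          sums (\<Sum>l<m. E1 \<mu> j (K l) * (\<Sum>i<m. B l i * E3 \<nu> (J i) k))"
        by simp
    qed
    define U where "U \<mu> = minor m (\<lambda>p l. E1 \<mu> (J p) (K l))" for \<mu>
    define V where "V \<nu> = minor m (\<lambda>i q. E3 \<nu> (J i) (K q))" for \<nu>
    define G where "G \<mu> \<nu> = minor m (\<lambda>p q. E2 \<mu> \<nu> (J p) (K q))" for \<mu> \<nu>
    have GUV: "G \<mu> \<nu> * M = U \<mu> * V \<nu>" for \<mu> \<nu>
    proof -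
      have "G \<mu> \<nu> = minor m (\<lambda>p q. \<Sum>l<m. E1 \<mu> (J p) (K l) * (\<Sum>i<m. B l i * E3 \<nu> (J i) (K q)))"
        unfolding G_def by (rule minor_cong) (rule E2w)
      also have "\<dots> = U \<mu> * (minor m B * V \<nu>)"
        unfolding U_def V_def by (simp only: minor_mult)
      finally have "G \<mu> \<nu> * M = U \<mu> * V \<nu> * (minor m B * M)"
        by (simp only: mult_ac)
      then show ?thesis
        by (simp only: B(2) mult_1_right)
    qed
    have UV0: "U 0 = M" "V 0 = M"
      by (simp_all add: U_def V_def M_def E1_def E3_def a_def)
    have "U holomorphic_on UNIV"
      unfolding U_def[abs_def] E1_def
      by (intro holomorphic_on_minor exp_integral_dA_entire uz mz) simp
    moreover have "(\<lambda>\<mu>. V (- \<mu>)) holomorphic_on UNIV"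
    proof -
      have "V holomorphic_on UNIV"
        unfolding V_def[abs_def] E3_def
        by (intro holomorphic_on_minor exp_integral_dA_entire uz mz) simp
      then have "(V \<circ> uminus) holomorphic_on UNIV"
        by (intro holomorphic_on_compose holomorphic_intros) (auto intro: holomorphic_on_subset)
      then show ?thesis by (simp add: o_def)
    qed
    \<comment> \<open>Conjugating both the argument and the value preserves holomorphy, so the
      function taking \<mu> to cnj(V(-cnj \<mu>)) is entire.\<close>
    then have "(cnj \<circ> (\<lambda>\<mu>. V (- \<mu>)) \<circ> cnj) holomorphic_on UNIV"
      by (intro holomorphic_on_compose_cnj_cnj) (auto intro: holomorphic_on_subset)
    ultimately have W: "(\<lambda>\<mu>. U \<mu> * cnj (V (- cnj \<mu>))) holomorphic_on UNIV"
      by (intro holomorphic_on_mult) (simp_all add: o_def)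
    define D where "D = (\<Sum>p | p permutes {0..<m}. (LINT z|dA. cmod (u z)) ^ m)"
    have GD: "cmod (G \<mu> (- cnj \<mu>)) \<le> D" for \<mu>
      unfolding G_def D_def
    proof (rule cmod_minor_le)
      fix p q
      have mono: "cmod (u z * z ^ J p * cnj z ^ K q * exp (\<mu> * z) * exp (- cnj \<mu> * cnj z)) \<le> cmod (u z)"
        if "z \<in> unit_disk" for z
      proof -
        \<comment> \<open>The exponents add up to \<mu> z minus its conjugate, which is purely
          imaginary.\<close>
        have "exp (\<mu> * z) * exp (- cnj \<mu> * cnj z) = exp (\<i> * of_real (2 * Im (\<mu> * z)))"
          using complex_diff_cnj[of "\<mu> * z"] by (simp add: mult.commute flip: exp_add)
        then have e1: "cmod (exp (\<mu> * z) * exp (- cnj \<mu> * cnj z)) = 1"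
          by simp
        have "cmod (z ^ J p * cnj z ^ K q) \<le> 1"
          using that by (simp add: norm_mult norm_power mult_le_one power_le_one)
        then have "cmod (u z) * cmod (z ^ J p * cnj z ^ K q) * cmod (exp (\<mu> * z) * exp (- cnj \<mu> * cnj z))
            \<le> cmod (u z)"
          unfolding e1 by (simp add: mult_left_le)
        then show ?thesis
          by (simp only: norm_mult mult.assoc)
      qed
      have i: "integrable dA (\<lambda>z. u z * z ^ J p * cnj z ^ K q * exp (\<mu> * z) * exp (- cnj \<mu> * cnj z))"
        by (rule exp_integral_dA_integrable[OF E1i mz(2)]) simp
      have "cmod (E2 \<mu> (- cnj \<mu>) (J p) (K q))
          \<le> (LINT z|dA. cmod (u z * z ^ J p * cnj z ^ K q * exp (\<mu> * z) * exp (- cnj \<mu> * cnj z)))"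
        unfolding E2_def by (rule integral_norm_bound)
      also have "\<dots> \<le> (LINT z|dA. cmod (u z))"
        using mono by (intro integral_mono integrable_norm i ui) simp
      finally show "cmod (E2 \<mu> (- cnj \<mu>) (J p) (K q)) \<le> (LINT z|dA. cmod (u z))" .
    qed
    have Wn: "cmod (U \<mu> * cnj (V (- cnj \<mu>))) = cmod (G \<mu> (- cnj \<mu>)) * cmod M" for \<mu>
      using arg_cong[OF GUV[of \<mu> "- cnj \<mu>"], of cmod] by (simp add: norm_mult)
    have "bounded (range (\<lambda>\<mu>. U \<mu> * cnj (V (- cnj \<mu>))))"
      unfolding bounded_iff
    proof (intro exI[of _ "D * cmod M"] ballI)
      fix x assume "x \<in> range (\<lambda>\<mu>. U \<mu> * cnj (V (- cnj \<mu>)))"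
      then obtain \<mu> where "x = U \<mu> * cnj (V (- cnj \<mu>))" by blast
      then show "cmod x \<le> D * cmod M"
        using GD[of \<mu>] by (simp only: Wn) (simp add: mult_right_mono)
    qed
    from Liouville_theorem[OF W this] obtain c where c: "\<And>\<mu>. U \<mu> * cnj (V (- cnj \<mu>)) = c"
      by (auto simp: constant_on_def)
    have "c = M * cnj M"
      using c[of 0] by (simp add: UV0)
    then have "cmod (G \<mu> (- cnj \<mu>)) * cmod M = cmod M * cmod M" for \<mu>
      using Wn[of \<mu>, symmetric] unfolding c by (simp add: norm_mult)
    moreover have M0: "M \<noteq> 0" using nz by (simp add: M_def)
    ultimately have GM: "cmod (G \<mu> (- cnj \<mu>)) = cmod M" for \<mu>
      by simp
    \<comment> \<open>For real \<mu> = s n the exponential becomes exp(i pi n Im z), as in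
      \<open>Riemann_Lebesgue_disk\<close>; the factor 1/2 compensates z - cnj z = 2 i Im z.\<close>
    define s where "s n = complex_of_real (pi * real n / 2)" for n :: nat
    have s_real: "cnj (s n) = s n" for n
      by (simp add: s_def)
    have E2lim: "(\<lambda>n. E2 (s n) (- cnj (s n)) j k) \<longlonglongrightarrow> 0" for j k
    proof -
      have "square_integrable dA (\<lambda>z. (z ^ j * cnj z ^ k) * u z)"
      proof (rule square_integrable_dA_bounded_mult[OF u, where C = 1])
        show "(\<lambda>z. z ^ j * cnj z ^ k) \<in> borel_measurable dA"
          by (intro continuous_on_imp_borel_measurable_dA continuous_intros)
        show "AE z in dA. cmod (z ^ j * cnj z ^ k) \<le> 1"
          by (intro AE_I2) (simp add: norm_mult norm_power mult_le_one power_le_one)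
      qed
      from Riemann_Lebesgue_disk[OF this]
      have "(\<lambda>n. LINT z|dA. z ^ j * cnj z ^ k * u z * exp (\<i> * of_real (pi * real n * Im z))) \<longlonglongrightarrow> 0" .
      moreover have "E2 (s n) (- cnj (s n)) j k
          = (LINT z|dA. z ^ j * cnj z ^ k * u z * exp (\<i> * of_real (pi * real n * Im z)))" for n
        unfolding E2_def
      proof (intro Bochner_Integration.integral_cong refl)
        fix z
        have "exp (s n * z) * exp (- cnj (s n) * cnj z) = exp (s n * (z - cnj z))"
          by (simp add: s_real right_diff_distrib flip: exp_add)
        also have "s n * (z - cnj z) = \<i> * of_real (pi * real n * Im z)"
          by (simp add: s_def complex_diff_cnj)
        finally show "u z * z ^ j * cnj z ^ k * exp (s n * z) * exp (- cnj (s n) * cnj z)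
            = z ^ j * cnj z ^ k * u z * exp (\<i> * of_real (pi * real n * Im z))"
          by (simp only: mult.assoc) (simp only: mult_ac)
      qed
      ultimately show ?thesis by simp
    qed
    have "(\<lambda>n. G (s n) (- cnj (s n))) \<longlonglongrightarrow> minor m (\<lambda>i j. 0)"
      unfolding G_def by (intro tendsto_minor E2lim)
    then have "(\<lambda>n. cmod (G (s n) (- cnj (s n)))) \<longlonglongrightarrow> cmod (minor m (\<lambda>i j. 0))"
      by (rule tendsto_norm)
    then have "cmod M = 0"
      unfolding GM using minor_zero[of m] \<open>m \<noteq> 0\<close> by (simp add: LIMSEQ_const_iff)
    with M0 show False by simp
  qed
  \<comment> \<open>Rank 0 means that all 1 by 1 minors, that is all moments, vanish.\<close>
  have "a j k = 0" for j k
  proof -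
    have "minor (Suc 0) (\<lambda>i l. a j k) = 0"
      using spec[OF spec[OF m(1)[unfolded P_def \<open>m = 0\<close>], of "\<lambda>_. j"], of "\<lambda>_. k"] .
    then show ?thesis by (simp add: minor_1)
  qed
  then have "annihilates_monomials u"
    using ui by (simp add: annihilates_monomials_def a_def)
  then show ?thesis
    by (rule annihilates_monomials_imp_AE_zero)
qed

section \<open>Zeros of Mellin transforms\<close>

lemma AE_dA_nonzero: "AE z in dA. z \<noteq> 0"
  unfolding AE_dA_iff using AE_lborel_singleton[of "0 :: complex"] by eventually_elim simp

lemma AE_dA_zero_if_norm2_mult:
  assumes "AE z in dA. f z * of_real ((cmod z)\<^sup>2) = 0"
  shows "AE z in dA. (f z :: complex) = 0"
  using assms AE_dA_nonzero by eventually_elim simp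

text \<open>The Mellin transform \<open>\<integral> v \<bar>z\<bar>\<^sup>2\<^sup>t\<close>. At \<open>z = 0\<close> the convention
  \<open>ln 0 = 0\<close> gives the integrand the value \<open>v 0\<close>, on a null set.\<close>

definition mellin_dA :: "(complex \<Rightarrow> complex) \<Rightarrow> complex \<Rightarrow> complex" where
  "mellin_dA v t = (LINT z|dA. v z * exp (t * of_real (2 * ln (cmod z))))"

lemma
  assumes "integrable dA v"
  shows mellin_dA_holomorphic: "mellin_dA v holomorphic_on {t. Re t > 0}"
    and mellin_dA_bound: "Re t > 0 \<Longrightarrow> cmod (mellin_dA v t) \<le> (LINT z|dA. cmod (v z))"
proof -
  have m: "(\<lambda>z. 2 * ln (cmod z)) \<in> borel_measurable dA"
    by (rule borel_measurable_dA) measurable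
  have "2 * ln (cmod z) \<le> 0" if "z \<in> space dA" for z
    using that by (cases "z = 0") auto
  from laplace_integral_holomorphic[OF assms m this] laplace_integral_bound[OF assms m this]
  show "mellin_dA v holomorphic_on {t. Re t > 0}"
    and "Re t > 0 \<Longrightarrow> cmod (mellin_dA v t) \<le> (LINT z|dA. cmod (v z))"
    by (simp_all add: mellin_dA_def[abs_def])
qed

lemma mellin_dA_of_nat:
  assumes v: "v \<in> borel_measurable dA" and n: "n > 0"
  shows "mellin_dA v (of_nat n) = (LINT z|dA. v z * of_real (cmod z ^ (2 * n)))"
  unfolding mellin_dA_def
proof (rule integral_cong_AE)
  show "(\<lambda>z. v z * exp (of_nat n * of_real (2 * ln (cmod z)))) \<in> borel_measurable dA"
    by (intro borel_measurable_times v borel_measurable_dA) measurable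
  show "(\<lambda>z. v z * of_real (cmod z ^ (2 * n))) \<in> borel_measurable dA"
    by (intro borel_measurable_times v borel_measurable_dA) measurable
  show "AE z in dA. v z * exp (of_nat n * of_real (2 * ln (cmod z))) = v z * of_real (cmod z ^ (2 * n))"
    using AE_dA_nonzero
  proof eventually_elim
    case (elim z)
    have "exp (complex_of_nat n * of_real (2 * ln (cmod z))) = of_real (exp (real (2 * n) * ln (cmod z)))"
      by (simp add: mult_ac flip: exp_of_real)
    also have "exp (real (2 * n) * ln (cmod z)) = cmod z ^ (2 * n)"
      using elim by (simp only: exp_of_nat_mult) simp
    finally show ?case by simp
  qed
qed

text \<open>Otherwise the uniqueness theorem makes the Mellin transform of g vanish at every
  positive integer. Together with the orthogonality for j \<noteq> k this kills all moments of g
  |z|^2, so g would be 0 almost everywhere.\<close>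

lemma reciprocal_summable_radial_symbol_zeros:
  assumes g: "g \<in> Linf" "radial g" "\<not> (AE z in dA. g z = 0)"
  shows "reciprocal_summable {m. radial_symbol g m = 0}"
proof (rule ccontr)
  assume Z: "\<not> reciprocal_summable {m. radial_symbol g m = 0}"
  obtain C where C: "g \<in> borel_measurable dA" "AE z in dA. cmod (g z) \<le> C"
    using LinfD[OF g(1)] by blast
  have gi: "integrable dA g"
    by (rule square_integrable_dA_imp_integrable[OF square_integrable_dA_bounded[OF C]])
  have zero: "(LINT z|dA. g z * of_real (cmod z ^ (2 * n))) = 0" if n: "n > 0" for n
  proof -
    have "mellin_dA g (of_real (real n)) = 0"
    proof (rule half_plane_uniqueness[OF mellin_dA_holomorphic[OF gi] mellin_dA_bound[OF gi] Z])
      fix m assume "m \<in> {m. radial_symbol g m = 0}" "m > 0"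
      then show "mellin_dA g (of_nat m) = 0"
        using monomial_norm2_pos[of m] mellin_dA_of_nat[OF C(1), of m]
        by (simp add: radial_symbol_def)
    qed (use n in auto)
    then show ?thesis
      using mellin_dA_of_nat[OF C(1) n] by simp
  qed
  \<comment> \<open>The extra factor z cnj z moves the diagonal moments from exponent j to j + 1,
    away from 0, which is not in the open half plane.\<close>
  have "(LINT z|dA. g z * z ^ 1 * cnj z ^ 1 * z ^ j * cnj z ^ k) = 0" for j k
  proof -
    have "(LINT z|dA. g z * z ^ 1 * cnj z ^ 1 * z ^ j * cnj z ^ k) = (LINT z|dA. g z * z ^ Suc j * cnj z ^ Suc k)"
      by (simp add: mult_ac)
    also have "\<dots> = 0"
    proof (cases "j = k")
      case True
      have "(LINT z|dA. g z * z ^ Suc j * cnj z ^ Suc j) = (LINT z|dA. g z * of_real (cmod z ^ (2 * Suc j)))"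
        by (simp only: mult.assoc power_mult_cnj_power)
      then show ?thesis using zero[of "Suc j"] True by simp
    next
      case False
      then show ?thesis
        using radial_orthogonal_monomials[OF C(1) g(2), of "Suc j" "Suc k"] by simp
    qed
    finally show ?thesis .
  qed
  then have "annihilates_monomials (\<lambda>z. g z * z ^ 1 * cnj z ^ 1)"
    using integrable_monomial_mult[OF gi, of 1 1] unfolding annihilates_monomials_def by blast
  then have "AE z in dA. g z * z ^ 1 * cnj z ^ 1 = 0"
    by (rule annihilates_monomials_imp_AE_zero)
  then have "AE z in dA. g z = 0"
    using AE_dA_nonzero by eventually_elim simp
  with g(3) show False by blast
qed

text \<open>Arbitrary \<open>J\<close> and \<open>K\<close> are reached by moving all indices
  jointly by t: the integers t that make them admissible are too many for a nonzero bounded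
  holomorphic function to vanish at, so the minor vanishes at t = 1 as well, admissible or
  not.\<close>

lemma minors_zero_shift:
  assumes f: "square_integrable dA f" and bad: "reciprocal_summable bad"
    and zero: "\<And>J K. (\<And>i. i < N \<Longrightarrow> J i \<notin> bad) \<Longrightarrow> (\<And>i. i < N \<Longrightarrow> K i \<notin> bad) \<Longrightarrow>
      minor N (\<lambda>i l. LINT z|dA. f z * z ^ J i * cnj z ^ K l) = 0"
  shows "minor N (\<lambda>i l. LINT z|dA. (f z * of_real ((cmod z)\<^sup>2)) * z ^ J i * cnj z ^ K l) = 0"
proof -
  have fi: "integrable dA f" by (rule square_integrable_dA_imp_integrable[OF f])
  define v where "v i l z = f z * z ^ J i * cnj z ^ K l" for i l z
  have vi: "integrable dA (v i l)" for i l
    unfolding v_def by (rule integrable_monomial_mult[OF fi])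
  define \<Phi> where "\<Phi> t = minor N (\<lambda>i l. mellin_dA (v i l) t)" for t
  have \<Phi>_nat: "\<Phi> (of_nat t) = minor N (\<lambda>i l. LINT z|dA. f z * z ^ (J i + t) * cnj z ^ (K l + t))"
    if "t > 0" for t
    unfolding \<Phi>_def
  proof (rule minor_cong)
    fix i l
    have "mellin_dA (v i l) (of_nat t) = (LINT z|dA. v i l z * (z ^ t * cnj z ^ t))"
      unfolding power_mult_cnj_power using vi that by (intro mellin_dA_of_nat) auto
    then show "mellin_dA (v i l) (of_nat t) = (LINT z|dA. f z * z ^ (J i + t) * cnj z ^ (K l + t))"
      by (simp add: v_def power_add mult_ac)
  qed
  define good where "good = {t. \<forall>i<N. t + J i \<notin> bad \<and> t + K i \<notin> bad}"
  have ngood: "\<not> reciprocal_summable good"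
  proof
    assume good: "reciprocal_summable good"
    \<comment> \<open>The t outside \<open>good\<close> lie in finitely many shifts of
      \<open>bad\<close>. If \<open>good\<close> were sparse too, so would be the set of all natural
      numbers, against the divergence of the harmonic series.\<close>
    have "reciprocal_summable (\<Union>i\<in>{..<N}. {t. t + J i \<in> bad} \<union> {t. t + K i \<in> bad})"
      by (intro reciprocal_summable_UN reciprocal_summable_Un reciprocal_summable_shift bad) simp
    from reciprocal_summable_Un[OF good this] have "reciprocal_summable UNIV"
      by (rule back_subst[of reciprocal_summable]) (auto simp: good_def)
    then show False
      using not_reciprocal_summable_UNIV by blast
  qed
  \<comment> \<open>The value at t = 1 raises all indices by one, which amounts to the weight
    |z|^2.\<close>
  have "\<Phi> (of_real 1) = 0"
  proof (rule half_plane_uniqueness[OF _ _ ngood])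
    show "\<Phi> holomorphic_on {t. Re t > 0}"
      unfolding \<Phi>_def[abs_def] by (intro holomorphic_on_minor mellin_dA_holomorphic vi)
    show "cmod (\<Phi> t) \<le> (\<Sum>p | p permutes {0..<N}. (LINT z|dA. cmod (f z)) ^ N)" if "Re t > 0" for t
      unfolding \<Phi>_def
    proof (rule cmod_minor_le)
      fix i l
      have "cmod (mellin_dA (v i l) t) \<le> (LINT z|dA. cmod (v i l z))"
        by (rule mellin_dA_bound[OF vi that])
      also have "\<dots> \<le> (LINT z|dA. cmod (f z))"
      proof (rule integral_mono)
        fix z assume "z \<in> space dA"
        then have "cmod (z ^ J i * cnj z ^ K l) \<le> 1"
          by (simp add: norm_mult norm_power mult_le_one power_le_one)
        then have "cmod (f z) * cmod (z ^ J i * cnj z ^ K l) \<le> cmod (f z)"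
          by (simp add: mult_left_le)
        then show "cmod (v i l z) \<le> cmod (f z)"
          by (simp only: v_def norm_mult mult.assoc)
      qed (use vi fi in auto)
      finally show "cmod (mellin_dA (v i l) t) \<le> (LINT z|dA. cmod (f z))" .
    qed
    show "\<Phi> (of_nat t) = 0" if "t \<in> good" "t > 0" for t
      unfolding \<Phi>_nat[OF that(2)]
      by (rule zero) (use that(1) in \<open>auto simp: good_def add.commute\<close>)
  qed simp
  then have "minor N (\<lambda>i l. LINT z|dA. f z * z ^ (J i + 1) * cnj z ^ (K l + 1)) = 0"
    using \<Phi>_nat[of 1] by simp
  moreover have eq: "(f z * of_real ((cmod z)\<^sup>2)) * z ^ J i * cnj z ^ K l
      = f z * z ^ (J i + 1) * cnj z ^ (K l + 1)" for z i l
    unfolding complex_norm_square by (simp add: mult_ac)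
  ultimately show ?thesis
    by (simp only: eq)
qed

theorem theorem3p3:
  fixes fs gs :: "(complex \<Rightarrow> complex) list" and f :: "complex \<Rightarrow> complex"
  assumes "fs \<noteq> []" and "gs \<noteq> []"
    and "\<And>h. h \<in> set fs \<union> set gs \<Longrightarrow> h \<in> Linf \<and> radial h \<and> \<not> (AE z in dA. h z = 0)"
    and "f \<in> L2"
    and "finite_rank_on disk_polynomials
           (\<lambda>\<phi>. foldr toeplitz gs (toeplitz f (foldr toeplitz fs \<phi>)))"
  shows "AE z in dA. f z = 0"
proof -
  note h = assms(3) and f = assms(4) and fr = assms(5)
  have f2: "square_integrable dA f" using f by (simp add: mem_L2_iff)
  have hf: "\<And>h. h \<in> set fs \<Longrightarrow> h \<in> Linf \<and> radial h" and hg: "\<And>h. h \<in> set gs \<Longrightarrow> h \<in> Linf \<and> radial h"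
    using h by auto
  \<comment> \<open>Outside this set the eigenvalues of all the radial factors are nonzero; it is
    sparse as a finite union of sparse zero sets.\<close>
  define bad where "bad = (\<Union>h\<in>set fs \<union> set gs. {m. radial_symbol h m = 0})"
  have bad: "reciprocal_summable bad"
    unfolding bad_def
    by (intro reciprocal_summable_UN reciprocal_summable_radial_symbol_zeros) (use h in auto)
  have \<alpha>: "(\<Prod>h\<leftarrow>fs. radial_symbol h j) \<noteq> 0" and \<beta>: "(\<Prod>h\<leftarrow>gs. radial_symbol h j) \<noteq> 0"
    if "j \<notin> bad" for j
    using that by (auto simp: bad_def prod_list_zero_iff)
  obtain N where N: "\<And>J K. (\<And>i. i < N \<Longrightarrow> (\<Prod>h\<leftarrow>fs. radial_symbol h (J i)) \<noteq> 0) \<Longrightarrow>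
      (\<And>i. i < N \<Longrightarrow> (\<Prod>h\<leftarrow>gs. radial_symbol h (K i)) \<noteq> 0) \<Longrightarrow>
      minor N (\<lambda>i l. LINT z|dA. f z * z ^ J i * cnj z ^ K l) = 0"
    using finite_rank_imp_minors_zero[OF fr toeplitz_product_monomial(1)[OF hf hg f]
        toeplitz_product_monomial(2)[OF hf hg f]] by blast
  have "AE z in dA. f z * of_real ((cmod z)\<^sup>2) = 0"
  proof (rule Luecking)
    have "square_integrable dA (\<lambda>z. of_real ((cmod z)\<^sup>2) * f z)"
      by (rule square_integrable_dA_bounded_mult[OF f2, where C = 1])
        (auto intro!: continuous_on_imp_borel_measurable_dA continuous_intros AE_I2
          simp: norm_power power_le_one)
    then show "square_integrable dA (\<lambda>z. f z * of_real ((cmod z)\<^sup>2))"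
      by (simp add: mult.commute)
    show "minor N (\<lambda>i l. LINT z|dA. (f z * of_real ((cmod z)\<^sup>2)) * z ^ J i * cnj z ^ K l) = 0" for J K
      by (rule minors_zero_shift[OF f2 bad]) (intro N \<alpha> \<beta>)
  qed
  then show ?thesis
    by (rule AE_dA_zero_if_norm2_mult)
qed

end
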